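(* Let $\mathcal{A}$ be a locally noetherian Grothendieck category. Then the injective spectrum $\mathrm{InjSpec}(\mathcal{A})$ is sober in its Ziegler topology.
   Context: A Grothendieck category is locally noetherian if it has a generating set of noetherian objects. $\mathrm{InjSpec}(\mathcal{A})$ is the set of isomorphism classes of indecomposable injective objects of $\mathcal{A}$. For a finitely presented object $A$ of $\mathcal{A}$, $(A)$ denotes the set of $E\in\mathrm{InjSpec}(\mathcal{A})$ admitting a non-zero morphism $A\to E$. The Ziegler topology on $\mathrm{InjSpec}(\mathcal{A})$ is the topology having the sets $(A)$, for $A$ finitely presented, as a basis of open sets. A space is sober if every (non-empty) irreducible closed set is the closure of a unique point. *)

theory Defs
  imports
    "HOL-Library.Equipollence"
    "HOL-Algebra.Group"
    "HOL-Analysis.Abstract_Topology"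
begin

section \<open>Smallness\<close>

text \<open>
  Set-theoretic size (set versus proper class) is expressed relative to a Grothendieck universe
  \<open>U\<close>, given only through its cardinality: an uncountable strongly inaccessible one. A collection
  of any type is small if it has strictly fewer elements than \<open>U\<close>. HOL itself does not prove that
  such a type exists; the type of ZFC sets from the AFP entry \<open>ZFC_in_HOL\<close> is an example, and
  there smallness is the usual one.
\<close>

definition small :: "'u set \<Rightarrow> 'a set \<Rightarrow> bool" where
  "small U X \<longleftrightarrow> X \<prec> U"

definition universe :: "'u set \<Rightarrow> bool" where
  "universe U \<longleftrightarrow>
     uncountable U \<and>
     (\<forall>X\<subseteq>U. small U X \<longrightarrow> small U (Pow X)) \<and>
     (\<forall>I\<subseteq>U. \<forall>F::'u \<Rightarrow> 'u set.
        small U I \<and> (\<forall>i\<in>I. F i \<subseteq> U \<and> small U (F i)) \<longrightarrow> small U (\<Union>i\<in>I. F i))"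


section \<open>Preadditive categories\<close>

text \<open>
  \<open>Plus\<close> is only meaningful on parallel arrows. There is no smallness restriction on \<open>Obj\<close>.
\<close>

record ('o, 'm) cat =
  Obj :: "'o set"
  Arr :: "'m set"
  Dom :: "'m \<Rightarrow> 'o"
  Cod :: "'m \<Rightarrow> 'o"
  Ident :: "'o \<Rightarrow> 'm"
  Comp :: "'m \<Rightarrow> 'm \<Rightarrow> 'm"  (infixl "\<bullet>\<index>" 70)
  Plus :: "'m \<Rightarrow> 'm \<Rightarrow> 'm"  (infixl "\<^bold>+\<index>" 65)
  Zero :: "'o \<Rightarrow> 'o \<Rightarrow> 'm"

definition Hom :: "('o, 'm) cat \<Rightarrow> 'o \<Rightarrow> 'o \<Rightarrow> 'm set" where
  "Hom C A B = {f \<in> Arr C. Dom C f = A \<and> Cod C f = B}"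

locale category =
  fixes C :: "('o, 'm) cat" (structure)
  assumes Dom_in_Obj: "f \<in> Arr C \<Longrightarrow> Dom C f \<in> Obj C"
    and Cod_in_Obj: "f \<in> Arr C \<Longrightarrow> Cod C f \<in> Obj C"
    and Ident_in_Hom: "A \<in> Obj C \<Longrightarrow> Ident C A \<in> Hom C A A"
    and Comp_in_Hom: "\<lbrakk>f \<in> Hom C A B; g \<in> Hom C B D\<rbrakk> \<Longrightarrow> g \<bullet> f \<in> Hom C A D"
    and Comp_Ident: "f \<in> Hom C A B \<Longrightarrow> f \<bullet> Ident C A = f"
    and Ident_Comp: "f \<in> Hom C A B \<Longrightarrow> Ident C B \<bullet> f = f"
    and Comp_assoc: "\<lbrakk>f \<in> Hom C A B; g \<in> Hom C B D; h \<in> Hom C D E\<rbrakk>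
           \<Longrightarrow> (h \<bullet> g) \<bullet> f = h \<bullet> (g \<bullet> f)"

locale preadditive_category = category C for C :: "('o, 'm) cat" (structure) +
  assumes Hom_comm_group: "\<lbrakk>A \<in> Obj C; B \<in> Obj C\<rbrakk>
           \<Longrightarrow> comm_group \<lparr>carrier = Hom C A B, monoid.mult = Plus C, one = Zero C A B\<rparr>"
    and Comp_Plus: "\<lbrakk>f \<in> Hom C A B; f' \<in> Hom C A B; g \<in> Hom C B D\<rbrakk>
           \<Longrightarrow> g \<bullet> (f \<^bold>+ f') = (g \<bullet> f) \<^bold>+ (g \<bullet> f')"
    and Plus_Comp: "\<lbrakk>f \<in> Hom C A B; g \<in> Hom C B D; g' \<in> Hom C B D\<rbrakk>
           \<Longrightarrow> (g \<^bold>+ g') \<bullet> f = (g \<bullet> f) \<^bold>+ (g' \<bullet> f)"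

context
  fixes C :: "('o, 'm) cat" (structure)
begin

definition is_mono :: "'m \<Rightarrow> bool" where
  "is_mono f \<longleftrightarrow> f \<in> Arr C \<and>
     (\<forall>g\<in>Arr C. \<forall>h\<in>Arr C. Dom C g = Dom C h \<and> Cod C g = Dom C f \<and> Cod C h = Dom C f
        \<and> f \<bullet> g = f \<bullet> h \<longrightarrow> g = h)"

definition is_epi :: "'m \<Rightarrow> bool" where
  "is_epi f \<longleftrightarrow> f \<in> Arr C \<and>
     (\<forall>g\<in>Arr C. \<forall>h\<in>Arr C. Cod C g = Cod C h \<and> Dom C g = Cod C f \<and> Dom C h = Cod C f
        \<and> g \<bullet> f = h \<bullet> f \<longrightarrow> g = h)"

definition isomorphic :: "'o \<Rightarrow> 'o \<Rightarrow> bool" where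
  "isomorphic A B \<longleftrightarrow> A \<in> Obj C \<and> B \<in> Obj C \<and>
     (\<exists>f\<in>Hom C A B. \<exists>g\<in>Hom C B A. g \<bullet> f = Ident C A \<and> f \<bullet> g = Ident C B)"

definition is_zero_object :: "'o \<Rightarrow> bool" where
  "is_zero_object Z \<longleftrightarrow> Z \<in> Obj C \<and>
     (\<forall>A\<in>Obj C. (\<exists>!f. f \<in> Hom C A Z) \<and> (\<exists>!f. f \<in> Hom C Z A))"

definition is_biproduct :: "'o \<Rightarrow> 'o \<Rightarrow> 'o \<Rightarrow> bool" where
  "is_biproduct S A B \<longleftrightarrow>
     (\<exists>i\<in>Hom C A S. \<exists>j\<in>Hom C B S. \<exists>p\<in>Hom C S A. \<exists>q\<in>Hom C S B.
        p \<bullet> i = Ident C A \<and> q \<bullet> j = Ident C B \<and> p \<bullet> j = Zero C B A \<and> q \<bullet> i = Zero C A B \<and>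
        (i \<bullet> p) \<^bold>+ (j \<bullet> q) = Ident C S)"

definition is_kernel :: "'m \<Rightarrow> 'm \<Rightarrow> bool" where
  "is_kernel k f \<longleftrightarrow> k \<in> Arr C \<and> f \<in> Arr C \<and> Cod C k = Dom C f \<and>
     f \<bullet> k = Zero C (Dom C k) (Cod C f) \<and>
     (\<forall>g\<in>Arr C. Cod C g = Dom C f \<and> f \<bullet> g = Zero C (Dom C g) (Cod C f) \<longrightarrow>
        (\<exists>!h. h \<in> Hom C (Dom C g) (Dom C k) \<and> k \<bullet> h = g))"

definition is_cokernel :: "'m \<Rightarrow> 'm \<Rightarrow> bool" where
  "is_cokernel c f \<longleftrightarrow> c \<in> Arr C \<and> f \<in> Arr C \<and> Dom C c = Cod C f \<and>
     c \<bullet> f = Zero C (Dom C f) (Cod C c) \<and>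
     (\<forall>g\<in>Arr C. Dom C g = Cod C f \<and> g \<bullet> f = Zero C (Dom C f) (Cod C g) \<longrightarrow>
        (\<exists>!h. h \<in> Hom C (Cod C c) (Cod C g) \<and> h \<bullet> c = g))"

definition short_exact :: "'m \<Rightarrow> 'm \<Rightarrow> bool" where
  "short_exact f g \<longleftrightarrow> is_kernel f g \<and> is_cokernel g f"

end


section \<open>Coproducts and directed colimits\<close>

context
  fixes C :: "('o, 'm) cat" (structure)
begin

definition is_coproduct :: "'i set \<Rightarrow> ('i \<Rightarrow> 'o) \<Rightarrow> 'o \<Rightarrow> ('i \<Rightarrow> 'm) \<Rightarrow> bool" where
  "is_coproduct I X S s \<longleftrightarrow> S \<in> Obj C \<and> (\<forall>i\<in>I. s i \<in> Hom C (X i) S) \<and>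
     (\<forall>T\<in>Obj C. \<forall>t. (\<forall>i\<in>I. t i \<in> Hom C (X i) T) \<longrightarrow>
        (\<exists>!h. h \<in> Hom C S T \<and> (\<forall>i\<in>I. h \<bullet> s i = t i)))"

definition directed_system ::
    "'i set \<Rightarrow> ('i \<Rightarrow> 'i \<Rightarrow> bool) \<Rightarrow> ('i \<Rightarrow> 'o) \<Rightarrow> ('i \<Rightarrow> 'i \<Rightarrow> 'm) \<Rightarrow> bool" where
  "directed_system I leq X x \<longleftrightarrow>
     I \<noteq> {} \<and> (\<forall>i\<in>I. leq i i) \<and>
     (\<forall>i\<in>I. \<forall>j\<in>I. \<forall>k\<in>I. leq i j \<and> leq j k \<longrightarrow> leq i k) \<and>
     (\<forall>i\<in>I. \<forall>j\<in>I. \<exists>k\<in>I. leq i k \<and> leq j k) \<and>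
     (\<forall>i\<in>I. X i \<in> Obj C \<and> x i i = Ident C (X i)) \<and>
     (\<forall>i\<in>I. \<forall>j\<in>I. leq i j \<longrightarrow> x i j \<in> Hom C (X i) (X j)) \<and>
     (\<forall>i\<in>I. \<forall>j\<in>I. \<forall>k\<in>I. leq i j \<and> leq j k \<longrightarrow> x j k \<bullet> x i j = x i k)"

definition is_cocone ::
    "'i set \<Rightarrow> ('i \<Rightarrow> 'i \<Rightarrow> bool) \<Rightarrow> ('i \<Rightarrow> 'o) \<Rightarrow> ('i \<Rightarrow> 'i \<Rightarrow> 'm) \<Rightarrow> 'o \<Rightarrow> ('i \<Rightarrow> 'm) \<Rightarrow> bool" where
  "is_cocone I leq X x L l \<longleftrightarrow> L \<in> Obj C \<and> (\<forall>i\<in>I. l i \<in> Hom C (X i) L) \<and>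
     (\<forall>i\<in>I. \<forall>j\<in>I. leq i j \<longrightarrow> l j \<bullet> x i j = l i)"

definition is_directed_colimit ::
    "'i set \<Rightarrow> ('i \<Rightarrow> 'i \<Rightarrow> bool) \<Rightarrow> ('i \<Rightarrow> 'o) \<Rightarrow> ('i \<Rightarrow> 'i \<Rightarrow> 'm) \<Rightarrow> 'o \<Rightarrow> ('i \<Rightarrow> 'm) \<Rightarrow> bool" where
  "is_directed_colimit I leq X x L l \<longleftrightarrow>
     directed_system I leq X x \<and> is_cocone I leq X x L l \<and>
     (\<forall>T t. is_cocone I leq X x T t \<longrightarrow> (\<exists>!h. h \<in> Hom C L T \<and> (\<forall>i\<in>I. h \<bullet> l i = t i)))"

definition system_map ::
    "'i set \<Rightarrow> ('i \<Rightarrow> 'i \<Rightarrow> bool) \<Rightarrow> ('i \<Rightarrow> 'o) \<Rightarrow> ('i \<Rightarrow> 'i \<Rightarrow> 'm) \<Rightarrow>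
     ('i \<Rightarrow> 'o) \<Rightarrow> ('i \<Rightarrow> 'i \<Rightarrow> 'm) \<Rightarrow> ('i \<Rightarrow> 'm) \<Rightarrow> bool" where
  "system_map I leq X x Y y f \<longleftrightarrow> (\<forall>i\<in>I. f i \<in> Hom C (X i) (Y i)) \<and>
     (\<forall>i\<in>I. \<forall>j\<in>I. leq i j \<longrightarrow> f j \<bullet> x i j = y i j \<bullet> f i)"

end


section \<open>Grothendieck categories\<close>

locale abelian_category = preadditive_category C for C :: "('o, 'm) cat" (structure) +
  assumes zero_object: "\<exists>Z. is_zero_object C Z"
    and biproducts: "\<lbrakk>A \<in> Obj C; B \<in> Obj C\<rbrakk> \<Longrightarrow> \<exists>S\<in>Obj C. is_biproduct C S A B"
    and kernels: "f \<in> Arr C \<Longrightarrow> \<exists>k. is_kernel C k f"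
    and cokernels: "f \<in> Arr C \<Longrightarrow> \<exists>c. is_cokernel C c f"
    and mono_normal: "is_mono C f \<Longrightarrow> \<exists>g. is_kernel C f g"
    and epi_normal: "is_epi C f \<Longrightarrow> \<exists>g. is_cokernel C f g"

definition generating_set :: "'u set \<Rightarrow> ('o, 'm) cat \<Rightarrow> 'o set \<Rightarrow> bool" where
  "generating_set U C \<G> \<longleftrightarrow> \<G> \<subseteq> Obj C \<and> small U \<G> \<and>
     (\<forall>A\<in>Obj C. \<forall>B\<in>Obj C. \<forall>f\<in>Hom C A B. \<forall>g\<in>Hom C A B. f \<noteq> g \<longrightarrow>
        (\<exists>G\<in>\<G>. \<exists>h\<in>Hom C G A. f \<bullet>\<^bsub>C\<^esub> h \<noteq> g \<bullet>\<^bsub>C\<^esub> h))"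

text \<open>
  Every small family is, up to reindexing, one indexed by a small subset of the element type of
  \<open>U\<close>, so it suffices to index by those.
\<close>

locale grothendieck_category = abelian_category C
  for U :: "'u set" and C :: "('o, 'm) cat" (structure) +
  assumes universe: "universe U"
    and locally_small: "\<lbrakk>A \<in> Obj C; B \<in> Obj C\<rbrakk> \<Longrightarrow> small U (Hom C A B)"
    and coproducts: "\<And>(I::'u set) X. \<lbrakk>small U I; \<forall>i\<in>I. X i \<in> Obj C\<rbrakk>
           \<Longrightarrow> \<exists>S s. is_coproduct C I X S s"
    and directed_colimits_exact:
      "\<And>(I::'u set) leq X x L l Y y M m Z z N n f g u v.
         \<lbrakk>small U I;
          is_directed_colimit C I leq X x L l;
          is_directed_colimit C I leq Y y M m;
          is_directed_colimit C I leq Z z N n;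
          system_map C I leq X x Y y f; system_map C I leq Y y Z z g;
          \<forall>i\<in>I. short_exact C (f i) (g i);
          u \<in> Hom C L M; \<forall>i\<in>I. u \<bullet> l i = m i \<bullet> f i;
          v \<in> Hom C M N; \<forall>i\<in>I. v \<bullet> m i = n i \<bullet> g i\<rbrakk>
         \<Longrightarrow> short_exact C u v"
    and generator: "\<exists>G. generating_set U C {G}"


section \<open>Noetherian and finitely presented objects\<close>

text \<open>
  Subobjects of \<open>A\<close> are represented by monomorphisms into \<open>A\<close>; two of them are the same subobject
  if each factors through the other.
\<close>

definition subobject_le :: "('o, 'm) cat \<Rightarrow> 'm \<Rightarrow> 'm \<Rightarrow> bool" where
  "subobject_le C m n \<longleftrightarrow> (\<exists>h\<in>Hom C (Dom C m) (Dom C n). n \<bullet>\<^bsub>C\<^esub> h = m)"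

definition noetherian :: "('o, 'm) cat \<Rightarrow> 'o \<Rightarrow> bool" where
  "noetherian C A \<longleftrightarrow> A \<in> Obj C \<and>
     (\<forall>s::nat \<Rightarrow> 'm.
        (\<forall>n. is_mono C (s n) \<and> Cod C (s n) = A \<and> subobject_le C (s n) (s (Suc n))) \<longrightarrow>
        (\<exists>N. \<forall>n\<ge>N. subobject_le C (s n) (s N) \<and> subobject_le C (s N) (s n)))"

definition locally_noetherian :: "'u set \<Rightarrow> ('o, 'm) cat \<Rightarrow> bool" where
  "locally_noetherian U C \<longleftrightarrow> (\<exists>\<G>. generating_set U C \<G> \<and> (\<forall>G\<in>\<G>. noetherian C G))"

text \<open>
  The functor \<open>Hom(A, -)\<close> preserves small directed colimits. The two conjuncts are surjectivity
  and injectivity of the canonical map from the directed colimit of the sets \<open>Hom(A, X i)\<close> to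
  \<open>Hom(A, L)\<close>.
\<close>

definition finitely_presented :: "'u set \<Rightarrow> ('o, 'm) cat \<Rightarrow> 'o \<Rightarrow> bool" where
  "finitely_presented U C A \<longleftrightarrow> A \<in> Obj C \<and>
     (\<forall>(I::'u set) leq X x L l. small U I \<and> is_directed_colimit C I leq X x L l \<longrightarrow>
        (\<forall>f\<in>Hom C A L. \<exists>i\<in>I. \<exists>g\<in>Hom C A (X i). l i \<bullet>\<^bsub>C\<^esub> g = f) \<and>
        (\<forall>i\<in>I. \<forall>j\<in>I. \<forall>g\<in>Hom C A (X i). \<forall>h\<in>Hom C A (X j). l i \<bullet>\<^bsub>C\<^esub> g = l j \<bullet>\<^bsub>C\<^esub> h \<longrightarrow>
           (\<exists>k\<in>I. leq i k \<and> leq j k \<and> x i k \<bullet>\<^bsub>C\<^esub> g = x j k \<bullet>\<^bsub>C\<^esub> h)))"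


section \<open>The injective spectrum and its Ziegler topology\<close>

definition injective_object :: "('o, 'm) cat \<Rightarrow> 'o \<Rightarrow> bool" where
  "injective_object C E \<longleftrightarrow> E \<in> Obj C \<and>
     (\<forall>m. is_mono C m \<longrightarrow>
        (\<forall>f\<in>Hom C (Dom C m) E. \<exists>g\<in>Hom C (Cod C m) E. g \<bullet>\<^bsub>C\<^esub> m = f))"

definition indecomposable :: "('o, 'm) cat \<Rightarrow> 'o \<Rightarrow> bool" where
  "indecomposable C E \<longleftrightarrow> E \<in> Obj C \<and> \<not> is_zero_object C E \<and>
     (\<forall>A\<in>Obj C. \<forall>B\<in>Obj C. is_biproduct C E A B \<longrightarrow> is_zero_object C A \<or> is_zero_object C B)"

definition InjSpec :: "('o, 'm) cat \<Rightarrow> 'o set set" where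
  "InjSpec C = {E. injective_object C E \<and> indecomposable C E} // {(A, B). isomorphic C A B}"

definition ziegler_basic :: "('o, 'm) cat \<Rightarrow> 'o \<Rightarrow> 'o set set" where
  "ziegler_basic C A = {e \<in> InjSpec C. \<exists>E\<in>e. \<exists>f\<in>Hom C A E. f \<noteq> Zero C A E}"

text \<open>
  The open sets are exactly the unions of basic sets. That these form a topology, with underlying
  set \<open>InjSpec C\<close>, is a theorem about locally noetherian categories and not part of the definition.
\<close>

definition ziegler_topology :: "'u set \<Rightarrow> ('o, 'm) cat \<Rightarrow> 'o set topology" where
  "ziegler_topology U C =
     topology (arbitrary union_of (\<lambda>V. \<exists>A. finitely_presented U C A \<and> V = ziegler_basic C A))"

definition irreducible_closed_in :: "'a topology \<Rightarrow> 'a set \<Rightarrow> bool" where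
  "irreducible_closed_in T S \<longleftrightarrow> closedin T S \<and> S \<noteq> {} \<and>
     (\<forall>F G. closedin T F \<and> closedin T G \<and> S = F \<union> G \<longrightarrow> S = F \<or> S = G)"

definition sober_space :: "'a topology \<Rightarrow> bool" where
  "sober_space T \<longleftrightarrow>
     (\<forall>S. irreducible_closed_in T S \<longrightarrow> (\<exists>!p. p \<in> topspace T \<and> S = T closure_of {p}))"

end

theory Submission
  imports Defs
begin

text \<open>
  Noetherian objects are finitely presented, and indecomposable injective objects are uniform. By
  uniformity, a point in \<open>(A) \<inter> (B)\<close> lies in \<open>(D)\<close> for a noetherian subobject \<open>D\<close> common to images of \<open>A\<close>
  and \<open>B\<close>, and \<open>(D) \<subseteq> (A) \<inter> (B)\<close> by injectivity; so the sets \<open>(A)\<close> are a basis.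

  Let \<open>S\<close> be irreducible and closed. Some noetherian generator \<open>G\<close> maps non-trivially to a point of \<open>S\<close>;
  let \<open>M = G / K\<close> with \<open>K\<close> maximal such that \<open>G / K\<close> still does. Every non-zero map from \<open>M\<close> to a point
  of \<open>S\<close> is monic, so all points of \<open>(M) \<inter> S\<close> are injective hulls of \<open>M\<close>, and \<open>(M) \<inter> S\<close> is one point
  \<open>p\<close>. A non-empty open subset of an irreducible space is dense, hence \<open>S\<close> is the closure of \<open>p\<close>; and
  every generic point of \<open>S\<close> lies in \<open>(M)\<close>, hence equals \<open>p\<close>.
\<close>

section \<open>Preadditive categories\<close>

text \<open>The Ziegler basis is indexed by finitely presented objects, whereas the objects
  \<open>D\<close> and \<open>M\<close> of the overview come out noetherian; finite presentation of
  noetherian objects is what makes their sets \<open>(D)\<close> and \<open>(M)\<close> open. The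
  obstacle there is that exactness is given only for short exact sequences of directed systems whose
  three colimits are at hand. The device is a constant system: once an ascending family of kernels
  on a noetherian object has stabilized, the corresponding quotient embeds compatibly in all later
  terms of the system, and exactness embeds it in the colimit. Vanishing in the colimit is thus
  vanishing at some stage. Uniformity rests on the same device, applied to the sum of a chain of
  subobjects. In place of elements there are arrows from test objects; where an element would be
  lifted along an epi, the epi is pulled back and the test object is replaced by a cover.\<close>

context category
begin

lemma in_Hom: "f \<in> Hom C A B \<longleftrightarrow> f \<in> Arr C \<and> Dom C f = A \<and> Cod C f = B"
  by (simp add: Hom_def)

declare Dom_in_Obj [simp] Cod_in_Obj [simp]

lemma Arr_Ident [simp]:
  assumes "A \<in> Obj C"
  shows "Ident C A \<in> Arr C" "Dom C (Ident C A) = A" "Cod C (Ident C A) = A"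
  using Ident_in_Hom[OF assms] by (auto simp: in_Hom)

lemma Arr_Comp [simp]:
  assumes "g \<in> Arr C" "f \<in> Arr C" "Dom C g = Cod C f"
  shows "g \<bullet> f \<in> Arr C" "Dom C (g \<bullet> f) = Dom C f" "Cod C (g \<bullet> f) = Cod C g"
  using Comp_in_Hom[of f "Dom C f" "Cod C f" g "Cod C g"] assms by (auto simp: in_Hom)

lemma Comp_Ident_right [simp]: "\<lbrakk>f \<in> Arr C; Dom C f = A\<rbrakk> \<Longrightarrow> f \<bullet> Ident C A = f"
  using Comp_Ident[of f A "Cod C f"] by (auto simp: in_Hom)

lemma Comp_Ident_left [simp]: "\<lbrakk>f \<in> Arr C; Cod C f = A\<rbrakk> \<Longrightarrow> Ident C A \<bullet> f = f"
  using Ident_Comp[of f "Dom C f" A] by (auto simp: in_Hom)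

lemma Comp_assoc_right [simp]:
  assumes "h \<in> Arr C" "g \<in> Arr C" "f \<in> Arr C" "Dom C h = Cod C g" "Dom C g = Cod C f"
  shows "(h \<bullet> g) \<bullet> f = h \<bullet> (g \<bullet> f)"
  using Comp_assoc[of f "Dom C f" "Cod C f" g "Cod C g" h "Cod C h"] assms by (auto simp: in_Hom)

text \<open>The simplifier brackets composites to the right, which hides
  \<open>h \<bullet> g\<close> inside \<open>h \<bullet> (g \<bullet> f)\<close>. This lemma and the
  next rewrite such a buried pair.\<close>

lemma Comp_eq_Comp:
  assumes "h \<bullet> g = h' \<bullet> g'" "h \<in> Arr C" "g \<in> Arr C" "h' \<in> Arr C" "g' \<in> Arr C" "f \<in> Arr C"
    "Dom C h = Cod C g" "Dom C h' = Cod C g'" "Dom C g = Cod C f" "Dom C g' = Cod C f"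
  shows "h \<bullet> (g \<bullet> f) = h' \<bullet> (g' \<bullet> f)"
  using assms Comp_assoc_right by metis

lemma Comp_eq_CompI:
  assumes "h \<bullet> g = k" "h \<in> Arr C" "g \<in> Arr C" "f \<in> Arr C"
    "Dom C h = Cod C g" "Dom C g = Cod C f"
  shows "h \<bullet> (g \<bullet> f) = k \<bullet> f"
  using assms Comp_assoc_right by metis

text \<open>Below, \<open>subobject_le\<close> is also applied to arrows that are not monic; it then
  says that \<open>x\<close> factors through \<open>m\<close>.\<close>

lemma subobject_leI:
  "\<lbrakk>m \<bullet> y = x; m \<in> Arr C; y \<in> Arr C; Cod C y = Dom C m\<rbrakk> \<Longrightarrow> subobject_le C x m"
  by (auto simp: subobject_le_def in_Hom)

lemma subobject_leE:
  assumes "subobject_le C x m"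
  obtains y where "y \<in> Arr C" "Dom C y = Dom C x" "Cod C y = Dom C m" "m \<bullet> y = x"
  using assms by (auto simp: subobject_le_def in_Hom)

lemma subobject_le_refl: "m \<in> Arr C \<Longrightarrow> subobject_le C m m"
  by (rule subobject_leI[of _ "Ident C (Dom C m)"]) auto

lemma subobject_le_trans:
  assumes "subobject_le C x m" "subobject_le C m n" "m \<in> Arr C" "n \<in> Arr C"
  shows "subobject_le C x n"
proof -
  obtain y where y: "y \<in> Arr C" "Dom C y = Dom C x" "Cod C y = Dom C m" "m \<bullet> y = x"
    using assms(1) by (rule subobject_leE)
  obtain z where z: "z \<in> Arr C" "Dom C z = Dom C m" "Cod C z = Dom C n" "n \<bullet> z = m"
    using assms(2) by (rule subobject_leE)
  have "n \<bullet> (z \<bullet> y) = m \<bullet> y"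
    by (rule Comp_eq_CompI) (use y z assms in auto)
  then show ?thesis
    by (intro subobject_leI[of n "z \<bullet> y"]) (use y z assms in auto)
qed

lemma mono_Arr [simp]: "is_mono C m \<Longrightarrow> m \<in> Arr C"
  by (simp add: is_mono_def)

lemma epi_Arr [simp]: "is_epi C m \<Longrightarrow> m \<in> Arr C"
  by (simp add: is_epi_def)

lemma monoD:
  "\<lbrakk>is_mono C m; m \<bullet> x = m \<bullet> y; x \<in> Arr C; y \<in> Arr C; Dom C x = Dom C y; Cod C x = Dom C m;
    Cod C y = Dom C m\<rbrakk> \<Longrightarrow> x = y"
  unfolding is_mono_def by blast

lemma epiD:
  "\<lbrakk>is_epi C m; x \<bullet> m = y \<bullet> m; x \<in> Arr C; y \<in> Arr C; Cod C x = Cod C y; Dom C x = Cod C m;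
    Dom C y = Cod C m\<rbrakk> \<Longrightarrow> x = y"
  unfolding is_epi_def by blast

lemma mono_Comp:
  assumes "is_mono C m" "is_mono C n" "Dom C m = Cod C n"
  shows "is_mono C (m \<bullet> n)"
  unfolding is_mono_def
proof (intro conjI ballI impI, goal_cases)
  case 1 show ?case using assms by simp
next
  case (2 g h)
  then have "n \<bullet> g = n \<bullet> h"
    by (intro monoD[OF assms(1), of "n \<bullet> g" "n \<bullet> h"]) (use assms 2 in auto)
  then show ?case
    by (intro monoD[OF assms(2), of g h]) (use assms 2 in auto)
qed

lemma epi_Comp:
  assumes "is_epi C m" "is_epi C n" "Dom C m = Cod C n"
  shows "is_epi C (m \<bullet> n)"
  unfolding is_epi_def
proof (intro conjI ballI impI, goal_cases)
  case 1 show ?case using assms by simp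
next
  case (2 g h)
  then have "g \<bullet> m = h \<bullet> m"
    by (intro epiD[OF assms(2), of "g \<bullet> m" "h \<bullet> m"]) (use assms 2 in auto)
  then show ?case
    by (intro epiD[OF assms(1), of g h]) (use assms 2 in auto)
qed

end

section \<open>Hom groups, zero arrows and differences\<close>

context preadditive_category
begin

lemma Hom_add_group:
  assumes "A \<in> Obj C" "B \<in> Obj C"
  shows "Zero C A B \<in> Hom C A B"
    and "\<lbrakk>f \<in> Hom C A B; g \<in> Hom C A B\<rbrakk> \<Longrightarrow> f \<^bold>+ g \<in> Hom C A B"
    and "f \<in> Hom C A B \<Longrightarrow> f \<^bold>+ Zero C A B = f"
    and "\<lbrakk>f \<in> Hom C A B; g \<in> Hom C A B\<rbrakk> \<Longrightarrow> f \<^bold>+ g = g \<^bold>+ f"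
    and "\<lbrakk>f \<^bold>+ h = g \<^bold>+ h; f \<in> Hom C A B; g \<in> Hom C A B; h \<in> Hom C A B\<rbrakk> \<Longrightarrow> f = g"
    and "\<lbrakk>f \<in> Hom C A B; g \<in> Hom C A B\<rbrakk> \<Longrightarrow> \<exists>d\<in>Hom C A B. d \<^bold>+ g = f"
proof -
  let ?G = "\<lparr>carrier = Hom C A B, monoid.mult = Plus C, one = Zero C A B\<rparr>"
  interpret H: comm_group ?G
    using assms by (intro Hom_comm_group) auto
  show "Zero C A B \<in> Hom C A B"
    using H.one_closed by simp
  show "\<lbrakk>f \<in> Hom C A B; g \<in> Hom C A B\<rbrakk> \<Longrightarrow> f \<^bold>+ g \<in> Hom C A B"
    using H.m_closed[of f g] by simp
  show "f \<in> Hom C A B \<Longrightarrow> f \<^bold>+ Zero C A B = f"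
    using H.r_one[of f] by simp
  show "\<lbrakk>f \<in> Hom C A B; g \<in> Hom C A B\<rbrakk> \<Longrightarrow> f \<^bold>+ g = g \<^bold>+ f"
    using H.m_comm[of f g] by simp
  show "\<lbrakk>f \<^bold>+ h = g \<^bold>+ h; f \<in> Hom C A B; g \<in> Hom C A B; h \<in> Hom C A B\<rbrakk> \<Longrightarrow> f = g"
    using H.right_cancel[of h f g] by simp
  show "\<lbrakk>f \<in> Hom C A B; g \<in> Hom C A B\<rbrakk> \<Longrightarrow> \<exists>d\<in>Hom C A B. d \<^bold>+ g = f"
    using H.inv_solve_right'[of "f \<otimes>\<^bsub>?G\<^esub> inv\<^bsub>?G\<^esub> g" f g] H.m_closed[of f "inv\<^bsub>?G\<^esub> g"] H.inv_closed[of g]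
    by (intro bexI[of _ "f \<otimes>\<^bsub>?G\<^esub> inv\<^bsub>?G\<^esub> g"]) auto
qed

lemmas Zero_in_Hom = Hom_add_group(1)
  and Plus_in_Hom = Hom_add_group(2)
  and Plus_commute = Hom_add_group(4)
    and ex_diff = Hom_add_group(6)

lemma Plus_cancel:
  "\<lbrakk>f \<^bold>+ h = g \<^bold>+ h; f \<in> Hom C A B; g \<in> Hom C A B; h \<in> Hom C A B; A \<in> Obj C; B \<in> Obj C\<rbrakk> \<Longrightarrow> f = g"
  by (rule Hom_add_group(5))

lemma Arr_Zero [simp]:
  assumes "A \<in> Obj C" "B \<in> Obj C"
  shows "Zero C A B \<in> Arr C" "Dom C (Zero C A B) = A" "Cod C (Zero C A B) = B"
  using Zero_in_Hom[OF assms] by (auto simp: in_Hom)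

lemma Plus_Zero:
  assumes "f \<in> Arr C" "Dom C f = A" "Cod C f = B"
  shows "f \<^bold>+ Zero C A B = f" "Zero C A B \<^bold>+ f = f"
  using assms Hom_add_group(3)[of A B f] Plus_commute[of A B f "Zero C A B"] by (auto simp: in_Hom)

text \<open>By distributivity \<open>g \<bullet> Zero C A B\<close> equals its own double, and
  cancelling it in the Hom group leaves zero.\<close>

lemma Comp_Zero [simp]:
  assumes "g \<in> Arr C" "Dom C g = B" "A \<in> Obj C"
  shows "g \<bullet> Zero C A B = Zero C A (Cod C g)"
proof -
  have B: "B \<in> Obj C" "Cod C g \<in> Obj C" using assms by auto
  let ?z = "Zero C A B"
  have z: "?z \<in> Hom C A B" using B assms by (simp add: in_Hom)
  have gz: "g \<bullet> ?z \<in> Hom C A (Cod C g)" using B assms by (simp add: in_Hom)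
  have "(g \<bullet> ?z) \<^bold>+ (g \<bullet> ?z) = g \<bullet> (?z \<^bold>+ ?z)"
    using Comp_Plus[OF z z, of g "Cod C g"] assms by (simp add: in_Hom)
  also have "\<dots> = Zero C A (Cod C g) \<^bold>+ (g \<bullet> ?z)"
    using Plus_Zero[of ?z A B] Plus_Zero[of "g \<bullet> ?z" A "Cod C g"] B assms by simp
  finally show ?thesis
    by (rule Plus_cancel[of _ _ _ A "Cod C g"]) (use B gz assms in \<open>auto simp: in_Hom\<close>)
qed

lemma Zero_Comp [simp]:
  assumes "g \<in> Arr C" "Cod C g = A" "B \<in> Obj C"
  shows "Zero C A B \<bullet> g = Zero C (Dom C g) B"
proof -
  have A: "A \<in> Obj C" "Dom C g \<in> Obj C" using assms by auto
  let ?z = "Zero C A B"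
  have z: "?z \<in> Hom C A B" using A assms by (simp add: in_Hom)
  have gz: "?z \<bullet> g \<in> Hom C (Dom C g) B" using A assms by (simp add: in_Hom)
  have "(?z \<bullet> g) \<^bold>+ (?z \<bullet> g) = (?z \<^bold>+ ?z) \<bullet> g"
    using Plus_Comp[OF _ z z, of g "Dom C g"] assms by (simp add: in_Hom)
  also have "\<dots> = Zero C (Dom C g) B \<^bold>+ (?z \<bullet> g)"
    using Plus_Zero[of ?z A B] Plus_Zero[of "?z \<bullet> g" "Dom C g" B] A assms by simp
  finally show ?thesis
    by (rule Plus_cancel[of _ _ _ "Dom C g" B]) (use A gz assms in \<open>auto simp: in_Hom\<close>)
qed

text \<open>A predicate, so that statements about vanishing composites need not name both end
  objects, which for chosen kernels and cokernels have no short names.\<close>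

definition null :: "'m \<Rightarrow> bool" where
  "null f \<longleftrightarrow> f = Zero C (Dom C f) (Cod C f)"

lemma null_Zero [simp]: "\<lbrakk>A \<in> Obj C; B \<in> Obj C\<rbrakk> \<Longrightarrow> null (Zero C A B)"
  by (simp add: null_def)

lemma nullD: "\<lbrakk>null f; Dom C f = A; Cod C f = B\<rbrakk> \<Longrightarrow> f = Zero C A B"
  by (simp add: null_def)

lemma null_unique:
  "\<lbrakk>null f; null g; Dom C f = Dom C g; Cod C f = Cod C g\<rbrakk> \<Longrightarrow> f = g"
  by (simp add: null_def)

lemma null_Comp_left: "\<lbrakk>null f; f \<in> Arr C; g \<in> Arr C; Dom C g = Cod C f\<rbrakk> \<Longrightarrow> null (g \<bullet> f)"
  unfolding null_def by (metis Arr_Comp(2,3) Comp_Zero Dom_in_Obj)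

lemma null_Comp_right: "\<lbrakk>null g; f \<in> Arr C; g \<in> Arr C; Dom C g = Cod C f\<rbrakk> \<Longrightarrow> null (g \<bullet> f)"
  unfolding null_def by (metis Arr_Comp(2,3) Zero_Comp Cod_in_Obj)

text \<open>The record carries no negation, so a difference is chosen as a solution of
  \<open>d + g = f\<close>, which exists in the Hom group. It turns an equation between parallel
  arrows into the vanishing of one arrow, which kernels and cokernels can test.\<close>

definition diff :: "'m \<Rightarrow> 'm \<Rightarrow> 'm" where
  "diff f g = (SOME d. d \<in> Hom C (Dom C f) (Cod C f) \<and> d \<^bold>+ g = f)"

context
  fixes f g
  assumes fg [simp]: "f \<in> Arr C" "g \<in> Arr C" and Dom_eq: "Dom C f = Dom C g"
    and Cod_eq: "Cod C f = Cod C g"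
begin

lemma diff_spec: "diff f g \<in> Hom C (Dom C f) (Cod C f)" "diff f g \<^bold>+ g = f"
proof -
  have "\<exists>d. d \<in> Hom C (Dom C f) (Cod C f) \<and> d \<^bold>+ g = f"
    using ex_diff[of "Dom C f" "Cod C f" f g] Dom_eq Cod_eq by (auto simp: in_Hom)
  from someI_ex[OF this]
  show "diff f g \<in> Hom C (Dom C f) (Cod C f)" "diff f g \<^bold>+ g = f"
    by (auto simp: diff_def)
qed

lemma Arr_diff: "diff f g \<in> Arr C" "Dom C (diff f g) = Dom C f" "Cod C (diff f g) = Cod C f"
  using diff_spec(1) by (auto simp: in_Hom)

lemma null_diff_iff: "null (diff f g) \<longleftrightarrow> f = g"
proof -
  note [simp] = Arr_diff
  have fg': "g \<in> Hom C (Dom C f) (Cod C f)" using Dom_eq Cod_eq by (simp add: in_Hom)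
  have "f = g" if "null (diff f g)"
    using diff_spec(2) Plus_Zero(2)[of g "Dom C f" "Cod C f"] nullD[OF that] Dom_eq Cod_eq by simp
  moreover have "null (diff f g)" if "f = g"
  proof -
    have "diff f g \<^bold>+ g = Zero C (Dom C f) (Cod C f) \<^bold>+ g"
      using diff_spec(2) that Plus_Zero(2)[of g "Dom C f" "Cod C f"] by simp
    then have "diff f g = Zero C (Dom C f) (Cod C f)"
      by (rule Plus_cancel[OF _ diff_spec(1) _ fg']) (auto simp: in_Hom)
    then show ?thesis by (simp add: null_def)
  qed
  ultimately show ?thesis by blast
qed

end

lemma Comp_diff:
  assumes "f \<in> Arr C" "g \<in> Arr C" "Dom C f = Dom C g" "Cod C f = Cod C g"
    and "m \<in> Arr C" "Dom C m = Cod C f"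
  shows "m \<bullet> diff f g = diff (m \<bullet> f) (m \<bullet> g)"
proof -
  note d = Arr_diff[OF assms(1-4)]
  have "m \<bullet> diff f g \<^bold>+ m \<bullet> g = m \<bullet> (diff f g \<^bold>+ g)"
    using Comp_Plus[of "diff f g" "Dom C f" "Cod C f" g m "Cod C m"] d assms by (simp add: in_Hom)
  also have "\<dots> = m \<bullet> f" using diff_spec(2)[OF assms(1-4)] by simp
  also have "\<dots> = diff (m \<bullet> f) (m \<bullet> g) \<^bold>+ m \<bullet> g"
    using diff_spec(2)[of "m \<bullet> f" "m \<bullet> g"] assms by simp
  finally show ?thesis
    by (rule Plus_cancel[of _ _ _ "Dom C f" "Cod C m"])
       (use d assms Arr_diff[of "m \<bullet> f" "m \<bullet> g"] in \<open>auto simp: in_Hom\<close>)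
qed

lemma diff_Comp:
  assumes "f \<in> Arr C" "g \<in> Arr C" "Dom C f = Dom C g" "Cod C f = Cod C g"
    and "x \<in> Arr C" "Dom C f = Cod C x"
  shows "diff f g \<bullet> x = diff (f \<bullet> x) (g \<bullet> x)"
proof -
  note d = Arr_diff[OF assms(1-4)]
  have "diff f g \<bullet> x \<^bold>+ g \<bullet> x = (diff f g \<^bold>+ g) \<bullet> x"
    using Plus_Comp[of x "Dom C x" "Dom C f" "diff f g" "Cod C f" g] d assms by (simp add: in_Hom)
  also have "\<dots> = f \<bullet> x" using diff_spec(2)[OF assms(1-4)] by simp
  also have "\<dots> = diff (f \<bullet> x) (g \<bullet> x) \<^bold>+ g \<bullet> x"
    using diff_spec(2)[of "f \<bullet> x" "g \<bullet> x"] assms by simp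
  finally show ?thesis
    by (rule Plus_cancel[of _ _ _ "Dom C x" "Cod C f"])
       (use d assms Arr_diff[of "f \<bullet> x" "g \<bullet> x"] in \<open>auto simp: in_Hom\<close>)
qed

lemma null_Comp_diff_iff:
  assumes "f \<in> Arr C" "g \<in> Arr C" "Dom C f = Dom C g" "Cod C f = Cod C g"
    and "m \<in> Arr C" "Dom C m = Cod C f"
  shows "null (m \<bullet> diff f g) \<longleftrightarrow> m \<bullet> f = m \<bullet> g"
  using Comp_diff[OF assms] null_diff_iff[of "m \<bullet> f" "m \<bullet> g"] assms by simp

lemma null_diff_Comp_iff:
  assumes "f \<in> Arr C" "g \<in> Arr C" "Dom C f = Dom C g" "Cod C f = Cod C g"
    and "x \<in> Arr C" "Dom C f = Cod C x"
  shows "null (diff f g \<bullet> x) \<longleftrightarrow> f \<bullet> x = g \<bullet> x"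
  using diff_Comp[OF assms] null_diff_iff[of "f \<bullet> x" "g \<bullet> x"] assms by simp

text \<open>By distributivity, \<open>m\<close> identifies two arrows exactly when it kills their
  difference.\<close>

lemma monoI:
  assumes "m \<in> Arr C"
    and "\<And>x. \<lbrakk>x \<in> Arr C; Cod C x = Dom C m; null (m \<bullet> x)\<rbrakk> \<Longrightarrow> null x"
  shows "is_mono C m"
  unfolding is_mono_def
proof (intro conjI ballI impI, goal_cases)
  case (2 g h)
  note d = Arr_diff[of g h]
  have "null (diff g h)"
    by (rule assms(2)) (use 2 d assms in \<open>auto simp: null_Comp_diff_iff\<close>)
  then show ?case using 2 by (simp add: null_diff_iff)
qed (use assms in auto)

lemma epiI:
  assumes "m \<in> Arr C"
    and "\<And>x. \<lbrakk>x \<in> Arr C; Dom C x = Cod C m; null (x \<bullet> m)\<rbrakk> \<Longrightarrow> null x"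
  shows "is_epi C m"
  unfolding is_epi_def
proof (intro conjI ballI impI, goal_cases)
  case (2 g h)
  note d = Arr_diff[of g h]
  have "null (diff g h)"
    by (rule assms(2)) (use 2 d assms in \<open>auto simp: null_diff_Comp_iff\<close>)
  then show ?case using 2 by (simp add: null_diff_iff)
qed (use assms in auto)

lemma mono_null_iff:
  assumes "is_mono C m" "x \<in> Arr C" "Cod C x = Dom C m"
  shows "null (m \<bullet> x) \<longleftrightarrow> null x"
proof
  assume "null (m \<bullet> x)"
  then have "m \<bullet> x = m \<bullet> Zero C (Dom C x) (Dom C m)"
    using assms by (simp add: null_def)
  then have "x = Zero C (Dom C x) (Dom C m)"
    by (rule monoD[OF assms(1)]) (use assms in auto)
  then show "null x" using assms by (simp add: null_def)
qed (use assms in \<open>auto intro: null_Comp_left\<close>)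

lemma epi_null_iff:
  assumes "is_epi C m" "x \<in> Arr C" "Dom C x = Cod C m"
  shows "null (x \<bullet> m) \<longleftrightarrow> null x"
proof
  assume "null (x \<bullet> m)"
  then have "x \<bullet> m = Zero C (Cod C m) (Cod C x) \<bullet> m"
    using assms by (simp add: null_def)
  then have "x = Zero C (Cod C m) (Cod C x)"
    by (rule epiD[OF assms(1)]) (use assms in auto)
  then show "null x" using assms by (simp add: null_def)
qed (use assms in \<open>auto intro: null_Comp_right\<close>)

text \<open>An arrow into or out of \<open>Z\<close> equals its composite with the identity of
  \<open>Z\<close>, so it vanishes together with that identity.\<close>

lemma zero_object_iff: "is_zero_object C Z \<longleftrightarrow> Z \<in> Obj C \<and> null (Ident C Z)"
proof (intro iffI conjI; (elim conjE)?)
  assume Z: "is_zero_object C Z"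
  then show "Z \<in> Obj C" by (simp add: is_zero_object_def)
  then have "\<exists>!f. f \<in> Hom C Z Z" using Z by (auto simp: is_zero_object_def)
  then have "Ident C Z = Zero C Z Z"
    using \<open>Z \<in> Obj C\<close> Zero_in_Hom[of Z Z] Ident_in_Hom[of Z] by blast
  then show "null (Ident C Z)" using \<open>Z \<in> Obj C\<close> by simp
next
  assume Z: "Z \<in> Obj C" "null (Ident C Z)"
  have *: "f = Zero C A Z" if "f \<in> Hom C A Z" for f A
    using null_Comp_right[OF Z(2), of f] that Z by (auto simp: in_Hom null_def)
  have **: "f = Zero C Z A" if "f \<in> Hom C Z A" for f A
    using null_Comp_left[OF Z(2), of f] that Z by (auto simp: in_Hom null_def)
  show "is_zero_object C Z"
    unfolding is_zero_object_def
  proof (intro conjI ballI)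
    fix A assume A: "A \<in> Obj C"
    show "\<exists>!f. f \<in> Hom C A Z" by (rule ex1I[of _ "Zero C A Z"]) (use A Z * Zero_in_Hom in auto)
    show "\<exists>!f. f \<in> Hom C Z A" by (rule ex1I[of _ "Zero C Z A"]) (use A Z ** Zero_in_Hom in auto)
  qed (use Z in auto)
qed

lemma zero_object_null:
  assumes "is_zero_object C Z" "f \<in> Arr C" "Dom C f = Z \<or> Cod C f = Z"
  shows "null f"
proof -
  have Z: "Z \<in> Obj C" "null (Ident C Z)" using assms(1) by (auto simp: zero_object_iff)
  show ?thesis
    using assms(3)
  proof
    assume "Dom C f = Z" then show ?thesis using null_Comp_left[of "Ident C Z" f] Z assms(2) by simp
  next
    assume "Cod C f = Z" then show ?thesis using null_Comp_right[of "Ident C Z" f] Z assms(2) by simp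
  qed
qed

end

section \<open>Abelian categories\<close>

context abelian_category
begin

definition ker :: "'m \<Rightarrow> 'm" where
  "ker f = (SOME k. is_kernel C k f)"

definition coker :: "'m \<Rightarrow> 'm" where
  "coker f = (SOME c. is_cokernel C c f)"

lemma is_kernel_ker: "f \<in> Arr C \<Longrightarrow> is_kernel C (ker f) f"
  unfolding ker_def by (rule someI_ex) (rule kernels)

lemma is_cokernel_coker: "f \<in> Arr C \<Longrightarrow> is_cokernel C (coker f) f"
  unfolding coker_def by (rule someI_ex) (rule cokernels)

lemma is_kernelD:
  assumes "is_kernel C k f"
  shows "k \<in> Arr C" "f \<in> Arr C" "Cod C k = Dom C f" "null (f \<bullet> k)"
    and "\<lbrakk>x \<in> Arr C; Cod C x = Dom C f; null (f \<bullet> x)\<rbrakk> \<Longrightarrow> subobject_le C x k"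
    and "is_mono C k"
proof -
  show k: "k \<in> Arr C" "f \<in> Arr C" "Cod C k = Dom C f" and fk: "null (f \<bullet> k)"
    using assms by (auto simp: is_kernel_def)
  have *: "\<exists>!h. h \<in> Hom C (Dom C x) (Dom C k) \<and> k \<bullet> h = x"
    if "x \<in> Arr C" "Cod C x = Dom C f" "null (f \<bullet> x)" for x
    using assms that k unfolding is_kernel_def null_def by auto
  show "\<lbrakk>x \<in> Arr C; Cod C x = Dom C f; null (f \<bullet> x)\<rbrakk> \<Longrightarrow> subobject_le C x k"
    using *[of x] unfolding subobject_le_def by auto
  show "is_mono C k"
    unfolding is_mono_def
  proof (intro conjI ballI impI, goal_cases)
    case (2 g h)
    have "null (f \<bullet> (k \<bullet> g))"
      using Comp_assoc_right[of f k g] null_Comp_right[OF fk, of g] k 2 by simp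
    then have "\<exists>!h'. h' \<in> Hom C (Dom C g) (Dom C k) \<and> k \<bullet> h' = k \<bullet> g"
      using *[of "k \<bullet> g"] 2 k by simp
    moreover have "g \<in> Hom C (Dom C g) (Dom C k)" "h \<in> Hom C (Dom C g) (Dom C k)"
      using 2 by (simp_all add: in_Hom)
    ultimately show ?case using 2 by metis
  qed (use k in auto)
qed

lemma is_cokernelD:
  assumes "is_cokernel C c f"
  shows "c \<in> Arr C" "f \<in> Arr C" "Dom C c = Cod C f" "null (c \<bullet> f)"
    and "\<lbrakk>x \<in> Arr C; Dom C x = Cod C f; null (x \<bullet> f)\<rbrakk> \<Longrightarrow>
           \<exists>y. y \<in> Arr C \<and> Dom C y = Cod C c \<and> Cod C y = Cod C x \<and> y \<bullet> c = x"
    and "is_epi C c"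
proof -
  show k: "c \<in> Arr C" "f \<in> Arr C" "Dom C c = Cod C f" and fk: "null (c \<bullet> f)"
    using assms by (auto simp: is_cokernel_def)
  have *: "\<exists>!h. h \<in> Hom C (Cod C c) (Cod C x) \<and> h \<bullet> c = x"
    if "x \<in> Arr C" "Dom C x = Cod C f" "null (x \<bullet> f)" for x
    using assms that k unfolding is_cokernel_def null_def by auto
  show "\<lbrakk>x \<in> Arr C; Dom C x = Cod C f; null (x \<bullet> f)\<rbrakk> \<Longrightarrow>
           \<exists>y. y \<in> Arr C \<and> Dom C y = Cod C c \<and> Cod C y = Cod C x \<and> y \<bullet> c = x"
    using *[of x] by (auto simp: in_Hom)
  show "is_epi C c"
    unfolding is_epi_def
  proof (intro conjI ballI impI, goal_cases)
    case (2 g h)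
    have "null (g \<bullet> c \<bullet> f)"
      using Comp_assoc_right[of g c f] null_Comp_left[OF fk, of g] k 2 by simp
    then have "\<exists>!h'. h' \<in> Hom C (Cod C c) (Cod C g) \<and> h' \<bullet> c = g \<bullet> c"
      using *[of "g \<bullet> c"] 2 k by simp
    moreover have "g \<in> Hom C (Cod C c) (Cod C g)" "h \<in> Hom C (Cod C c) (Cod C g)"
      using 2 by (simp_all add: in_Hom)
    ultimately show ?case using 2 by metis
  qed (use k in auto)
qed

lemma ker [simp]:
  assumes "f \<in> Arr C"
  shows "ker f \<in> Arr C" "Cod C (ker f) = Dom C f" "null (f \<bullet> ker f)" "is_mono C (ker f)"
  using is_kernelD[OF is_kernel_ker[OF assms]] by auto

lemma coker [simp]:
  assumes "f \<in> Arr C"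
  shows "coker f \<in> Arr C" "Dom C (coker f) = Cod C f" "null (coker f \<bullet> f)" "is_epi C (coker f)"
  using is_cokernelD[OF is_cokernel_coker[OF assms]] by auto

lemma le_ker_iff:
  assumes "f \<in> Arr C" "x \<in> Arr C" "Cod C x = Dom C f"
  shows "subobject_le C x (ker f) \<longleftrightarrow> null (f \<bullet> x)"
proof
  assume "subobject_le C x (ker f)"
  then obtain y where y: "y \<in> Arr C" "Dom C y = Dom C x" "Cod C y = Dom C (ker f)" "ker f \<bullet> y = x"
    by (rule subobject_leE)
  show "null (f \<bullet> x)"
    using null_Comp_right[of "f \<bullet> ker f" y] y assms by simp
qed (use is_kernelD(5)[OF is_kernel_ker] assms in auto)

lemma coker_factor:
  assumes "null (x \<bullet> f)" "f \<in> Arr C" "x \<in> Arr C" "Dom C x = Cod C f"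
  obtains y where "y \<in> Arr C" "Dom C y = Cod C (coker f)" "Cod C y = Cod C x" "y \<bullet> coker f = x"
  using is_cokernelD(5)[OF is_cokernel_coker] assms by metis

text \<open>A mono is the kernel of its own cokernel: \<open>m\<close> is the kernel of some
  \<open>g\<close>, and \<open>g\<close> factors through \<open>coker m\<close>, so whatever
  \<open>coker m\<close> kills is killed by \<open>g\<close>. Inclusions of subobjects are verified
  below by computing such a vanishing composite.\<close>

lemma mono_le_iff:
  assumes "is_mono C m" "x \<in> Arr C" "Cod C x = Cod C m"
  shows "subobject_le C x m \<longleftrightarrow> null (coker m \<bullet> x)"
proof
  assume "subobject_le C x m"
  then obtain y where y: "y \<in> Arr C" "Dom C y = Dom C x" "Cod C y = Dom C m" "m \<bullet> y = x"
    by (rule subobject_leE)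
  show "null (coker m \<bullet> x)"
    using null_Comp_right[of "coker m \<bullet> m" y] y assms by simp
next
  assume *: "null (coker m \<bullet> x)"
  obtain g where g: "is_kernel C m g" using mono_normal[OF assms(1)] by blast
  note g' = is_kernelD[OF g]
  obtain y where y: "y \<in> Arr C" "Dom C y = Cod C (coker m)" "Cod C y = Cod C g" "y \<bullet> coker m = g"
    using coker_factor[of g m] g' by auto
  have "null (y \<bullet> (coker m \<bullet> x))" using * y assms by - (rule null_Comp_left, auto)
  then have "null (g \<bullet> x)" using Comp_assoc_right[of y "coker m" x] y assms by simp
  then show "subobject_le C x m" using g'(5)[of x] assms g' by simp
qed

text \<open>Dually to monos, an epi is the cokernel of its own kernel: \<open>e\<close> is the
  cokernel of some \<open>g\<close>, and \<open>g\<close> factors through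
  \<open>ker e\<close>.\<close>

lemma epi_factor:
  assumes "is_epi C e" "null (x \<bullet> ker e)" "x \<in> Arr C" "Dom C x = Dom C e"
  obtains y where "y \<in> Arr C" "Dom C y = Cod C e" "Cod C y = Cod C x" "y \<bullet> e = x"
proof -
  obtain g where g: "is_cokernel C e g" using epi_normal[OF assms(1)] by blast
  note g' = is_cokernelD[OF g]
  have "subobject_le C g (ker e)"
    using le_ker_iff[of e g] g' by simp
  then obtain z where z: "z \<in> Arr C" "Dom C z = Dom C g" "Cod C z = Dom C (ker e)" "ker e \<bullet> z = g"
    by (rule subobject_leE)
  have "null (x \<bullet> ker e \<bullet> z)" using assms z by - (rule null_Comp_right, auto)
  then have "null (x \<bullet> g)" using z assms by simp
  then show thesis using g'(5)[of x] that assms g' by metis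
qed

lemma mono_iff_ker: "f \<in> Arr C \<Longrightarrow> is_mono C f \<longleftrightarrow> null (ker f)"
proof
  assume f: "f \<in> Arr C" "null (ker f)"
  show "is_mono C f"
  proof (rule monoI)
    fix x assume x: "x \<in> Arr C" "Cod C x = Dom C f" "null (f \<bullet> x)"
    then obtain y where "y \<in> Arr C" "Dom C y = Dom C x" "Cod C y = Dom C (ker f)" "ker f \<bullet> y = x"
      using le_ker_iff f by (meson subobject_leE)
    then show "null x" using null_Comp_right[of "ker f" y] f by auto
  qed (use f in auto)
qed (use mono_null_iff ker in blast)

lemma epi_iff_coker: "f \<in> Arr C \<Longrightarrow> is_epi C f \<longleftrightarrow> null (coker f)"
proof
  assume f: "f \<in> Arr C" "null (coker f)"
  show "is_epi C f"
  proof (rule epiI)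
    fix x assume x: "x \<in> Arr C" "Dom C x = Cod C f" "null (x \<bullet> f)"
    then obtain y where "y \<in> Arr C" "Dom C y = Cod C (coker f)" "y \<bullet> coker f = x"
      using coker_factor f by metis
    then show "null x" using null_Comp_left[of "coker f" y] f by auto
  qed (use f in auto)
qed (use epi_null_iff coker in blast)

text \<open>The arrow \<open>ker (Ident C A)\<close> serves as the zero subobject of
  \<open>A\<close>, from which the searches for a maximal subobject start.\<close>

lemma null_ker_Ident: "A \<in> Obj C \<Longrightarrow> null (ker (Ident C A))"
  using ker(3)[of "Ident C A"] ker(1,2)[of "Ident C A"] by simp

text \<open>The image is \<open>m = ker (coker f)\<close>. If \<open>g\<close> kills
  \<open>e\<close>, then \<open>f\<close> factors through the mono \<open>m \<bullet> ker g\<close>,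
  which is the kernel of some \<open>h\<close>. Since \<open>h\<close> kills \<open>f\<close>, it
  factors through \<open>coker f\<close> and kills \<open>m\<close>, so \<open>m\<close> factors
  through \<open>m \<bullet> ker g\<close>. Hence \<open>ker g\<close> has a right inverse and
  \<open>g\<close> vanishes.\<close>

lemma image_factorization:
  assumes "f \<in> Arr C"
  obtains m e where "is_mono C m" "is_epi C e" "m \<bullet> e = f" "Dom C m = Cod C e" "Cod C m = Cod C f"
    "Dom C e = Dom C f"
proof -
  let ?c = "coker f"
  let ?m = "ker ?c"
  have m: "?c \<in> Arr C" "Dom C ?c = Cod C f" "?m \<in> Arr C" "Cod C ?m = Cod C f" "is_mono C ?m"
    using assms by auto
  have "subobject_le C f ?m"
    using le_ker_iff[of ?c f] assms m by simp
  then obtain e where e: "e \<in> Arr C" "Dom C e = Dom C f" "Cod C e = Dom C ?m" "?m \<bullet> e = f"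
    by (rule subobject_leE)
  have "is_epi C e"
  proof (rule epiI)
    fix g assume g: "g \<in> Arr C" "Dom C g = Cod C e" "null (g \<bullet> e)"
    let ?k = "ker g"
    have k: "?k \<in> Arr C" "Cod C ?k = Cod C e" "is_mono C ?k" using g by auto
    have "subobject_le C e ?k" using le_ker_iff[of g e] g e by simp
    then obtain e' where e': "e' \<in> Arr C" "Dom C e' = Dom C e" "Cod C e' = Dom C ?k" "?k \<bullet> e' = e"
      by (rule subobject_leE)
    have mk: "is_mono C (?m \<bullet> ?k)" using m k e by (intro mono_Comp) auto
    obtain h where h: "is_kernel C (?m \<bullet> ?k) h" using mono_normal[OF mk] by blast
    note h' = is_kernelD[OF h]
    have hm: "h \<in> Arr C" "Dom C h = Cod C f" using h' m k e by auto
    have "f = (?m \<bullet> ?k) \<bullet> e'" using e e' m k by simp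
    then have "h \<bullet> f = (h \<bullet> (?m \<bullet> ?k)) \<bullet> e'" using e e' m k hm by simp
    then have "null (h \<bullet> f)" using h'(4) e e' m k hm by (metis Arr_Comp h'(1,2,3) null_Comp_right)
    then obtain y where y: "y \<in> Arr C" "Dom C y = Cod C ?c" "Cod C y = Cod C h" "y \<bullet> ?c = h"
      using coker_factor[of h f] hm assms by auto
    have "null (y \<bullet> (?c \<bullet> ?m))" using y m by - (rule null_Comp_left, auto)
    then have "null (h \<bullet> ?m)" using Comp_assoc_right[of y ?c ?m] y m by simp
    then have "subobject_le C ?m (?m \<bullet> ?k)" using h'(5)[of ?m] m hm by simp
    then obtain r where r: "r \<in> Arr C" "Dom C r = Dom C ?m" "Cod C r = Dom C (?m \<bullet> ?k)" "(?m \<bullet> ?k) \<bullet> r = ?m"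
      by (rule subobject_leE)
    have "?k \<bullet> r = Ident C (Dom C ?m)"
      by (rule monoD[OF m(5)]) (use r m k e in auto)
    then have "g = g \<bullet> (?k \<bullet> r)" using g e by simp
    also have "\<dots> = (g \<bullet> ?k) \<bullet> r" using g k e r m by simp
    finally show "null g" using null_Comp_right[of "g \<bullet> ?k" r] g k e r m by simp
  qed (use e in auto)
  then show thesis using that[of ?m e] e m by simp
qed

text \<open>For an arrow \<open>a\<close> that need not be monic,
  \<open>null (coker a \<bullet> f)\<close> expresses that \<open>f\<close> lands in the image of
  \<open>a\<close>. As \<open>coker m\<close> kills \<open>a\<close>, it factors through
  \<open>coker a\<close> and kills \<open>f\<close> as well.\<close>

lemma image_le_mono:
  assumes "is_mono C m" "m \<bullet> e = a" "e \<in> Arr C" "Cod C e = Dom C m"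
    and f: "f \<in> Arr C" "Cod C f = Cod C m" "null (coker a \<bullet> f)"
  shows "subobject_le C f m"
proof -
  have m: "m \<in> Arr C" using assms by simp
  have a: "a \<in> Arr C" "Cod C a = Cod C m" using assms m by auto
  have "null (coker m \<bullet> m \<bullet> e)" by (rule null_Comp_right[OF coker(3)[OF m]]) (use assms m in auto)
  then have "null (coker m \<bullet> a)" using assms m by simp
  then obtain y where y: "y \<in> Arr C" "Dom C y = Cod C (coker a)" "Cod C y = Cod C (coker m)"
    "y \<bullet> coker a = coker m" by (rule coker_factor) (use a m in auto)
  have "null (y \<bullet> (coker a \<bullet> f))" by (rule null_Comp_left[OF f(3)]) (use y a f in auto)
  moreover have "y \<bullet> (coker a \<bullet> f) = coker m \<bullet> f"
    by (rule Comp_eq_CompI[OF y(4)]) (use y a f in auto)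
  ultimately show ?thesis using mono_le_iff[OF assms(1) f(1,2)] by simp
qed

lemma mono_epi_iso:
  assumes "is_mono C f" "is_epi C f"
  obtains g where "g \<in> Arr C" "Dom C g = Cod C f" "Cod C g = Dom C f"
    "f \<bullet> g = Ident C (Cod C f)" "g \<bullet> f = Ident C (Dom C f)"
proof -
  have f: "f \<in> Arr C" using assms by simp
  have "null (coker f)" using assms f epi_iff_coker by blast
  then have "null (coker f \<bullet> Ident C (Cod C f))" using f by simp
  then have "subobject_le C (Ident C (Cod C f)) f"
    using mono_le_iff[OF assms(1)] f by simp
  then obtain g where g: "g \<in> Arr C" "Dom C g = Dom C (Ident C (Cod C f))" "Cod C g = Dom C f"
      "f \<bullet> g = Ident C (Cod C f)"
    by (rule subobject_leE)
  have "g \<bullet> f = Ident C (Dom C f)"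
    by (rule monoD[OF assms(1)]) (use g f Comp_eq_CompI[OF g(4), of f] in auto)
  then show thesis using that g f by simp
qed

section \<open>Biproducts, pullbacks of epis and splittings\<close>

lemma biproduct_obtain:
  assumes "A \<in> Obj C" "B \<in> Obj C"
  obtains S i j p q where "S \<in> Obj C" "i \<in> Hom C A S" "j \<in> Hom C B S" "p \<in> Hom C S A" "q \<in> Hom C S B"
    "p \<bullet> i = Ident C A" "q \<bullet> j = Ident C B" "p \<bullet> j = Zero C B A" "q \<bullet> i = Zero C A B"
    "(i \<bullet> p) \<^bold>+ (j \<bullet> q) = Ident C S"
proof -
  obtain S where "S \<in> Obj C" "is_biproduct C S A B" using biproducts[OF assms] by blast
  then show thesis unfolding is_biproduct_def using that by blast
qed

text \<open>The pullback is the kernel of the difference \<open>d\<close> of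
  \<open>f \<bullet> p\<close> and \<open>e \<bullet> q\<close> on the biproduct, and
  \<open>d\<close> is epi because on the summand \<open>Dom C e\<close> it is \<open>e\<close> up to
  sign. If \<open>g\<close> kills the first leg, then \<open>g \<bullet> p = h \<bullet> d\<close>
  for some \<open>h\<close>; restricting to \<open>Dom C e\<close> gives
  \<open>h \<bullet> e = 0\<close>, so \<open>h\<close>, then \<open>g \<bullet> p\<close>, then
  \<open>g\<close> vanish.\<close>

lemma epi_pullback:
  assumes "is_epi C e" "f \<in> Arr C" "Cod C f = Cod C e"
  obtains p q where "is_epi C p" "q \<in> Arr C" "Dom C p = Dom C q" "Cod C p = Dom C f"
    "Cod C q = Dom C e" "f \<bullet> p = e \<bullet> q"
proof -
  have e: "e \<in> Arr C" using assms by simp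
  obtain S i j p q where S: "S \<in> Obj C" "i \<in> Hom C (Dom C f) S" "j \<in> Hom C (Dom C e) S"
    "p \<in> Hom C S (Dom C f)" "q \<in> Hom C S (Dom C e)"
    "p \<bullet> i = Ident C (Dom C f)" "q \<bullet> j = Ident C (Dom C e)"
    "p \<bullet> j = Zero C (Dom C e) (Dom C f)" "q \<bullet> i = Zero C (Dom C f) (Dom C e)"
    using biproduct_obtain[of "Dom C f" "Dom C e"] assms e by (metis Dom_in_Obj)
  note S' = S[unfolded in_Hom]
  let ?d = "diff (f \<bullet> p) (e \<bullet> q)"
  have d: "?d \<in> Arr C" "Dom C ?d = S" "Cod C ?d = Cod C f"
    using Arr_diff[of "f \<bullet> p" "e \<bullet> q"] S' assms e by auto
  have d_null: "null (m \<bullet> ?d \<bullet> x) \<longleftrightarrow> m \<bullet> (f \<bullet> (p \<bullet> x)) = m \<bullet> (e \<bullet> (q \<bullet> x))"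
    if "m \<in> Arr C" "Dom C m = Cod C f" "x \<in> Arr C" "Cod C x = S" for m x
    using that S' assms e Comp_diff[of "f \<bullet> p" "e \<bullet> q" m]
      null_diff_Comp_iff[of "m \<bullet> (f \<bullet> p)" "m \<bullet> (e \<bullet> q)" x] by simp
  have epi_d: "is_epi C ?d"
  proof (rule epiI)
    fix h assume h: "h \<in> Arr C" "Dom C h = Cod C ?d" "null (h \<bullet> ?d)"
    have "null (h \<bullet> ?d \<bullet> j)" using h d S' by - (rule null_Comp_right, auto)
    then have "h \<bullet> (f \<bullet> (p \<bullet> j)) = h \<bullet> (e \<bullet> (q \<bullet> j))" using d_null[of h j] h d S' by simp
    then have "null (h \<bullet> e)" using h d S' assms e by (simp add: null_def)
    then show "null h" using epi_null_iff[OF assms(1)] h d assms by simp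
  qed (use d in auto)
  let ?k = "ker ?d"
  have k: "?k \<in> Arr C" "Cod C ?k = S" "null (?d \<bullet> ?k)" using d by auto
  have "is_epi C (p \<bullet> ?k)"
  proof (rule epiI)
    fix g assume g: "g \<in> Arr C" "Dom C g = Cod C (p \<bullet> ?k)" "null (g \<bullet> (p \<bullet> ?k))"
    have "null ((g \<bullet> p) \<bullet> ?k)" using g S' k by simp
    then obtain h where h: "h \<in> Arr C" "Dom C h = Cod C ?d" "Cod C h = Cod C (g \<bullet> p)" "h \<bullet> ?d = g \<bullet> p"
      using epi_factor[OF epi_d, of "g \<bullet> p"] g S' k d by auto
    have hdj: "h \<bullet> ?d \<bullet> j = g \<bullet> (p \<bullet> j)" using h g S' k by simp
    have "null (g \<bullet> (p \<bullet> j))" using S' g k e assms by simp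
    then have "null (h \<bullet> ?d \<bullet> j)" by (simp only: hdj)
    then have "h \<bullet> (f \<bullet> (p \<bullet> j)) = h \<bullet> (e \<bullet> (q \<bullet> j))" using d_null[of h j] h d S' by simp
    then have "null (h \<bullet> e)" using h d S' assms e by (simp add: null_def)
    then have "null h" using epi_null_iff[OF assms(1)] h d assms by simp
    then have "null (g \<bullet> p)" using h d null_Comp_right[of h ?d] by simp
    then have "null (g \<bullet> p \<bullet> i)" using g S' k by - (rule null_Comp_right, auto)
    then show "null g" using g S' k by simp
  qed (use k S' in auto)
  moreover have "f \<bullet> (p \<bullet> ?k) = e \<bullet> (q \<bullet> ?k)"
    using d_null[of "Ident C (Cod C f)" ?k] k S' assms e d by simp
  ultimately show thesis using that[of "p \<bullet> ?k" "q \<bullet> ?k"] k S' e by simp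
qed

text \<open>The second summand is the kernel of the retraction \<open>r\<close>. The difference of
  the identity and \<open>k \<bullet> r\<close> is killed by \<open>r\<close>, and its factor
  \<open>t\<close> through \<open>ker r\<close> is the second projection.\<close>

lemma split_mono_biproduct:
  assumes "k \<in> Hom C K E" "r \<in> Hom C E K" "r \<bullet> k = Ident C K"
  shows "is_biproduct C E K (Dom C (ker r))"
proof -
  let ?s = "ker r"
  note kr = assms(1,2)[unfolded in_Hom]
  have E: "E \<in> Obj C" "K \<in> Obj C" using kr by auto
  have s: "?s \<in> Arr C" "Cod C ?s = E" "is_mono C ?s" "null (r \<bullet> ?s)" using kr by auto
  then have rs: "r \<bullet> ?s = Zero C (Dom C ?s) K" using kr by (simp add: null_def)
  let ?d = "diff (Ident C E) (k \<bullet> r)"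
  have d: "?d \<in> Arr C" "Dom C ?d = E" "Cod C ?d = E" and d_plus: "?d \<^bold>+ (k \<bullet> r) = Ident C E"
    using Arr_diff[of "Ident C E" "k \<bullet> r"] diff_spec[of "Ident C E" "k \<bullet> r"] kr E by auto
  have "null (r \<bullet> ?d)"
    using null_Comp_diff_iff[of "Ident C E" "k \<bullet> r" r] kr E Comp_eq_CompI[OF assms(3), of r] by simp
  then have "subobject_le C ?d ?s" using le_ker_iff[of r ?d] d kr by simp
  then obtain t where t: "t \<in> Arr C" "Dom C t = Dom C ?d" "Cod C t = Dom C ?s" "?s \<bullet> t = ?d"
    by (rule subobject_leE)
  have ds: "?d \<bullet> ?s = ?s"
  proof -
    have "?s = (?d \<^bold>+ (k \<bullet> r)) \<bullet> ?s" using d_plus s by simp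
    also have "\<dots> = ?d \<bullet> ?s \<^bold>+ k \<bullet> r \<bullet> ?s"
      by (rule Plus_Comp[of ?s "Dom C ?s" E ?d E "k \<bullet> r"]) (use s d kr in \<open>auto simp: in_Hom\<close>)
    also have "\<dots> = ?d \<bullet> ?s" using s d kr rs by (simp add: Plus_Zero)
    finally show ?thesis by simp
  qed
  have ts: "t \<bullet> ?s = Ident C (Dom C ?s)"
    by (rule monoD[OF s(3)]) (use t s d ds Comp_eq_CompI[OF t(4), of ?s] in auto)
  have "?d \<bullet> k = Zero C K E"
  proof -
    have "null (?d \<bullet> k)"
    proof (subst null_diff_Comp_iff)
      have "(k \<bullet> r) \<bullet> k = k \<bullet> (r \<bullet> k)" using kr by simp
      also have "\<dots> = k" unfolding assms(3) using kr by simp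
      finally show "Ident C E \<bullet> k = (k \<bullet> r) \<bullet> k" using kr by simp
    qed (use kr E in simp_all)
    then show ?thesis using d kr by (simp add: null_def)
  qed
  then have "null (?s \<bullet> (t \<bullet> k))" using Comp_eq_CompI[OF t(4), of k] t s kr d E by simp
  then have "null (t \<bullet> k)" using mono_null_iff[OF s(3), of "t \<bullet> k"] t s kr d by simp
  then have tk: "t \<bullet> k = Zero C K (Dom C ?s)" using t s kr d by (simp add: null_def)
  have plus: "(k \<bullet> r) \<^bold>+ (?s \<bullet> t) = Ident C E"
    using d_plus Plus_commute[of E E ?d "k \<bullet> r"] t d kr E by (simp add: in_Hom)
  show ?thesis
    unfolding is_biproduct_def
    by (rule bexI[of _ k], rule bexI[of _ ?s], rule bexI[of _ r], rule bexI[of _ t])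
       (use assms rs ts tk plus kr s t d in \<open>auto simp: in_Hom\<close>)
qed

text \<open>Supplies the short exact sequences to which the exactness of directed colimits is
  applied.\<close>

lemma mono_short_exact:
  assumes "is_mono C m"
  shows "short_exact C m (coker m)"
proof -
  have m: "m \<in> Arr C" using assms by simp
  have "is_kernel C m (coker m)"
    unfolding is_kernel_def
  proof (intro conjI ballI impI)
    fix x assume x: "x \<in> Arr C" "Cod C x = Dom C (coker m) \<and> coker m \<bullet> x = Zero C (Dom C x) (Cod C (coker m))"
    then have "null (coker m \<bullet> x)" using m by simp
    then have "subobject_le C x m" using mono_le_iff[OF assms, of x] x m by simp
    then obtain y where y: "y \<in> Arr C" "Dom C y = Dom C x" "Cod C y = Dom C m" "m \<bullet> y = x"
      by (rule subobject_leE)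
    show "\<exists>!h. h \<in> Hom C (Dom C x) (Dom C m) \<and> m \<bullet> h = x"
    proof (rule ex1I[of _ y])
      fix h assume "h \<in> Hom C (Dom C x) (Dom C m) \<and> m \<bullet> h = x"
      then show "h = y" by (intro monoD[OF assms, of h y]) (use y in \<open>auto simp: in_Hom\<close>)
    qed (use y in \<open>auto simp: in_Hom\<close>)
  qed (use m coker(3)[OF m] in \<open>auto simp: null_def\<close>)
  then show ?thesis using is_cokernel_coker[OF m] by (simp add: short_exact_def)
qed

section \<open>Noetherian objects\<close>

lemma noetherianD:
  "\<lbrakk>noetherian C A; \<And>n. is_mono C (s n) \<and> Cod C (s n) = A \<and> subobject_le C (s n) (s (Suc n))\<rbrakk> \<Longrightarrow>
    \<exists>N::nat. \<forall>n\<ge>N. subobject_le C (s n) (s N) \<and> subobject_le C (s N) (s n)"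
  unfolding noetherian_def by blast

text \<open>Without a maximal member, dependent choice builds a strictly increasing chain from
  \<open>m0\<close>. Distinct arrows may represent the same subobject, so maximality is stated by
  \<open>subobject_le\<close> and not by equality.\<close>

lemma noetherian_maximal:
  assumes "noetherian C A" "m0 \<in> S" "\<And>m. m \<in> S \<Longrightarrow> is_mono C m \<and> Cod C m = A"
  obtains m where "m \<in> S" "\<And>m'. \<lbrakk>m' \<in> S; subobject_le C m m'\<rbrakk> \<Longrightarrow> subobject_le C m' m"
proof (rule ccontr)
  note maximal = that
  assume "\<not> thesis"
  then have *: "\<exists>m'\<in>S. subobject_le C m m' \<and> \<not> subobject_le C m' m" if "m \<in> S" for m
    using maximal that by blast
  have "\<exists>s. s 0 = m0 \<and> (\<forall>n::nat. s n \<in> S \<and> subobject_le C (s n) (s (Suc n)) \<and> \<not> subobject_le C (s (Suc n)) (s n))"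
    using dependent_nat_choice[of "\<lambda>n m. m \<in> S \<and> (n = 0 \<longrightarrow> m = m0)"
      "\<lambda>_ m m'. subobject_le C m m' \<and> \<not> subobject_le C m' m"] assms(2) * by (metis old.nat.distinct(2))
  then obtain s where s: "\<And>n::nat. s n \<in> S" "\<And>n. subobject_le C (s n) (s (Suc n))"
    "\<And>n. \<not> subobject_le C (s (Suc n)) (s n)" by blast
  then obtain N where "\<forall>n\<ge>N. subobject_le C (s n) (s N) \<and> subobject_le C (s N) (s n)"
    using assms(1,3) unfolding noetherian_def by blast
  then show False using s(3)[of N] by (metis le_SucI order_refl)
qed

text \<open>Composition with \<open>m\<close> preserves and reflects the order of subobjects, so a
  chain in \<open>Dom C m\<close> becomes one in \<open>Cod C m\<close>.\<close>

lemma noetherian_Dom_mono: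
  assumes "is_mono C m" "noetherian C (Cod C m)"
  shows "noetherian C (Dom C m)"
  unfolding noetherian_def
proof (intro conjI allI impI)
  have m: "m \<in> Arr C" using assms by simp
  then show "Dom C m \<in> Obj C" by simp
  fix s :: "nat \<Rightarrow> 'm"
  assume s: "\<forall>n. is_mono C (s n) \<and> Cod C (s n) = Dom C m \<and> subobject_le C (s n) (s (Suc n))"
  have le: "subobject_le C (m \<bullet> s i) (m \<bullet> s j) \<longleftrightarrow> subobject_le C (s i) (s j)" for i j
  proof
    assume "subobject_le C (m \<bullet> s i) (m \<bullet> s j)"
    then obtain y where y: "y \<in> Arr C" "Dom C y = Dom C (m \<bullet> s i)" "Cod C y = Dom C (m \<bullet> s j)"
      "(m \<bullet> s j) \<bullet> y = m \<bullet> s i" by (rule subobject_leE)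
    have "s j \<bullet> y = s i"
      by (rule monoD[OF assms(1)]) (use y s m in auto)
    then show "subobject_le C (s i) (s j)"
      by (rule subobject_leI) (use y s m in auto)
  next
    assume "subobject_le C (s i) (s j)"
    then obtain y where y: "y \<in> Arr C" "Dom C y = Dom C (s i)" "Cod C y = Dom C (s j)"
      "s j \<bullet> y = s i" by (rule subobject_leE)
    have "(m \<bullet> s j) \<bullet> y = m \<bullet> s i" using Comp_assoc_right[of m "s j" y] y s m by simp
    then show "subobject_le C (m \<bullet> s i) (m \<bullet> s j)"
      by (rule subobject_leI) (use y s m in auto)
  qed
  have "is_mono C (m \<bullet> s n) \<and> Cod C (m \<bullet> s n) = Cod C m \<and> subobject_le C (m \<bullet> s n) (m \<bullet> s (Suc n))" for n
    using s m le mono_Comp[OF assms(1)] by simp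
  then show "\<exists>N. \<forall>n\<ge>N. subobject_le C (s n) (s N) \<and> subobject_le C (s N) (s n)"
    unfolding le[symmetric] by (rule noetherianD[OF assms(2)])
qed

text \<open>The preimage of \<open>s n\<close> under \<open>e\<close> is the kernel of
  \<open>coker (s n) \<bullet> e\<close>. Taking preimages along an epi preserves and reflects the
  order, so the chain of preimages in \<open>Dom C e\<close> decides stability.\<close>

lemma noetherian_Cod_epi:
  assumes "is_epi C e" "noetherian C (Dom C e)"
  shows "noetherian C (Cod C e)"
  unfolding noetherian_def
proof (intro conjI allI impI)
  have e: "e \<in> Arr C" using assms by simp
  then show "Cod C e \<in> Obj C" by simp
  fix s :: "nat \<Rightarrow> 'm"
  assume s: "\<forall>n. is_mono C (s n) \<and> Cod C (s n) = Cod C e \<and> subobject_le C (s n) (s (Suc n))"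
  define c where "c n = coker (s n)" for n
  have c: "c n \<in> Arr C" "Dom C (c n) = Cod C e" "is_epi C (c n)" "null (c n \<bullet> s n)" for n
    using s by (auto simp: c_def)
  have ce: "is_epi C (c n \<bullet> e)" for n
    by (rule epi_Comp) (use c e assms in auto)
  have le: "subobject_le C (ker (c i \<bullet> e)) (ker (c j \<bullet> e)) \<longleftrightarrow> subobject_le C (s i) (s j)" for i j
  proof -
    have "subobject_le C (ker (c i \<bullet> e)) (ker (c j \<bullet> e)) \<longleftrightarrow> null ((c j \<bullet> e) \<bullet> ker (c i \<bullet> e))"
      by (rule le_ker_iff) (use c e in auto)
    also have "\<dots> \<longleftrightarrow> null (c j \<bullet> s i)"
    proof
      assume "null ((c j \<bullet> e) \<bullet> ker (c i \<bullet> e))"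
      then obtain y where y: "y \<in> Arr C" "Dom C y = Cod C (c i \<bullet> e)" "Cod C y = Cod C (c j \<bullet> e)"
        "y \<bullet> (c i \<bullet> e) = c j \<bullet> e" by (rule epi_factor[OF ce]) (use c e in auto)
      have "y \<bullet> c i = c j" by (rule epiD[OF assms(1)]) (use y c e in auto)
      moreover have "null (y \<bullet> (c i \<bullet> s i))"
        by (rule null_Comp_left[OF c(4)]) (use y c e s in auto)
      moreover have "(y \<bullet> c i) \<bullet> s i = y \<bullet> (c i \<bullet> s i)" using y c e s by simp
      ultimately show "null (c j \<bullet> s i)" by simp
    next
      assume "null (c j \<bullet> s i)"
      then obtain y where y: "y \<in> Arr C" "Dom C y = Cod C (coker (s i))" "Cod C y = Cod C (c j)"
        "y \<bullet> coker (s i) = c j" by (rule coker_factor) (use c e s in auto)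
      have "null ((c i \<bullet> e) \<bullet> ker (c i \<bullet> e))"
        by (rule ker(3)) (use c e in auto)
      then have "null (y \<bullet> ((c i \<bullet> e) \<bullet> ker (c i \<bullet> e)))"
        by (rule null_Comp_left) (use y c e s in \<open>auto simp: c_def[symmetric]\<close>)
      moreover have "y \<bullet> ((c i \<bullet> e) \<bullet> ker (c i \<bullet> e)) = ((y \<bullet> c i) \<bullet> e) \<bullet> ker (c i \<bullet> e)"
        using y(1-3) c e s by (simp add: c_def[symmetric])
      ultimately show "null ((c j \<bullet> e) \<bullet> ker (c i \<bullet> e))" using y(4) by (simp add: c_def)
    qed
    also have "\<dots> \<longleftrightarrow> subobject_le C (s i) (s j)"
      unfolding c_def by (rule mono_le_iff[symmetric]) (use s in auto)
    finally show ?thesis .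
  qed
  have "is_mono C (ker (c n \<bullet> e)) \<and> Cod C (ker (c n \<bullet> e)) = Dom C e \<and>
    subobject_le C (ker (c n \<bullet> e)) (ker (c (Suc n) \<bullet> e))" for n
    using s e c le by simp
  then show "\<exists>N. \<forall>n\<ge>N. subobject_le C (s n) (s N) \<and> subobject_le C (s N) (s n)"
    unfolding le[symmetric] by (rule noetherianD[OF assms(2)])
qed

text \<open>An index whose kernel is maximal among all the kernels works: beyond it kernels can only
  grow, so they stay the same subobject. Kernels are described by the arrows that they absorb, which
  is the form needed when images are embedded in later stages.\<close>

lemma noetherian_kernels_stabilize:
  assumes "noetherian C A" "I \<noteq> {}" and g: "\<And>i. i \<in> I \<Longrightarrow> g i \<in> Arr C \<and> Dom C (g i) = A"
    and mono: "\<And>i j x. \<lbrakk>i \<in> I; j \<in> I; leq i j; x \<in> Arr C; Cod C x = A; null (g i \<bullet> x)\<rbrakk> \<Longrightarrow> null (g j \<bullet> x)"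
  obtains i where "i \<in> I"
    "\<And>j x. \<lbrakk>j \<in> I; leq i j; x \<in> Arr C; Cod C x = A; null (g j \<bullet> x)\<rbrakk> \<Longrightarrow> null (g i \<bullet> x)"
proof -
  obtain i0 where "i0 \<in> I" using assms(2) by blast
  then obtain m where m: "m \<in> (\<lambda>i. ker (g i)) ` I"
    and max: "\<And>m'. \<lbrakk>m' \<in> (\<lambda>i. ker (g i)) ` I; subobject_le C m m'\<rbrakk> \<Longrightarrow> subobject_le C m' m"
    using noetherian_maximal[OF assms(1) imageI[of i0 I "\<lambda>i. ker (g i)"]] g
    by (smt (verit) imageE ker(2,4))
  then obtain i where i: "i \<in> I" "m = ker (g i)" by blast
  show thesis
  proof (rule that[OF i(1)])
    fix j x assume j: "j \<in> I" "leq i j" "x \<in> Arr C" "Cod C x = A" "null (g j \<bullet> x)"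
    have "null (g j \<bullet> ker (g i))"
      by (rule mono[of i j]) (use i j g in auto)
    then have "subobject_le C (ker (g i)) (ker (g j))"
      by (subst le_ker_iff) (use i j g in auto)
    then have 1: "subobject_le C (ker (g j)) (ker (g i))" using max i j by blast
    have 2: "subobject_le C x (ker (g j))"
      by (subst le_ker_iff) (use i j g in auto)
    have "subobject_le C x (ker (g i))"
      by (rule subobject_le_trans[OF 2 1]) (use i j g in auto)
    then show "null (g i \<bullet> x)"
      by (subst (asm) le_ker_iff) (use i j g in auto)
  qed
qed

section \<open>Directed colimits\<close>

text \<open>The arrow induced on the cokernel of \<open>f\<close>. A function is wanted, since a
  directed system needs its transition arrows for all pairs of indices at once.\<close>

definition coker_map :: "'m \<Rightarrow> 'm \<Rightarrow> 'm" where
  "coker_map f x = (SOME y. y \<in> Arr C \<and> Dom C y = Cod C (coker f) \<and> Cod C y = Cod C x \<and> y \<bullet> coker f = x)"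

lemma coker_map:
  assumes "null (x \<bullet> f)" "f \<in> Arr C" "x \<in> Arr C" "Dom C x = Cod C f"
  shows "coker_map f x \<in> Arr C" "Dom C (coker_map f x) = Cod C (coker f)"
    "Cod C (coker_map f x) = Cod C x" "coker_map f x \<bullet> coker f = x"
proof -
  have "\<exists>y. y \<in> Arr C \<and> Dom C y = Cod C (coker f) \<and> Cod C y = Cod C x \<and> y \<bullet> coker f = x"
    using coker_factor[OF assms] by blast
  from someI_ex[OF this]
  show "coker_map f x \<in> Arr C" "Dom C (coker_map f x) = Cod C (coker f)"
    "Cod C (coker_map f x) = Cod C x" "coker_map f x \<bullet> coker f = x"
    by (auto simp: coker_map_def)
qed

text \<open>If \<open>d\<close> kills \<open>y\<close>, pull \<open>e\<close> back along
  \<open>y\<close> to get \<open>y \<bullet> p = e \<bullet> q\<close> with \<open>p\<close> epi.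
  Then \<open>d\<close> kills \<open>e \<bullet> q\<close>, so \<open>e \<bullet> q\<close> is zero,
  and so is \<open>y\<close>. In the applications \<open>e\<close> is a quotient map and
  \<open>d\<close> the arrow induced on the quotient.\<close>

lemma mono_of_same_kernel:
  assumes "is_epi C e" "d \<in> Arr C" "Dom C d = Cod C e"
    and "\<And>x. \<lbrakk>x \<in> Arr C; Cod C x = Dom C e; null (d \<bullet> (e \<bullet> x))\<rbrakk> \<Longrightarrow> null (e \<bullet> x)"
  shows "is_mono C d"
proof (rule monoI[OF assms(2)])
  fix y assume y: "y \<in> Arr C" "Cod C y = Dom C d" "null (d \<bullet> y)"
  obtain p q where pq: "is_epi C p" "q \<in> Arr C" "Dom C p = Dom C q" "Cod C p = Dom C y"
    "Cod C q = Dom C e" "y \<bullet> p = e \<bullet> q"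
    by (rule epi_pullback[OF assms(1), of y]) (use y assms in auto)
  have "null ((d \<bullet> y) \<bullet> p)" by (rule null_Comp_right[OF y(3)]) (use pq y assms in auto)
  moreover have "(d \<bullet> y) \<bullet> p = d \<bullet> (y \<bullet> p)" by (rule Comp_assoc_right) (use pq y assms in auto)
  ultimately have "null (d \<bullet> (e \<bullet> q))" using pq(6) by simp
  then have "null (y \<bullet> p)" unfolding pq(6) by (rule assms(4)[rotated 2]) (use pq in auto)
  then show "null y" by (subst (asm) epi_null_iff[OF pq(1)]) (use pq y in auto)
qed

end

text \<open>The index conditions of \<open>directed_system\<close>, separated from the diagram so
  that cofinal subsets can be treated alone. The relation is a preorder on \<open>I\<close>;
  antisymmetry is not demanded.\<close>

definition directed_on :: "'i set \<Rightarrow> ('i \<Rightarrow> 'i \<Rightarrow> bool) \<Rightarrow> bool" where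
  "directed_on I leq \<longleftrightarrow>
     I \<noteq> {} \<and> (\<forall>i\<in>I. leq i i) \<and>
     (\<forall>i\<in>I. \<forall>j\<in>I. \<forall>k\<in>I. leq i j \<and> leq j k \<longrightarrow> leq i k) \<and>
     (\<forall>i\<in>I. \<forall>j\<in>I. \<exists>k\<in>I. leq i k \<and> leq j k)"

lemma directed_onD:
  assumes "directed_on I leq"
  shows "I \<noteq> {}" "i \<in> I \<Longrightarrow> leq i i"
    "\<lbrakk>leq i j; leq j k; i \<in> I; j \<in> I; k \<in> I\<rbrakk> \<Longrightarrow> leq i k"
    "\<lbrakk>i \<in> I; j \<in> I\<rbrakk> \<Longrightarrow> \<exists>k\<in>I. leq i k \<and> leq j k"
  using assms unfolding directed_on_def by blast+

lemma directed_on_above: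
  assumes "directed_on I leq" "i0 \<in> I"
  shows "directed_on {i\<in>I. leq i0 i} leq"
  unfolding directed_on_def
proof (intro conjI ballI impI, goal_cases)
  case (4 i j)
  then obtain k where "k \<in> I" "leq i k" "leq j k" using directed_onD(4)[OF assms(1), of i j] by blast
  then show ?case using directed_onD(3)[OF assms(1), of i0 i k] 4 assms(2) by blast
next
  case (3 i j k)
  then show ?case using directed_onD(3)[OF assms(1), of i j k] by blast
qed (use assms directed_onD(2)[OF assms(1)] in blast)+

lemma directed_constant:
  assumes "directed_on I leq" "\<And>i j. \<lbrakk>i \<in> I; j \<in> I; leq i j\<rbrakk> \<Longrightarrow> f i = f j" "i \<in> I" "j \<in> I"
  shows "f i = f j"
  using directed_onD(4)[OF assms(1,3,4)] assms(2)[of i] assms(2)[of j] assms(3,4) by metis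

section \<open>Directed systems and colimits in an arbitrary category\<close>

context category
begin

lemma directed_system_iff: "directed_system C I leq X x \<longleftrightarrow> directed_on I leq \<and>
     (\<forall>i\<in>I. X i \<in> Obj C \<and> x i i = Ident C (X i)) \<and>
     (\<forall>i\<in>I. \<forall>j\<in>I. leq i j \<longrightarrow> x i j \<in> Hom C (X i) (X j)) \<and>
     (\<forall>i\<in>I. \<forall>j\<in>I. \<forall>k\<in>I. leq i j \<and> leq j k \<longrightarrow> x j k \<bullet> x i j = x i k)"
  unfolding directed_system_def directed_on_def by blast

lemma colimitD:
  assumes "is_directed_colimit C I leq X x L l"
  shows "directed_on I leq" "L \<in> Obj C"
    "i \<in> I \<Longrightarrow> X i \<in> Obj C" "i \<in> I \<Longrightarrow> x i i = Ident C (X i)"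
    "\<lbrakk>i \<in> I; j \<in> I; leq i j\<rbrakk> \<Longrightarrow> x i j \<in> Arr C"
    "\<lbrakk>i \<in> I; j \<in> I; leq i j\<rbrakk> \<Longrightarrow> Dom C (x i j) = X i"
    "\<lbrakk>i \<in> I; j \<in> I; leq i j\<rbrakk> \<Longrightarrow> Cod C (x i j) = X j"
    "\<lbrakk>leq i j; leq j k; i \<in> I; j \<in> I; k \<in> I\<rbrakk> \<Longrightarrow> x j k \<bullet> x i j = x i k"
    "i \<in> I \<Longrightarrow> l i \<in> Arr C" "i \<in> I \<Longrightarrow> Dom C (l i) = X i" "i \<in> I \<Longrightarrow> Cod C (l i) = L"
    "\<lbrakk>i \<in> I; j \<in> I; leq i j\<rbrakk> \<Longrightarrow> l j \<bullet> x i j = l i"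
    "is_cocone C I leq X x T t \<Longrightarrow> \<exists>!h. h \<in> Hom C L T \<and> (\<forall>i\<in>I. h \<bullet> l i = t i)"
proof -
  have ds: "directed_system C I leq X x" and cc: "is_cocone C I leq X x L l"
    using assms unfolding is_directed_colimit_def by blast+
  show "directed_on I leq"  "i \<in> I \<Longrightarrow> X i \<in> Obj C" "i \<in> I \<Longrightarrow> x i i = Ident C (X i)"
    "\<lbrakk>leq i j; leq j k; i \<in> I; j \<in> I; k \<in> I\<rbrakk> \<Longrightarrow> x j k \<bullet> x i j = x i k"
    using ds unfolding directed_system_iff by blast+
  show "L \<in> Obj C" "\<lbrakk>i \<in> I; j \<in> I; leq i j\<rbrakk> \<Longrightarrow> l j \<bullet> x i j = l i"
    using cc unfolding is_cocone_def by blast+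
  have "\<lbrakk>i \<in> I; j \<in> I; leq i j\<rbrakk> \<Longrightarrow> x i j \<in> Hom C (X i) (X j)"
    using ds unfolding directed_system_iff by blast
  then show "\<lbrakk>i \<in> I; j \<in> I; leq i j\<rbrakk> \<Longrightarrow> x i j \<in> Arr C"
    "\<lbrakk>i \<in> I; j \<in> I; leq i j\<rbrakk> \<Longrightarrow> Dom C (x i j) = X i"
    "\<lbrakk>i \<in> I; j \<in> I; leq i j\<rbrakk> \<Longrightarrow> Cod C (x i j) = X j" by (simp_all add: in_Hom)
  have "i \<in> I \<Longrightarrow> l i \<in> Hom C (X i) L"
    using cc unfolding is_cocone_def by blast
  then show "i \<in> I \<Longrightarrow> l i \<in> Arr C" "i \<in> I \<Longrightarrow> Dom C (l i) = X i" "i \<in> I \<Longrightarrow> Cod C (l i) = L"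
    by (simp_all add: in_Hom)
  show "is_cocone C I leq X x T t \<Longrightarrow> \<exists>!h. h \<in> Hom C L T \<and> (\<forall>i\<in>I. h \<bullet> l i = t i)"
    using assms unfolding is_directed_colimit_def by blast
qed

lemma coconeI:
  assumes "T \<in> Obj C" "\<And>i. i \<in> I \<Longrightarrow> t i \<in> Arr C" "\<And>i. i \<in> I \<Longrightarrow> Dom C (t i) = X i"
    "\<And>i. i \<in> I \<Longrightarrow> Cod C (t i) = T" "\<And>i j. \<lbrakk>i \<in> I; j \<in> I; leq i j\<rbrakk> \<Longrightarrow> t j \<bullet> x i j = t i"
  shows "is_cocone C I leq X x T t"
  using assms unfolding is_cocone_def in_Hom by blast

lemma coconeD:
  assumes "is_cocone C I leq X x T t"
  shows "T \<in> Obj C" "i \<in> I \<Longrightarrow> t i \<in> Arr C" "i \<in> I \<Longrightarrow> Dom C (t i) = X i"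
    "i \<in> I \<Longrightarrow> Cod C (t i) = T" "\<lbrakk>i \<in> I; j \<in> I; leq i j\<rbrakk> \<Longrightarrow> t j \<bullet> x i j = t i"
  using assms unfolding is_cocone_def in_Hom by blast+

text \<open>Cofinality: a cocone on the indices above \<open>i0\<close> extends to \<open>I\<close>
  by moving each \<open>i\<close> to some \<open>k i\<close> above both \<open>i\<close> and
  \<open>i0\<close>. The choice of \<open>k i\<close> does not matter, because any two candidates
  have a common upper bound.\<close>

lemma directed_colimit_above:
  assumes lim: "is_directed_colimit C I leq X x L l" and i0: "i0 \<in> I"
  shows "is_directed_colimit C {i\<in>I. leq i0 i} leq X x L l" (is "is_directed_colimit C ?J _ _ _ _ _")
  unfolding is_directed_colimit_def
proof (intro conjI allI impI)
  note L = colimitD[OF lim]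
  note dir = directed_onD[OF L(1)]
  show "directed_system C ?J leq X x"
    using directed_on_above[OF L(1) i0] lim
    unfolding is_directed_colimit_def directed_system_iff by blast
  show "is_cocone C ?J leq X x L l"
    using lim unfolding is_directed_colimit_def is_cocone_def by blast
  fix T t assume "is_cocone C ?J leq X x T t"
  note t = coconeD[OF this]
  have "\<exists>k. k \<in> ?J \<and> leq i k" if "i \<in> I" for i
    using dir(4)[OF that i0] by blast
  then obtain k where k: "\<And>i. i \<in> I \<Longrightarrow> k i \<in> ?J \<and> leq i (k i)" by metis
  define t' where "t' i = t (k i) \<bullet> x i (k i)" for i
  have t'_eq: "t' i = t j \<bullet> x i j" if i: "i \<in> I" and j: "j \<in> ?J" "leq i j" for i j
  proof -
    obtain m where m: "m \<in> I" "leq (k i) m" "leq j m"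
      using dir(4)[of "k i" j] k[OF i] j by blast
    then have m': "m \<in> ?J" using dir(3)[of i0 j m] i0 j by blast
    have "t (k i) \<bullet> x i (k i) = (t m \<bullet> x (k i) m) \<bullet> x i (k i)"
      using t(5)[of "k i" m] k[OF i] m m' by simp
    also have "\<dots> = t m \<bullet> (x (k i) m \<bullet> x i (k i))"
      by (rule Comp_assoc_right) (use t L k[OF i] m m' i in auto)
    also have "\<dots> = t m \<bullet> (x j m \<bullet> x i j)"
      using L(8)[of i "k i" m] L(8)[of i j m] k[OF i] j m m' i by simp
    also have "\<dots> = (t m \<bullet> x j m) \<bullet> x i j"
      by (rule Comp_assoc_right[symmetric]) (use t L k[OF i] m m' i j in auto)
    also have "\<dots> = t j \<bullet> x i j" using t(5)[of j m] j m m' by simp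
    finally show ?thesis by (simp add: t'_def)
  qed
  have t'_J: "t' i = t i" if "i \<in> ?J" for i
    using t'_eq[of i i] that dir(2)[of i] L t by simp
  have "is_cocone C I leq X x T t'"
  proof (rule coconeI)
    fix i j assume ij: "i \<in> I" "j \<in> I" "leq i j"
    have "t' j \<bullet> x i j = t (k j) \<bullet> (x j (k j) \<bullet> x i j)"
      unfolding t'_def by (rule Comp_assoc_right) (use t L k[of j] ij in auto)
    also have "\<dots> = t (k j) \<bullet> x i (k j)" using L(8)[of i j "k j"] k[of j] ij by simp
    also have "\<dots> = t' i"
      using t'_eq[of i "k j"] k[of j] ij dir(3)[of i j "k j"] by simp
    finally show "t' j \<bullet> x i j = t' i" .
  qed (use t L k in \<open>auto simp: t'_def\<close>)
  from L(13)[OF this]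
  have "\<exists>!h. h \<in> Hom C L T \<and> (\<forall>i\<in>I. h \<bullet> l i = t' i)" .
  moreover have "(\<forall>i\<in>I. h \<bullet> l i = t' i) \<longleftrightarrow> (\<forall>i\<in>?J. h \<bullet> l i = t i)" if h: "h \<in> Hom C L T" for h
  proof
    assume "\<forall>i\<in>I. h \<bullet> l i = t' i" then show "\<forall>i\<in>?J. h \<bullet> l i = t i" using t'_J by simp
  next
    assume *: "\<forall>i\<in>?J. h \<bullet> l i = t i"
    show "\<forall>i\<in>I. h \<bullet> l i = t' i"
    proof
      fix i assume i: "i \<in> I"
      have "h \<bullet> l i = h \<bullet> (l (k i) \<bullet> x i (k i))" using L(12)[of i "k i"] k[OF i] i by simp
      also have "\<dots> = (h \<bullet> l (k i)) \<bullet> x i (k i)"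
        by (rule Comp_assoc_right[symmetric]) (use h L k[OF i] i in \<open>auto simp: in_Hom\<close>)
      finally show "h \<bullet> l i = t' i" using * k[OF i] by (simp add: t'_def)
    qed
  qed
  ultimately show "\<exists>!h. h \<in> Hom C L T \<and> (\<forall>i\<in>?J. h \<bullet> l i = t i)"
    by (simp cong: conj_cong)
qed

text \<open>The composition law may also use \<open>leq i k\<close>, which transitivity
  supplies.\<close>

lemma directed_colimitI:
  assumes "directed_on I leq" "\<And>i. i \<in> I \<Longrightarrow> X i \<in> Obj C" "\<And>i. i \<in> I \<Longrightarrow> x i i = Ident C (X i)"
    "\<And>i j. \<lbrakk>i \<in> I; j \<in> I; leq i j\<rbrakk> \<Longrightarrow> x i j \<in> Arr C \<and> Dom C (x i j) = X i \<and> Cod C (x i j) = X j"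
    "\<And>i j k. \<lbrakk>i \<in> I; j \<in> I; k \<in> I; leq i j; leq j k; leq i k\<rbrakk> \<Longrightarrow> x j k \<bullet> x i j = x i k"
    "is_cocone C I leq X x L l"
    "\<And>T t. is_cocone C I leq X x T t \<Longrightarrow> \<exists>!h. h \<in> Hom C L T \<and> (\<forall>i\<in>I. h \<bullet> l i = t i)"
  shows "is_directed_colimit C I leq X x L l"
proof -
  have "directed_system C I leq X x"
    unfolding directed_system_iff in_Hom
  proof (intro conjI ballI impI)
    fix i j k assume "i \<in> I" "j \<in> I" "k \<in> I" "leq i j \<and> leq j k"
    then show "x j k \<bullet> x i j = x i k"
      using assms(5)[of i j k] directed_onD(3)[OF assms(1), of i j k] by blast
  qed (use assms in blast)+
  then show ?thesis
    unfolding is_directed_colimit_def using assms(6,7) by blast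
qed

text \<open>A directed index set is connected, so all legs of a cocone on a constant system
  coincide, and this common leg is the mediating arrow.\<close>

lemma constant_colimit:
  assumes "directed_on I leq" "D \<in> Obj C"
  shows "is_directed_colimit C I leq (\<lambda>_. D) (\<lambda>_ _. Ident C D) D (\<lambda>_. Ident C D)"
proof (rule directed_colimitI)
  show "is_cocone C I leq (\<lambda>_. D) (\<lambda>_ _. Ident C D) D (\<lambda>_. Ident C D)"
    by (rule coconeI) (use assms in auto)
  fix T t assume "is_cocone C I leq (\<lambda>_. D) (\<lambda>_ _. Ident C D) T t"
  note t = coconeD[OF this]
  obtain i where i: "i \<in> I" using directed_onD(1)[OF assms(1)] by blast
  have eq: "t j = t i" if "j \<in> I" for j
    by (rule directed_constant[OF assms(1) _ that i]) (use t(2-)in force)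
  show "\<exists>!h. h \<in> Hom C D T \<and> (\<forall>i\<in>I. h \<bullet> Ident C D = t i)"
  proof (rule ex1I[of _ "t i"])
    have "t i \<bullet> Ident C D = t j" if "j \<in> I" for j
      using Comp_Ident_right[OF t(2,3)[OF i]] eq[OF that] by metis
    then show "t i \<in> Hom C D T \<and> (\<forall>j\<in>I. t i \<bullet> Ident C D = t j)"
      using t(2-4)[OF i] by (blast intro: in_Hom[THEN iffD2])
    fix h assume "h \<in> Hom C D T \<and> (\<forall>i\<in>I. h \<bullet> Ident C D = t i)"
    then show "h = t i" using i by (auto simp: in_Hom)
  qed
qed (use assms in auto)

end

section \<open>Cokernels of directed systems\<close>

context abelian_category
begin

text \<open>Cokernels commute with colimits. A cocone on the quotients, precomposed with the
  quotient maps, is a cocone on \<open>X\<close>; its mediating arrow kills \<open>u\<close>, as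
  \<open>u\<close> factors through some \<open>d i\<close>, and therefore descends to
  \<open>coker u\<close>. The other two conclusions are the compatibilities required by the
  exactness axiom.\<close>

lemma coker_colimit:
  assumes lim: "is_directed_colimit C I leq X x L l"
    and d: "\<And>i. i \<in> I \<Longrightarrow> d i \<in> Arr C \<and> Dom C (d i) = D \<and> Cod C (d i) = X i"
    and comp: "\<And>i j. \<lbrakk>i \<in> I; j \<in> I; leq i j\<rbrakk> \<Longrightarrow> x i j \<bullet> d i = d j"
    and u: "u \<in> Arr C" "Dom C u = D" "Cod C u = L" "\<And>i. i \<in> I \<Longrightarrow> l i \<bullet> d i = u"
  shows "is_directed_colimit C I leq (\<lambda>i. Cod C (coker (d i)))
    (\<lambda>i j. coker_map (d i) (coker (d j) \<bullet> x i j)) (Cod C (coker u)) (\<lambda>i. coker_map (d i) (coker u \<bullet> l i))"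
    (is "is_directed_colimit C I leq ?Q ?q ?N ?n")
    and "system_map C I leq X x (\<lambda>i. Cod C (coker (d i)))
    (\<lambda>i j. coker_map (d i) (coker (d j) \<bullet> x i j)) (\<lambda>i. coker (d i))"
    and "\<And>i. i \<in> I \<Longrightarrow> coker u \<bullet> l i = coker_map (d i) (coker u \<bullet> l i) \<bullet> coker (d i)"
proof -
  note L = colimitD[OF lim]
  define c where "c i = coker (d i)" for i
  have c: "c i \<in> Arr C" "Dom C (c i) = X i" "null (c i \<bullet> d i)" "is_epi C (c i)" if "i \<in> I" for i
    using d[OF that] by (auto simp: c_def)
  define q where "q i j = coker_map (d i) (c j \<bullet> x i j)" for i j
  have q: "q i j \<in> Arr C" "Dom C (q i j) = Cod C (c i)" "Cod C (q i j) = Cod C (c j)"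
      "q i j \<bullet> c i = c j \<bullet> x i j" if ij: "i \<in> I" "j \<in> I" "leq i j" for i j
  proof -
    have "c j \<bullet> x i j \<bullet> d i = c j \<bullet> d j"
      using comp[OF ij] Comp_assoc_right[of "c j" "x i j" "d i"] c d L ij by metis
    then have "null ((c j \<bullet> x i j) \<bullet> d i)" using c ij by simp
    from coker_map[OF this] show "q i j \<in> Arr C" "Dom C (q i j) = Cod C (c i)" "Cod C (q i j) = Cod C (c j)"
      "q i j \<bullet> c i = c j \<bullet> x i j"
      using ij c d L unfolding q_def c_def[symmetric] by simp_all
  qed
  have cu: "coker u \<in> Arr C" "Dom C (coker u) = L" "is_epi C (coker u)" using u by auto
  define n where "n i = coker_map (d i) (coker u \<bullet> l i)" for i
  have n: "n i \<in> Arr C" "Dom C (n i) = Cod C (c i)" "Cod C (n i) = Cod C (coker u)"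
      "n i \<bullet> c i = coker u \<bullet> l i" if i: "i \<in> I" for i
  proof -
    have "coker u \<bullet> l i \<bullet> d i = coker u \<bullet> u"
      using u(4)[OF i] Comp_assoc_right[of "coker u" "l i" "d i"] cu d L i by metis
    then have "null ((coker u \<bullet> l i) \<bullet> d i)" using u by simp
    from coker_map[OF this] show "n i \<in> Arr C" "Dom C (n i) = Cod C (c i)" "Cod C (n i) = Cod C (coker u)"
      "n i \<bullet> c i = coker u \<bullet> l i"
      using i cu d L unfolding n_def c_def[symmetric] by simp_all
  qed
  show "\<And>i. i \<in> I \<Longrightarrow> coker u \<bullet> l i = coker_map (d i) (coker u \<bullet> l i) \<bullet> coker (d i)"
    using n(4) unfolding n_def c_def by simp
  have "system_map C I leq X x (\<lambda>i. Cod C (c i)) q c"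
    unfolding system_map_def in_Hom using c q by simp
  then show "system_map C I leq X x (\<lambda>i. Cod C (coker (d i)))
    (\<lambda>i j. coker_map (d i) (coker (d j) \<bullet> x i j)) (\<lambda>i. coker (d i))"
    unfolding c_def q_def .
  have "is_directed_colimit C I leq (\<lambda>i. Cod C (c i)) q (Cod C (coker u)) n"
  proof (rule directed_colimitI)
    show "q i i = Ident C (Cod C (c i))" if i: "i \<in> I" for i
    proof -
      have ii: "leq i i" using directed_onD(2)[OF L(1) i] .
      show ?thesis
        by (rule epiD[OF c(4)[OF i]]) (use q[OF i i ii] c[OF i] L(4)[OF i] in auto)
    qed
    show "q j k \<bullet> q i j = q i k" if ijk: "i \<in> I" "j \<in> I" "k \<in> I" "leq i j" "leq j k" "leq i k" for i j k
    proof (rule epiD[OF c(4)[OF ijk(1)]])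
      note [simp] = c ijk L(5-7) q(1-3)
      have "(q j k \<bullet> q i j) \<bullet> c i = q j k \<bullet> (q i j \<bullet> c i)" by simp
      also have "\<dots> = q j k \<bullet> (c j \<bullet> x i j)" by (simp only: q(4)[OF ijk(1,2,4)])
      also have "\<dots> = (q j k \<bullet> c j) \<bullet> x i j" by simp
      also have "\<dots> = (c k \<bullet> x j k) \<bullet> x i j" by (simp only: q(4)[OF ijk(2,3,5)])
      also have "\<dots> = c k \<bullet> (x j k \<bullet> x i j)" by simp
      also have "\<dots> = c k \<bullet> x i k" by (simp only: L(8)[OF ijk(4,5,1-3)])
      also have "\<dots> = q i k \<bullet> c i" by (simp only: q(4)[OF ijk(1,3,6)])
      finally show "(q j k \<bullet> q i j) \<bullet> c i = q i k \<bullet> c i" .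
    qed (use q ijk c in auto)
    show "is_cocone C I leq (\<lambda>i. Cod C (c i)) q (Cod C (coker u)) n"
    proof (rule coconeI)
      fix i j assume ij: "i \<in> I" "j \<in> I" "leq i j"
      note [simp] = c ij L(5-7,9-11) q(1-3) n(1-3) cu
      show "n j \<bullet> q i j = n i"
      proof (rule epiD[OF c(4)[OF ij(1)]])
        have "(n j \<bullet> q i j) \<bullet> c i = n j \<bullet> (q i j \<bullet> c i)" by simp
        also have "\<dots> = n j \<bullet> (c j \<bullet> x i j)" by (simp only: q(4)[OF ij])
        also have "\<dots> = (n j \<bullet> c j) \<bullet> x i j" by simp
        also have "\<dots> = (coker u \<bullet> l j) \<bullet> x i j" by (simp only: n(4)[OF ij(2)])
        also have "\<dots> = coker u \<bullet> (l j \<bullet> x i j)" by simp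
        also have "\<dots> = coker u \<bullet> l i" by (simp only: L(12)[OF ij])
        also have "\<dots> = n i \<bullet> c i" by (simp only: n(4)[OF ij(1)])
        finally show "(n j \<bullet> q i j) \<bullet> c i = n i \<bullet> c i" .
      qed auto
    qed (use n cu in auto)
    fix T t assume "is_cocone C I leq (\<lambda>i. Cod C (c i)) q T t"
    note t = coconeD[OF this]
    have "is_cocone C I leq X x T (\<lambda>i. t i \<bullet> c i)"
    proof (rule coconeI)
      fix i j assume ij: "i \<in> I" "j \<in> I" "leq i j"
      note [simp] = c ij L(5-7) q(1-3) t(2-4)
      have "(t j \<bullet> c j) \<bullet> x i j = t j \<bullet> (c j \<bullet> x i j)" by simp
      also have "\<dots> = t j \<bullet> (q i j \<bullet> c i)" by (simp only: q(4)[OF ij])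
      also have "\<dots> = (t j \<bullet> q i j) \<bullet> c i" by simp
      also have "\<dots> = t i \<bullet> c i" by (simp only: t(5)[OF ij])
      finally show "(t j \<bullet> c j) \<bullet> x i j = t i \<bullet> c i" .
    qed (use t c in auto)
    from L(13)[OF this] obtain h where h: "h \<in> Hom C L T" "\<And>i. i \<in> I \<Longrightarrow> h \<bullet> l i = t i \<bullet> c i"
      and h_unique: "\<And>h'. \<lbrakk>h' \<in> Hom C L T; \<And>i. i \<in> I \<Longrightarrow> h' \<bullet> l i = t i \<bullet> c i\<rbrakk> \<Longrightarrow> h' = h"
      by blast
    note h' = h(1)[unfolded in_Hom]
    obtain i where i: "i \<in> I" using directed_onD(1)[OF L(1)] by blast
    have "null (h \<bullet> u)"
    proof -
      note [simp] = c i L(9-11) t(2-4) h' d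
      have "h \<bullet> u = (h \<bullet> l i) \<bullet> d i" unfolding u(4)[OF i, symmetric] by simp
      also have "\<dots> = t i \<bullet> (c i \<bullet> d i)" unfolding h(2)[OF i] by simp
      finally show ?thesis using null_Comp_left[OF c(3)[OF i], of "t i"] by simp
    qed
    then obtain g where g: "g \<in> Arr C" "Dom C g = Cod C (coker u)" "Cod C g = Cod C h" "g \<bullet> coker u = h"
      by (rule coker_factor) (use u h' in auto)
    show "\<exists>!h. h \<in> Hom C (Cod C (coker u)) T \<and> (\<forall>i\<in>I. h \<bullet> n i = t i)"
    proof (rule ex1I[of _ g], intro conjI ballI)
      fix i assume i: "i \<in> I"
      note [simp] = c i L(9-11) t(2-4) h' d g(1-3) n(1-3) cu
      show "g \<bullet> n i = t i"
      proof (rule epiD[OF c(4)[OF i]])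
        have "(g \<bullet> n i) \<bullet> c i = g \<bullet> (n i \<bullet> c i)" by simp
        also have "\<dots> = g \<bullet> (coker u \<bullet> l i)" by (simp only: n(4)[OF i])
        also have "\<dots> = (g \<bullet> coker u) \<bullet> l i" by simp
        also have "\<dots> = t i \<bullet> c i" by (simp only: g(4) h(2)[OF i])
        finally show "(g \<bullet> n i) \<bullet> c i = t i \<bullet> c i" .
      qed auto
    next
      fix k assume k: "k \<in> Hom C (Cod C (coker u)) T \<and> (\<forall>i\<in>I. k \<bullet> n i = t i)"
      then have k': "k \<in> Arr C" "Dom C k = Cod C (coker u)" "Cod C k = T" "\<And>i. i \<in> I \<Longrightarrow> k \<bullet> n i = t i"
        by (auto simp: in_Hom)
      have "k \<bullet> coker u = h"
      proof (rule h_unique)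
        fix i assume i: "i \<in> I"
        note [simp] = c i L(9-11) t(2-4) h' d k'(1-3) n(1-3) cu
        have "(k \<bullet> coker u) \<bullet> l i = k \<bullet> (coker u \<bullet> l i)" by simp
        also have "\<dots> = k \<bullet> (n i \<bullet> c i)" by (simp only: n(4)[OF i])
        also have "\<dots> = (k \<bullet> n i) \<bullet> c i" by simp
        also have "\<dots> = t i \<bullet> c i" by (simp only: k'(4)[OF i])
        finally show "(k \<bullet> coker u) \<bullet> l i = t i \<bullet> c i" .
      qed (use k' cu in \<open>auto simp: in_Hom\<close>)
      then show "k = g"
        by (intro epiD[OF cu(3), of k g]) (use k' g cu h' in auto)
    qed (use g h' in \<open>auto simp: in_Hom\<close>)
  qed (use L(1) c q in auto)
  then show "is_directed_colimit C I leq ?Q ?q ?N ?n"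
    unfolding c_def q_def n_def .
qed

text \<open>Both \<open>h\<close> and the zero arrow mediate the same cocone, so they are
  equal.\<close>

lemma colimit_jointly_epi:
  assumes lim: "is_directed_colimit C I leq X x L l"
    and h: "h \<in> Arr C" "Dom C h = L" "\<And>i. i \<in> I \<Longrightarrow> null (h \<bullet> l i)"
  shows "null h"
proof -
  note L = colimitD[OF lim]
  let ?z = "Zero C L (Cod C h)"
  have z: "?z \<bullet> l i = h \<bullet> l i" if "i \<in> I" for i
    using h that L by (simp add: null_def)
  have "is_cocone C I leq X x (Cod C h) (\<lambda>i. h \<bullet> l i)"
  proof (rule coconeI)
    fix i j assume ij: "i \<in> I" "j \<in> I" "leq i j"
    have "(h \<bullet> l j) \<bullet> x i j = h \<bullet> (l j \<bullet> x i j)"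
      by (rule Comp_assoc_right) (use ij h L in auto)
    then show "(h \<bullet> l j) \<bullet> x i j = h \<bullet> l i" by (simp only: L(12)[OF ij])
  qed (use h L in auto)
  note ex = L(13)[OF this]
  have "?z \<in> Hom C L (Cod C h)" "h \<in> Hom C L (Cod C h)" using h L(2) by (simp_all add: in_Hom)
  then have "?z = h" using ex z by blast
  moreover have "null ?z" using h L(2) by simp
  ultimately show ?thesis by simp
qed

end

section \<open>Smallness, and monos into a directed colimit\<close>

lemma small_lepoll: "\<lbrakk>small U X; Y \<lesssim> X\<rbrakk> \<Longrightarrow> small U Y"
  unfolding small_def by (rule lesspoll_trans1)

lemma small_subset: "\<lbrakk>small U X; Y \<subseteq> X\<rbrakk> \<Longrightarrow> small U Y"
  unfolding small_def by (meson lesspoll_trans1 subset_imp_lepoll)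

context grothendieck_category
begin

text \<open>
  Exactness of the directed colimit of \<open>D \<rightarrow> X i \<rightarrow> coker (d i)\<close>, with \<open>D\<close> a constant system.
\<close>

lemma mono_into_colimit:
  fixes I :: "'u set"
  assumes small: "small U I" and lim: "is_directed_colimit C I leq X x L l"
    and d: "\<And>i. i \<in> I \<Longrightarrow> is_mono C (d i) \<and> Dom C (d i) = D \<and> Cod C (d i) = X i"
    and comp: "\<And>i j. \<lbrakk>i \<in> I; j \<in> I; leq i j\<rbrakk> \<Longrightarrow> x i j \<bullet> d i = d j"
    and i0: "i0 \<in> I"
  shows "is_mono C (l i0 \<bullet> d i0)"
proof -
  note L = colimitD[OF lim]
  have d': "d i \<in> Arr C \<and> Dom C (d i) = D \<and> Cod C (d i) = X i" if "i \<in> I" for i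
    using d[OF that] by auto
  define u where "u = l i0 \<bullet> d i0"
  have D: "D \<in> Obj C" using d'[OF i0] by auto
  have u: "u \<in> Arr C" "Dom C u = D" "Cod C u = L"
    using d'[OF i0] L i0 by (auto simp: u_def)
  have u_eq: "l i \<bullet> d i = u" if i: "i \<in> I" for i
    unfolding u_def
  proof (rule directed_constant[OF L(1) _ i i0])
    fix i j assume ij: "i \<in> I" "j \<in> I" "leq i j"
    have "l i \<bullet> d i = (l j \<bullet> x i j) \<bullet> d i" by (simp only: L(12)[OF ij])
    also have "\<dots> = l j \<bullet> (x i j \<bullet> d i)"
      by (rule Comp_assoc_right) (use ij d' L in auto)
    also have "\<dots> = l j \<bullet> d j" by (simp only: comp[OF ij])
    finally show "l i \<bullet> d i = l j \<bullet> d j" .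
  qed
  note Q = coker_colimit[of I leq X x L l d D u, OF lim d' comp u u_eq, simplified]
  have const: "system_map C I leq (\<lambda>_. D) (\<lambda>_ _. Ident C D) X x d"
    unfolding system_map_def in_Hom
    using d' comp D by auto
  have "short_exact C u (coker u)"
  proof (rule directed_colimits_exact[OF small constant_colimit[OF L(1) D] lim Q(1) const Q(2)])
    show "\<forall>i\<in>I. short_exact C (d i) (coker (d i))" using d mono_short_exact by blast
    show "u \<in> Hom C D L" using u by (simp add: in_Hom)
    show "\<forall>i\<in>I. u \<bullet> Ident C D = l i \<bullet> d i" using u u_eq by simp
    show "coker u \<in> Hom C L (Cod C (coker u))" using u by (simp add: in_Hom)
    show "\<forall>i\<in>I. coker u \<bullet> l i = coker_map (d i) (coker u \<bullet> l i) \<bullet> coker (d i)" using Q(3) by blast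
  qed
  then show ?thesis
    using is_kernelD(6) unfolding short_exact_def u_def by blast
qed

end

section \<open>Noetherian objects are finitely presented\<close>

context abelian_category
begin

text \<open>Everything follows by composing with the decomposition of the identity of
  \<open>S\<close> through its two summands. The form suits the sum of two subobjects: jointly monic
  projections, jointly epic injections, and copairing.\<close>

lemma biproduct_universal:
  assumes "A \<in> Obj C" "B \<in> Obj C"
  obtains i j p q where
    "i \<in> Arr C" "Dom C i = A" "j \<in> Arr C" "Dom C j = B" "Cod C j = Cod C i"
    "p \<in> Arr C" "Dom C p = Cod C i" "Cod C p = A" "q \<in> Arr C" "Dom C q = Cod C i" "Cod C q = B"
    "p \<bullet> i = Ident C A" "null (q \<bullet> i)"
    "\<And>x. \<lbrakk>x \<in> Arr C; Cod C x = Cod C i; null (p \<bullet> x); null (q \<bullet> x)\<rbrakk> \<Longrightarrow> null x"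
    "\<And>x y. \<lbrakk>x \<in> Arr C; y \<in> Arr C; Dom C x = Cod C i; Dom C y = Cod C i; Cod C x = Cod C y;
       x \<bullet> i = y \<bullet> i; x \<bullet> j = y \<bullet> j\<rbrakk> \<Longrightarrow> x = y"
    "\<And>u v. \<lbrakk>u \<in> Arr C; v \<in> Arr C; Dom C u = A; Dom C v = B; Cod C u = Cod C v\<rbrakk> \<Longrightarrow>
       \<exists>w. w \<in> Arr C \<and> Dom C w = Cod C i \<and> Cod C w = Cod C u \<and> w \<bullet> i = u \<and> w \<bullet> j = v"
proof -
  obtain S i j p q where S: "S \<in> Obj C" "i \<in> Hom C A S" "j \<in> Hom C B S" "p \<in> Hom C S A" "q \<in> Hom C S B"
    "p \<bullet> i = Ident C A" "q \<bullet> j = Ident C B" "p \<bullet> j = Zero C B A" "q \<bullet> i = Zero C A B"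
    "(i \<bullet> p) \<^bold>+ (j \<bullet> q) = Ident C S"
    by (rule biproduct_obtain[OF assms])
  note H = S(2-5)[unfolded in_Hom]
  have ip: "i \<bullet> p \<in> Hom C S S" "j \<bullet> q \<in> Hom C S S" using H by (simp_all add: in_Hom)
  show thesis
  proof (rule that[of i j p q])
    fix x assume x: "x \<in> Arr C" "Cod C x = Cod C i" "null (p \<bullet> x)" "null (q \<bullet> x)"
    have "x = ((i \<bullet> p) \<^bold>+ (j \<bullet> q)) \<bullet> x" unfolding S(10) using x H by simp
    also have "\<dots> = (i \<bullet> p \<bullet> x) \<^bold>+ (j \<bullet> q \<bullet> x)"
      by (rule Plus_Comp[OF _ ip]) (use x H in \<open>simp add: in_Hom\<close>)
    also have "\<dots> = (i \<bullet> (p \<bullet> x)) \<^bold>+ (j \<bullet> (q \<bullet> x))" using x H by simp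
    also have "\<dots> = Zero C (Dom C x) S \<^bold>+ Zero C (Dom C x) S"
      using nullD[OF x(3) refl refl] nullD[OF x(4) refl refl] x(1,2) H by simp
    also have "\<dots> = Zero C (Dom C x) S" using Plus_Zero[of "Zero C (Dom C x) S" "Dom C x" S] S(1) x(1) by simp
    finally have eq: "x = Zero C (Dom C x) S" .
    show "null x" by (subst eq) (use S(1) x(1) in simp)
  next
    fix x y assume xy: "x \<in> Arr C" "y \<in> Arr C" "Dom C x = Cod C i" "Dom C y = Cod C i" "Cod C x = Cod C y"
       "x \<bullet> i = y \<bullet> i" "x \<bullet> j = y \<bullet> j"
    have expand: "z = (z \<bullet> i) \<bullet> p \<^bold>+ (z \<bullet> j) \<bullet> q" if z: "z \<in> Arr C" "Dom C z = Cod C i" for z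
    proof -
      have "z = z \<bullet> ((i \<bullet> p) \<^bold>+ (j \<bullet> q))" unfolding S(10) using z H by simp
      also have "\<dots> = z \<bullet> (i \<bullet> p) \<^bold>+ z \<bullet> (j \<bullet> q)"
        by (rule Comp_Plus[OF ip]) (use z H in \<open>simp add: in_Hom\<close>)
      finally show ?thesis using z H by simp
    qed
    show "x = y" using expand[OF xy(1,3)] expand[OF xy(2,4)] xy(6,7) by simp
  next
    fix u v assume uv: "u \<in> Arr C" "v \<in> Arr C" "Dom C u = A" "Dom C v = B" "Cod C u = Cod C v"
    let ?T = "Cod C u"
    let ?w = "(u \<bullet> p) \<^bold>+ (v \<bullet> q)"
    have up: "u \<bullet> p \<in> Hom C S ?T" "v \<bullet> q \<in> Hom C S ?T" using uv H by (simp_all add: in_Hom)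
    have w: "?w \<in> Hom C S ?T" using Plus_in_Hom[of S ?T] up S(1) uv by simp
    have "?w \<bullet> i = (u \<bullet> p \<bullet> i) \<^bold>+ (v \<bullet> q \<bullet> i)" by (rule Plus_Comp[OF S(2) up])
    also have "\<dots> = u \<^bold>+ Zero C A ?T" using uv H S(6-9) assms by simp
    also have "\<dots> = u" using Plus_Zero uv by simp
    finally have 1: "?w \<bullet> i = u" .
    have "?w \<bullet> j = (u \<bullet> p \<bullet> j) \<^bold>+ (v \<bullet> q \<bullet> j)" by (rule Plus_Comp[OF S(3) up])
    also have "\<dots> = Zero C B ?T \<^bold>+ v" using uv H S(6-9) assms by simp
    also have "\<dots> = v" using Plus_Zero uv by simp
    finally have 2: "?w \<bullet> j = v" .
    show "\<exists>w. w \<in> Arr C \<and> Dom C w = Cod C i \<and> Cod C w = Cod C u \<and> w \<bullet> i = u \<and> w \<bullet> j = v"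
      by (rule exI[of _ ?w]) (use 1 2 w H in \<open>simp add: in_Hom\<close>)
  qed (use H S assms in simp_all)
qed

lemma generating_set_detects:
  assumes "generating_set U C \<G>" "z \<in> Arr C" "\<not> null z"
  obtains h where "Dom C h \<in> \<G>" "h \<in> Arr C" "Cod C h = Dom C z" "\<not> null (z \<bullet> h)"
proof -
  let ?o = "Zero C (Dom C z) (Cod C z)"
  have "z \<noteq> ?o" using assms(3) by (simp add: null_def)
  moreover have "z \<in> Hom C (Dom C z) (Cod C z)" "?o \<in> Hom C (Dom C z) (Cod C z)"
    using assms(2) by (simp_all add: in_Hom)
  ultimately obtain G h where h: "G \<in> \<G>" "h \<in> Hom C G (Dom C z)" "z \<bullet> h \<noteq> ?o \<bullet> h"
    using assms(1,2) Dom_in_Obj Cod_in_Obj unfolding generating_set_def by blast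
  have "\<not> null (z \<bullet> h)"
  proof
    assume "null (z \<bullet> h)"
    then have "z \<bullet> h = ?o \<bullet> h" using h(2) assms(2) by (simp add: in_Hom null_def)
    then show False using h(3) by simp
  qed
  then show thesis using that[of h] h by (auto simp: in_Hom)
qed

end

section \<open>Arrows from noetherian objects into directed colimits\<close>

context grothendieck_category
begin

text \<open>
  The kernels of \<open>N \<rightarrow> V / im (a i)\<close> stabilize, at \<open>K\<close> say. The constant system \<open>N / K\<close> then embeds in the
  system of all \<open>V / im (a i)\<close>, whose colimit is zero.
\<close>

lemma noetherian_into_directed_union:
  fixes I :: "'u set"
  assumes small: "small U I" and dir: "directed_on I leq"
    and a: "\<And>i. i \<in> I \<Longrightarrow> a i \<in> Arr C \<and> Cod C (a i) = V"
    and le: "\<And>i j. \<lbrakk>i \<in> I; j \<in> I; leq i j\<rbrakk> \<Longrightarrow> null (coker (a j) \<bullet> a i)"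
    and epi: "\<And>h. \<lbrakk>h \<in> Arr C; Dom C h = V; \<And>i. i \<in> I \<Longrightarrow> null (h \<bullet> a i)\<rbrakk> \<Longrightarrow> null h"
    and f: "f \<in> Arr C" "Cod C f = V" "noetherian C (Dom C f)"
  obtains i where "i \<in> I" "null (coker (a i) \<bullet> f)"
proof -
  define c where "c i = coker (a i)" for i
  have c: "c i \<in> Arr C" "Dom C (c i) = V" "is_epi C (c i)" "null (c i \<bullet> a i)" if "i \<in> I" for i
    using a[OF that] by (auto simp: c_def)
  define q where "q i j = coker_map (a i) (c j)" for i j
  have q: "q i j \<in> Arr C" "Dom C (q i j) = Cod C (c i)" "Cod C (q i j) = Cod C (c j)"
    "q i j \<bullet> c i = c j" if ij: "i \<in> I" "j \<in> I" "leq i j" for i j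
    using coker_map[OF le[OF ij]] a[OF ij(1)] a[OF ij(2)] unfolding q_def c_def by simp_all
  have cf: "null ((c i \<bullet> f) \<bullet> y) \<Longrightarrow> null ((c j \<bullet> f) \<bullet> y)"
    if ij: "i \<in> I" "j \<in> I" "leq i j" and y: "y \<in> Arr C" "Cod C y = Dom C f" for i j y
  proof -
    assume n: "null ((c i \<bullet> f) \<bullet> y)"
    note [simp] = c(1,2) ij q(1-3) y f(1,2)
    have "(c j \<bullet> f) \<bullet> y = q i j \<bullet> c i \<bullet> f \<bullet> y" by (simp only: q(4)[OF ij])
    also have "\<dots> = q i j \<bullet> ((c i \<bullet> f) \<bullet> y)" by simp
    finally show ?thesis using null_Comp_left[OF n, of "q i j"] by simp
  qed
  obtain i0 where i0: "i0 \<in> I" and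
    stable: "\<And>j y. \<lbrakk>j \<in> I; leq i0 j; y \<in> Arr C; Cod C y = Dom C f; null ((c j \<bullet> f) \<bullet> y)\<rbrakk> \<Longrightarrow>
       null ((c i0 \<bullet> f) \<bullet> y)"
    by (rule noetherian_kernels_stabilize[OF f(3), of I "\<lambda>i. c i \<bullet> f" leq])
       (use directed_onD(1)[OF dir] c f cf in auto)
  \<comment> \<open>From \<open>i0\<close> on the kernel of \<open>c i \<bullet> f\<close> is
    stable, so only there does the image of \<open>f\<close> modulo \<open>a i0\<close> embed in
    each later quotient.\<close>
  let ?J = "{i\<in>I. leq i0 i}"
  have dirJ: "directed_on ?J leq" by (rule directed_on_above[OF dir i0])
  have i0J: "i0 \<in> ?J" using i0 directed_onD(2)[OF dir] by simp
  obtain m e where me: "is_mono C m" "is_epi C e" "m \<bullet> e = c i0 \<bullet> f" "Dom C m = Cod C e"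
    "Cod C m = Cod C (c i0)" "Dom C e = Dom C f"
    by (rule image_factorization[of "c i0 \<bullet> f"]) (use c[OF i0] f in auto)
  have me': "m \<in> Arr C" "e \<in> Arr C" using me by auto
  obtain Z where Z: "is_zero_object C Z" using zero_object by blast
  then have Z': "Z \<in> Obj C" by (simp add: is_zero_object_def)
  \<comment> \<open>The colimit of the quotients is zero: in a cocone \<open>t\<close> all
    composites \<open>t i \<bullet> c i\<close> are one arrow out of \<open>V\<close>. It kills
    every \<open>a k\<close>, as one sees at an index above both \<open>i0\<close> and
    \<open>k\<close>, so it vanishes by the assumption \<open>epi\<close>, and each
    \<open>t i\<close> vanishes with it.\<close>
  have lim: "is_directed_colimit C ?J leq (\<lambda>i. Cod C (c i)) q Z (\<lambda>i. Zero C (Cod C (c i)) Z)"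
  proof (rule directed_colimitI[OF dirJ])
    show "q i i = Ident C (Cod C (c i))" if "i \<in> ?J" for i
      by (rule epiD[OF c(3)[of i]]) (use that q[of i i] c[of i] directed_onD(2)[OF dir, of i] in auto)
    show "q j k \<bullet> q i j = q i k" if ijk: "i \<in> ?J" "j \<in> ?J" "k \<in> ?J" "leq i j" "leq j k" "leq i k" for i j k
    proof (rule epiD[OF c(3)[of i]])
      have ijk': "i \<in> I" "j \<in> I" "k \<in> I" using ijk by auto
      note [simp] = c(1,2) ijk' ijk(4-6) q(1-3)
      have "(q j k \<bullet> q i j) \<bullet> c i = q j k \<bullet> (q i j \<bullet> c i)" by simp
      also have "\<dots> = c k" by (simp only: q(4)[OF ijk'(1,2) ijk(4)] q(4)[OF ijk'(2,3) ijk(5)])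
      also have "\<dots> = q i k \<bullet> c i" by (simp only: q(4)[OF ijk'(1,3) ijk(6)])
      finally show "(q j k \<bullet> q i j) \<bullet> c i = q i k \<bullet> c i" .
    qed (use q ijk c in auto)
    show "is_cocone C ?J leq (\<lambda>i. Cod C (c i)) q Z (\<lambda>i. Zero C (Cod C (c i)) Z)"
      by (rule coconeI) (use Z' c q in auto)
    fix T t assume "is_cocone C ?J leq (\<lambda>i. Cod C (c i)) q T t"
    note t = coconeD[OF this]
    have tc: "t i \<bullet> c i = t j \<bullet> c j" if "i \<in> ?J" "j \<in> ?J" for i j
    proof (rule directed_constant[OF dirJ _ that])
      fix i j assume ij: "i \<in> ?J" "j \<in> ?J" "leq i j"
      then have ij': "i \<in> I" "j \<in> I" by auto
      have "t i \<bullet> c i = (t j \<bullet> q i j) \<bullet> c i" by (simp only: t(5)[OF ij])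
      also have "\<dots> = t j \<bullet> (q i j \<bullet> c i)"
        by (rule Comp_assoc_right) (use t(2-4) ij c q in auto)
      also have "\<dots> = t j \<bullet> c j" by (simp only: q(4)[OF ij' ij(3)])
      finally show "t i \<bullet> c i = t j \<bullet> c j" .
    qed
    have t_null: "null (t i)" if i: "i \<in> ?J" for i
    proof -
      have "null (t i \<bullet> c i)"
      proof (rule epi)
        fix k assume k: "k \<in> I"
        obtain k' where k': "k' \<in> I" "leq i0 k'" "leq k k'" using directed_onD(4)[OF dir i0 k] by blast
        have "(t i \<bullet> c i) \<bullet> a k = (t k' \<bullet> c k') \<bullet> a k" using tc[OF i, of k'] k' by simp
        also have "\<dots> = t k' \<bullet> (c k' \<bullet> a k)"
          by (rule Comp_assoc_right) (use t(2-4) k k' c a in auto)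
        finally have eq: "(t i \<bullet> c i) \<bullet> a k = t k' \<bullet> (c k' \<bullet> a k)" .
        have "null (c k' \<bullet> a k)" using le[OF k k'(1,3)] by (simp only: c_def)
        then show "null ((t i \<bullet> c i) \<bullet> a k)"
          unfolding eq by (rule null_Comp_left) (use t(2-4) k k' c a in auto)
      qed (use i t(2-4) c in auto)
      then show ?thesis by (subst (asm) epi_null_iff[OF c(3)[of i]]) (use i t(2-4) c in auto)
    qed
    show "\<exists>!h. h \<in> Hom C Z T \<and> (\<forall>i\<in>?J. h \<bullet> Zero C (Cod C (c i)) Z = t i)"
    proof (rule ex1I[of _ "Zero C Z T"])
      have "Zero C Z T \<bullet> Zero C (Cod C (c i)) Z = t i" if i: "i \<in> ?J" for i
        by (rule null_unique[OF _ t_null[OF i]]) (use i t(1-4) c Z' in auto)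
      then show "Zero C Z T \<in> Hom C Z T \<and> (\<forall>i\<in>?J. Zero C Z T \<bullet> Zero C (Cod C (c i)) Z = t i)"
        using Zero_in_Hom[OF Z' t(1)] by blast
      fix h assume "h \<in> Hom C Z T \<and> (\<forall>i\<in>?J. h \<bullet> Zero C (Cod C (c i)) Z = t i)"
      then have "h \<in> Arr C" "Dom C h = Z" "Cod C h = T" by (auto simp: in_Hom)
      then show "h = Zero C Z T" using zero_object_null[OF Z, of h] by (simp add: null_def)
    qed
  qed (use c q in auto)
  \<comment> \<open>Each \<open>d i\<close> maps the image of \<open>c i0 \<bullet> f\<close> to a
    later quotient; it is monic since the kernels are stable.\<close>
  define d where "d i = q i0 i \<bullet> m" for i
  have "is_mono C (Zero C (Cod C (c i0)) Z \<bullet> d i0)"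
  proof (rule mono_into_colimit[OF _ lim, where d = d and D = "Dom C m"])
    show "small U ?J" using small by (rule small_subset) auto
    show "is_mono C (d i) \<and> Dom C (d i) = Dom C m \<and> Cod C (d i) = Cod C (c i)" if "i \<in> ?J" for i
    proof -
      from that have i: "i \<in> I" "leq i0 i" by auto
      note [simp] = i i0 c(1,2) q(1-3) me(4-6) me' f(1,2)
      have "is_mono C (d i)"
      proof (rule mono_of_same_kernel[OF me(2)])
        fix y assume y [simp]: "y \<in> Arr C" "Cod C y = Dom C e" and n: "null (d i \<bullet> (e \<bullet> y))"
        have "d i \<bullet> (e \<bullet> y) = q i0 i \<bullet> ((m \<bullet> e) \<bullet> y)" by (simp add: d_def)
        also have "\<dots> = q i0 i \<bullet> (c i0 \<bullet> f \<bullet> y)" by (simp only: me(3))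
        also have "\<dots> = (q i0 i \<bullet> c i0) \<bullet> f \<bullet> y" by simp
        also have "\<dots> = (c i \<bullet> f) \<bullet> y" by (simp only: q(4)[OF i0 i])
        finally have "null ((c i0 \<bullet> f) \<bullet> y)" using stable[OF i, of y] n by simp
        then have "null ((m \<bullet> e) \<bullet> y)" by (simp only: me(3))
        then show "null (e \<bullet> y)" using mono_null_iff[OF me(1), of "e \<bullet> y"] by simp
      qed (simp_all add: d_def)
      then show ?thesis by (simp add: d_def)
    qed
    fix i j assume "i \<in> ?J" "j \<in> ?J" and ij: "leq i j"
    then have i: "i \<in> I" "leq i0 i" and j: "j \<in> I" "leq i0 j" by auto
    have "q i j \<bullet> q i0 i = q i0 j" using colimitD(8)[OF lim, of i0 i j] i j ij i0J by simp
    then show "q i j \<bullet> d i = d j"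
      unfolding d_def using Comp_eq_CompI[of "q i j" "q i0 i" "q i0 j" m] i j ij i0 me me' q by simp
  qed (use i0J in auto)
  moreover have d0: "d i0 = m"
    using colimitD(4)[OF lim i0J] me me' by (simp add: d_def)
  ultimately have *: "is_mono C (Zero C (Cod C (c i0)) Z \<bullet> m)" by simp
  \<comment> \<open>The zero arrow out of \<open>Dom C m\<close> is monic, so this object is zero
    and \<open>e\<close>, which ends there, vanishes.\<close>
  have "null e"
  proof (subst mono_null_iff[OF *, symmetric])
    show "null (Zero C (Cod C (c i0)) Z \<bullet> m \<bullet> e)"
      using me me' Z' c[OF i0] f by simp
  qed (use me me' Z' c[OF i0] in auto)
  then have "null (m \<bullet> e)" by (rule null_Comp_left) (use me me' in auto)
  then have "null (coker (a i0) \<bullet> f)" unfolding me(3) c_def .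
  then show thesis by (rule that[OF i0])
qed

text \<open>The kernels of \<open>x k j \<bullet> d\<close> stabilize at some \<open>j0\<close>. The
  image of \<open>d\<close> in \<open>X j0\<close> then embeds in all later stages, hence in
  \<open>L\<close>. But \<open>d\<close> vanishes in \<open>L\<close>, so this image is
  zero.\<close>

lemma noetherian_killed_in_colimit:
  fixes I :: "'u set"
  assumes small: "small U I" and lim: "is_directed_colimit C I leq X x L l"
    and k: "k \<in> I" and d: "d \<in> Arr C" "Cod C d = X k" "noetherian C (Dom C d)" and "null (l k \<bullet> d)"
  obtains j where "j \<in> I" "leq k j" "null (x k j \<bullet> d)"
proof -
  note L = colimitD[OF lim]
  note dir = directed_onD[OF L(1)]
  let ?K = "{j\<in>I. leq k j}"
  have mono: "null ((x k j \<bullet> d) \<bullet> y)"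
    if "i \<in> ?K" "j \<in> ?K" and leq: "leq i j" and y: "y \<in> Arr C" "Cod C y = Dom C d"
      and n: "null ((x k i \<bullet> d) \<bullet> y)" for i j y
  proof -
    from that have i: "i \<in> I" "leq k i" and j: "j \<in> I" "leq k j" by auto
    note [simp] = i j k leq y d(1,2) L(5-7)
    have "(x k j \<bullet> d) \<bullet> y = (x i j \<bullet> x k i) \<bullet> d \<bullet> y" by (simp only: L(8)[OF i(2) leq k i(1) j(1)])
    also have "\<dots> = x i j \<bullet> ((x k i \<bullet> d) \<bullet> y)" by simp
    finally show ?thesis using null_Comp_left[OF n, of "x i j"] by simp
  qed
  obtain j0 where "j0 \<in> ?K" and
    stable: "\<And>j y. \<lbrakk>j \<in> ?K; leq j0 j; y \<in> Arr C; Cod C y = Dom C d; null ((x k j \<bullet> d) \<bullet> y)\<rbrakk> \<Longrightarrow>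
       null ((x k j0 \<bullet> d) \<bullet> y)"
    by (rule noetherian_kernels_stabilize[OF d(3), of ?K "\<lambda>j. x k j \<bullet> d" leq])
       (use dir(2)[OF k] k d L mono in auto)
  then have j0: "j0 \<in> I" "leq k j0" by auto
  let ?J = "{j\<in>I. leq j0 j}"
  have j0J: "j0 \<in> ?J" using j0 dir(2) by simp
  note limJ = directed_colimit_above[OF lim j0(1)]
  obtain m e where me: "is_mono C m" "is_epi C e" "m \<bullet> e = x k j0 \<bullet> d" "Dom C m = Cod C e"
    "Cod C m = X j0" "Dom C e = Dom C d"
    by (rule image_factorization[of "x k j0 \<bullet> d"]) (use k j0 L d in auto)
  have me': "m \<in> Arr C" "e \<in> Arr C" using me by auto
  define d' where "d' i = x j0 i \<bullet> m" for i
  have "is_mono C (l j0 \<bullet> d' j0)"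
  proof (rule mono_into_colimit[OF _ limJ, where d = d' and D = "Dom C m"])
    show "small U ?J" using small by (rule small_subset) auto
    show "is_mono C (d' i) \<and> Dom C (d' i) = Dom C m \<and> Cod C (d' i) = X i" if "i \<in> ?J" for i
    proof -
      from that have i: "i \<in> I" "leq j0 i" by auto
      have ki: "leq k i" using dir(3)[OF j0(2) i(2) k j0(1) i(1)] .
      note [simp] = i j0 k ki L(5-7) me(4-6) me' d(1,2)
      have "is_mono C (d' i)"
      proof (rule mono_of_same_kernel[OF me(2)])
        fix y assume y [simp]: "y \<in> Arr C" "Cod C y = Dom C e" and n: "null (d' i \<bullet> (e \<bullet> y))"
        have "d' i \<bullet> (e \<bullet> y) = x j0 i \<bullet> ((m \<bullet> e) \<bullet> y)" by (simp add: d'_def)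
        also have "\<dots> = x j0 i \<bullet> (x k j0 \<bullet> d \<bullet> y)" by (simp only: me(3))
        also have "\<dots> = (x j0 i \<bullet> x k j0) \<bullet> d \<bullet> y" by simp
        also have "\<dots> = (x k i \<bullet> d) \<bullet> y" by (simp only: L(8)[OF j0(2) i(2) k j0(1) i(1)])
        finally have "null ((x k j0 \<bullet> d) \<bullet> y)" using stable[of i y] n by simp
        then have "null ((m \<bullet> e) \<bullet> y)" by (simp only: me(3))
        then show "null (e \<bullet> y)" using mono_null_iff[OF me(1), of "e \<bullet> y"] by simp
      qed (simp_all add: d'_def)
      then show ?thesis by (simp add: d'_def)
    qed
    fix i j assume "i \<in> ?J" "j \<in> ?J" and ij: "leq i j"
    then have i: "i \<in> I" "leq j0 i" and j: "j \<in> I" "leq j0 j" by auto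
    have "x i j \<bullet> x j0 i = x j0 j" using L(8)[of j0 i j] i j ij j0 by simp
    then show "x i j \<bullet> d' i = d' j"
      unfolding d'_def using Comp_eq_CompI[of "x i j" "x j0 i" "x j0 j" m] i j ij j0 me me' L by simp
  qed (use j0J in auto)
  moreover have "d' j0 = m" using L(4)[OF j0(1)] me me' by (simp add: d'_def)
  ultimately have *: "is_mono C (l j0 \<bullet> m)" by simp
  have "null e"
  proof (subst mono_null_iff[OF *, symmetric])
    note [simp] = j0 k L(5-7,9-11) me(4-6) me' d(1,2)
    have "(l j0 \<bullet> m) \<bullet> e = l j0 \<bullet> (m \<bullet> e)" by simp
    also have "\<dots> = l j0 \<bullet> (x k j0 \<bullet> d)" by (simp only: me(3))
    also have "\<dots> = (l j0 \<bullet> x k j0) \<bullet> d" by simp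
    also have "\<dots> = l k \<bullet> d" by (simp only: L(12)[OF k j0])
    finally show "null ((l j0 \<bullet> m) \<bullet> e)" using assms(7) by simp
  qed (use me me' L j0 in auto)
  then have "null (m \<bullet> e)" by (rule null_Comp_left) (use me me' in auto)
  then show thesis using that[OF j0] me(3) by simp
qed

text \<open>The images of the \<open>l i\<close> form a directed family that covers
  \<open>L\<close>, so \<open>f\<close> lands in one of them. Lifting from the image to
  \<open>X i\<close> itself is possible only after passing to a cover \<open>p\<close> of the
  domain, obtained by pulling back the epi part of \<open>l i\<close>.\<close>

lemma noetherian_local_lift:
  fixes I :: "'u set"
  assumes small: "small U I" and lim: "is_directed_colimit C I leq X x L l"
    and f: "f \<in> Arr C" "Cod C f = L" "noetherian C (Dom C f)"
  obtains i p q where "i \<in> I" "is_epi C p" "Cod C p = Dom C f" "q \<in> Arr C" "Cod C q = X i"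
    "Dom C p = Dom C q" "f \<bullet> p = l i \<bullet> q"
proof -
  note L = colimitD[OF lim]
  have le: "null (coker (l j) \<bullet> l i)" if ij: "i \<in> I" "j \<in> I" "leq i j" for i j
  proof -
    have "null (coker (l j) \<bullet> l j \<bullet> x i j)"
      by (rule null_Comp_right[OF coker(3)]) (use ij L in auto)
    also have "coker (l j) \<bullet> l j \<bullet> x i j = coker (l j) \<bullet> (l j \<bullet> x i j)"
      by (rule Comp_assoc_right) (use ij L in auto)
    finally show ?thesis by (simp only: L(12)[OF ij])
  qed
  obtain i where i: "i \<in> I" "null (coker (l i) \<bullet> f)"
    by (rule noetherian_into_directed_union[OF small L(1) _ le _ f])
       (use L in \<open>auto intro: colimit_jointly_epi[OF lim]\<close>)
  obtain m e where me: "is_mono C m" "is_epi C e" "m \<bullet> e = l i" "Dom C m = Cod C e"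
    "Cod C m = L" "Dom C e = X i"
    by (rule image_factorization[of "l i"]) (use i L in auto)
  have "subobject_le C f m"
    by (rule image_le_mono[OF me(1,3)]) (use i f me in auto)
  then obtain f' where f': "f' \<in> Arr C" "Dom C f' = Dom C f" "Cod C f' = Dom C m" "m \<bullet> f' = f"
    by (rule subobject_leE)
  obtain p q where pq: "is_epi C p" "q \<in> Arr C" "Dom C p = Dom C q" "Cod C p = Dom C f'"
    "Cod C q = Dom C e" "f' \<bullet> p = e \<bullet> q"
    by (rule epi_pullback[OF me(2), of f']) (use f' me in auto)
  have "f \<bullet> p = m \<bullet> (f' \<bullet> p)"
    by (rule Comp_eq_CompI[OF f'(4), symmetric]) (use me f' pq in auto)
  also have "\<dots> = m \<bullet> (e \<bullet> q)" by (simp only: pq(6))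
  also have "\<dots> = l i \<bullet> q"
    by (rule Comp_eq_CompI[OF me(3)]) (use me f' pq in auto)
  finally show thesis using that[OF i(1) pq(1)] pq f' me by simp
qed

text \<open>
  The subobjects \<open>b : B \<rightarrow> A\<close> on which \<open>f\<close> lifts to some \<open>X j\<close> have a maximal element. If it is proper, then
  \<open>f\<close> also lifts on some \<open>g : G \<rightarrow> A\<close> outside it, with \<open>G\<close> a generator. The kernel of \<open>B \<oplus> G \<rightarrow> A\<close> embeds in \<open>G\<close>,
  so it is noetherian and killed at a later stage, and \<open>f\<close> lifts on the sum of both subobjects.
\<close>

lemma noetherian_lifts:
  fixes I :: "'u set"
  assumes gen: "generating_set U C \<G>" "\<And>G. G \<in> \<G> \<Longrightarrow> noetherian C G"
    and small: "small U I" and lim: "is_directed_colimit C I leq X x L l"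
    and f: "f \<in> Arr C" "Cod C f = L" "noetherian C (Dom C f)"
  obtains i g where "i \<in> I" "g \<in> Arr C" "Dom C g = Dom C f" "Cod C g = X i" "l i \<bullet> g = f"
proof -
  note L = colimitD[OF lim]
  note dir = directed_onD[OF L(1)]
  let ?A = "Dom C f"
  obtain i p q where pq: "i \<in> I" "is_epi C p" "Cod C p = Dom C f" "q \<in> Arr C" "Cod C q = X i"
    "Dom C p = Dom C q" "f \<bullet> p = l i \<bullet> q"
    by (rule noetherian_local_lift[OF small lim f])
  define S where "S = {b. is_mono C b \<and> Cod C b = ?A \<and>
    (\<exists>j\<in>I. \<exists>\<beta>. \<beta> \<in> Arr C \<and> Dom C \<beta> = Dom C b \<and> Cod C \<beta> = X j \<and> l j \<bullet> \<beta> = f \<bullet> b)}"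
  have "ker (Ident C ?A) \<in> S"
  proof -
    let ?b = "ker (Ident C ?A)"
    have b: "?b \<in> Arr C" "Cod C ?b = ?A" "is_mono C ?b" using f by simp_all
    have "null (f \<bullet> ?b)" by (rule null_Comp_left[OF null_ker_Ident]) (use f b in auto)
    then have "l i \<bullet> Zero C (Dom C ?b) (X i) = f \<bullet> ?b"
      using L pq(1) b f by (simp add: null_def)
    then show ?thesis unfolding S_def using b L pq(1)
      by (intro CollectI conjI bexI[of _ i] exI[of _ "Zero C (Dom C ?b) (X i)"]) auto
  qed
  then obtain b where b: "b \<in> S" and max: "\<And>m. \<lbrakk>m \<in> S; subobject_le C b m\<rbrakk> \<Longrightarrow> subobject_le C m b"
    using noetherian_maximal[OF f(3), of _ S] unfolding S_def by (smt (verit) mem_Collect_eq)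
  then obtain j \<beta> where b': "is_mono C b" "Cod C b = ?A" and j: "j \<in> I" and \<beta>: "\<beta> \<in> Arr C"
    "Dom C \<beta> = Dom C b" "Cod C \<beta> = X j" "l j \<bullet> \<beta> = f \<bullet> b"
    unfolding S_def by blast
  have "is_epi C b"
  proof (rule ccontr)
    assume "\<not> is_epi C b"
    then have "\<not> null (coker b)" using epi_iff_coker b' by simp
    \<comment> \<open>Testing \<open>coker b \<bullet> p\<close> instead of \<open>coker b\<close>
      yields an arrow \<open>p \<bullet> h\<close> that lies outside \<open>b\<close> and on which
      \<open>f\<close> lifts at once, through \<open>q \<bullet> h\<close>.\<close>
    then have "\<not> null (coker b \<bullet> p)" by (subst epi_null_iff[OF pq(2)]) (use b' pq in auto)
    then obtain h where h: "Dom C h \<in> \<G>" "h \<in> Arr C" "Cod C h = Dom C p" "\<not> null ((coker b \<bullet> p) \<bullet> h)"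
      by (rule generating_set_detects[OF gen(1), rotated]) (use b' pq in auto)
    obtain k where k: "k \<in> I" "leq i k" "leq j k" using dir(4)[OF pq(1) j] by blast
    let ?G = "Dom C h"
    define g where "g = p \<bullet> h"
    define \<beta>' where "\<beta>' = x j k \<bullet> \<beta>"
    define \<gamma> where "\<gamma> = x i k \<bullet> (q \<bullet> h)"
    have g: "g \<in> Arr C" "Dom C g = ?G" "Cod C g = ?A" using h pq by (auto simp: g_def)
    have \<beta>': "\<beta>' \<in> Arr C" "Dom C \<beta>' = Dom C b" "Cod C \<beta>' = X k"
      using \<beta> L k j by (auto simp: \<beta>'_def)
    have \<gamma>: "\<gamma> \<in> Arr C" "Dom C \<gamma> = ?G" "Cod C \<gamma> = X k"
      using h pq L k by (auto simp: \<gamma>_def)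
    have l\<beta>: "l k \<bullet> \<beta>' = f \<bullet> b"
      unfolding \<beta>'_def using Comp_eq_CompI[OF L(12)[OF j k(1,3)], of \<beta>] L j k \<beta> by simp
    have l\<gamma>: "l k \<bullet> \<gamma> = f \<bullet> g"
    proof -
      have "l k \<bullet> \<gamma> = l i \<bullet> (q \<bullet> h)"
        unfolding \<gamma>_def by (rule Comp_eq_CompI[OF L(12)[OF pq(1) k(1,2)]]) (use L pq h k in auto)
      also have "\<dots> = f \<bullet> (p \<bullet> h)"
        by (rule Comp_eq_Comp[OF pq(7)[symmetric]]) (use L pq h k f in auto)
      finally show ?thesis by (simp add: g_def)
    qed
    obtain i1 j1 p1 q1 where S: "i1 \<in> Arr C" "Dom C i1 = Dom C b" "j1 \<in> Arr C" "Dom C j1 = ?G"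
      "Cod C j1 = Cod C i1" "p1 \<in> Arr C" "Dom C p1 = Cod C i1" "Cod C p1 = Dom C b"
      "q1 \<in> Arr C" "Dom C q1 = Cod C i1" "Cod C q1 = ?G"
      "p1 \<bullet> i1 = Ident C (Dom C b)" "null (q1 \<bullet> i1)" and
      jm: "\<And>x. \<lbrakk>x \<in> Arr C; Cod C x = Cod C i1; null (p1 \<bullet> x); null (q1 \<bullet> x)\<rbrakk> \<Longrightarrow> null x" and
      je: "\<And>x y. \<lbrakk>x \<in> Arr C; y \<in> Arr C; Dom C x = Cod C i1; Dom C y = Cod C i1; Cod C x = Cod C y;
        x \<bullet> i1 = y \<bullet> i1; x \<bullet> j1 = y \<bullet> j1\<rbrakk> \<Longrightarrow> x = y" and
      cop: "\<And>u v. \<lbrakk>u \<in> Arr C; v \<in> Arr C; Dom C u = Dom C b; Dom C v = ?G; Cod C u = Cod C v\<rbrakk> \<Longrightarrow>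
       \<exists>w. w \<in> Arr C \<and> Dom C w = Cod C i1 \<and> Cod C w = Cod C u \<and> w \<bullet> i1 = u \<and> w \<bullet> j1 = v"
      by (rule biproduct_universal[of "Dom C b" ?G]) (use b' h in auto)
    obtain \<phi> where \<phi>: "\<phi> \<in> Arr C" "Dom C \<phi> = Cod C i1" "Cod C \<phi> = ?A" "\<phi> \<bullet> i1 = b" "\<phi> \<bullet> j1 = g"
      using cop[of b g] b' g by auto
    obtain \<psi> where \<psi>: "\<psi> \<in> Arr C" "Dom C \<psi> = Cod C i1" "Cod C \<psi> = X k" "\<psi> \<bullet> i1 = \<beta>'" "\<psi> \<bullet> j1 = \<gamma>"
      using cop[of \<beta>' \<gamma>] \<beta>' \<gamma> by auto
    have l\<psi>: "l k \<bullet> \<psi> = f \<bullet> \<phi>"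
    proof (rule je)
      note [simp] = L(9-11) k \<psi>(1-3) \<phi>(1-3) S(1-5) f
      have "(l k \<bullet> \<psi>) \<bullet> i1 = l k \<bullet> (\<psi> \<bullet> i1)" by simp
      also have "\<dots> = f \<bullet> (\<phi> \<bullet> i1)" by (simp only: \<psi> \<phi> l\<beta>)
      finally show "(l k \<bullet> \<psi>) \<bullet> i1 = (f \<bullet> \<phi>) \<bullet> i1" by simp
      have "(l k \<bullet> \<psi>) \<bullet> j1 = l k \<bullet> (\<psi> \<bullet> j1)" by simp
      also have "\<dots> = f \<bullet> (\<phi> \<bullet> j1)" by (simp only: \<psi> \<phi> l\<gamma>)
      finally show "(l k \<bullet> \<psi>) \<bullet> j1 = (f \<bullet> \<phi>) \<bullet> j1" by simp
    qed (use L k \<psi> \<phi> f in auto)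
    define \<kappa> where "\<kappa> = ker \<phi>"
    have \<kappa>: "\<kappa> \<in> Arr C" "Cod C \<kappa> = Cod C i1" "is_mono C \<kappa>" "null (\<phi> \<bullet> \<kappa>)"
      using \<phi> by (simp_all add: \<kappa>_def)
    \<comment> \<open>The kernel of \<open>\<phi>\<close> meets the summand \<open>Dom C b\<close>
      trivially, because \<open>\<phi>\<close> restricts there to the mono \<open>b\<close>: an
      arrow \<open>z\<close> into the kernel with \<open>q1 \<bullet> z\<close> zero equals
      \<open>i1 \<bullet> (p1 \<bullet> z)\<close>.\<close>
    have "is_mono C (q1 \<bullet> \<kappa>)"
    proof (rule monoI)
      fix y assume y: "y \<in> Arr C" "Cod C y = Dom C (q1 \<bullet> \<kappa>)" "null (q1 \<bullet> \<kappa> \<bullet> y)"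
      note [simp] = y(1) \<kappa>(1,2) S(1-11) \<phi>(1-3)
      have y2 [simp]: "Cod C y = Dom C \<kappa>" using y(2) by simp
      define z where "z = \<kappa> \<bullet> y"
      have z [simp]: "z \<in> Arr C" "Cod C z = Cod C i1" by (simp_all add: z_def)
      have qz: "null (q1 \<bullet> z)" using y(3) by (simp add: z_def)
      have "z = i1 \<bullet> (p1 \<bullet> z)"
      proof -
        let ?d = "diff z (i1 \<bullet> (p1 \<bullet> z))"
        have d: "?d \<in> Arr C" "Cod C ?d = Cod C i1" by (simp_all add: Arr_diff)
        have "null (p1 \<bullet> ?d)"
        proof (subst null_Comp_diff_iff)
          show "p1 \<bullet> z = p1 \<bullet> (i1 \<bullet> (p1 \<bullet> z))"
            using Comp_eq_CompI[OF S(12), of "p1 \<bullet> z"] by simp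
        qed simp_all
        moreover have "null (q1 \<bullet> ?d)"
        proof (subst null_Comp_diff_iff)
          have "null (q1 \<bullet> i1 \<bullet> (p1 \<bullet> z))" by (rule null_Comp_right[OF S(13)]) simp_all
          then have "null (q1 \<bullet> (i1 \<bullet> (p1 \<bullet> z)))" by simp
          from null_unique[OF qz this] show "q1 \<bullet> z = q1 \<bullet> (i1 \<bullet> (p1 \<bullet> z))" by simp
        qed simp_all
        ultimately have "null ?d" using jm d by blast
        then show ?thesis by (subst (asm) null_diff_iff) simp_all
      qed
      then have "\<phi> \<bullet> z = \<phi> \<bullet> (i1 \<bullet> (p1 \<bullet> z))" by simp
      also have "\<dots> = b \<bullet> (p1 \<bullet> z)" by (rule Comp_eq_CompI[OF \<phi>(4)]) simp_all
      finally have eq: "\<phi> \<bullet> z = b \<bullet> (p1 \<bullet> z)" .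
      have "null (\<phi> \<bullet> \<kappa> \<bullet> y)" by (rule null_Comp_right[OF \<kappa>(4)]) simp_all
      then have "null (\<phi> \<bullet> z)" by (simp add: z_def)
      then have "null (p1 \<bullet> z)" unfolding eq using mono_null_iff[OF b'(1), of "p1 \<bullet> z"] by simp
      then have "null z" using jm qz by simp
      then show "null y" unfolding z_def using mono_null_iff[OF \<kappa>(3), of y] by simp
    qed (use \<kappa> S in auto)
    then have "noetherian C (Dom C (q1 \<bullet> \<kappa>))"
      by (rule noetherian_Dom_mono) (use \<kappa> S gen(2) h in auto)
    then have \<kappa>_noeth: "noetherian C (Dom C \<kappa>)" using \<kappa> S by simp
    have "null (l k \<bullet> (\<psi> \<bullet> \<kappa>))"
    proof -
      have eq: "l k \<bullet> (\<psi> \<bullet> \<kappa>) = f \<bullet> (\<phi> \<bullet> \<kappa>)"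
        by (rule Comp_eq_Comp[OF l\<psi>]) (use L k \<psi> \<phi> f \<kappa> in auto)
      show ?thesis unfolding eq by (rule null_Comp_left[OF \<kappa>(4)]) (use \<phi> f \<kappa> in auto)
    qed
    then obtain k' where k': "k' \<in> I" "leq k k'" "null (x k k' \<bullet> (\<psi> \<bullet> \<kappa>))"
      by (rule noetherian_killed_in_colimit[OF small lim k(1), rotated 3]) (use \<psi> \<kappa> \<kappa>_noeth in auto)
    obtain m e where me: "is_mono C m" "is_epi C e" "m \<bullet> e = \<phi>" "Dom C m = Cod C e"
      "Cod C m = ?A" "Dom C e = Cod C i1"
      by (rule image_factorization[of \<phi>]) (use \<phi> in auto)
    note [simp] = k k' L(5-7,9-11) \<psi>(1-3) \<phi>(1-3) \<kappa>(1,2) me(4-6) mono_Arr[OF me(1)] epi_Arr[OF me(2)]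
      f(1,2) S(1-5)
    \<comment> \<open>Since \<open>m \<bullet> e = \<phi>\<close>, the kernel of \<open>e\<close>
      lies in \<open>\<kappa>\<close>, which \<open>\<psi>\<close> sends to zero at stage
      \<open>k'\<close>. Hence \<open>\<psi>\<close> descends from the biproduct to the image
      \<open>m\<close> of \<open>\<phi>\<close>.\<close>
    have "null (x k k' \<bullet> \<psi> \<bullet> ker e)"
    proof -
      have "null (m \<bullet> (e \<bullet> ker e))" by (rule null_Comp_left[OF ker(3)]) simp_all
      also have "m \<bullet> (e \<bullet> ker e) = \<phi> \<bullet> ker e" by (rule Comp_eq_CompI[OF me(3)]) simp_all
      finally have "subobject_le C (ker e) \<kappa>" unfolding \<kappa>_def by (subst le_ker_iff) simp_all
      then obtain y where y: "y \<in> Arr C" "Dom C y = Dom C (ker e)" "Cod C y = Dom C \<kappa>" "\<kappa> \<bullet> y = ker e"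
        by (rule subobject_leE)
      have "null ((x k k' \<bullet> (\<psi> \<bullet> \<kappa>)) \<bullet> y)" by (rule null_Comp_right[OF k'(3)]) (use y(1-3) in simp_all)
      also have "(x k k' \<bullet> (\<psi> \<bullet> \<kappa>)) \<bullet> y = x k k' \<bullet> \<psi> \<bullet> (\<kappa> \<bullet> y)" using y(1-3) by simp
      finally show ?thesis unfolding y(4) .
    qed
    then obtain \<omega> where \<omega>: "\<omega> \<in> Arr C" "Dom C \<omega> = Cod C e" "Cod C \<omega> = X k'" "\<omega> \<bullet> e = x k k' \<bullet> \<psi>"
      by (rule epi_factor[OF me(2)]) simp_all
    note [simp] = \<omega>(1-3)
    have "l k' \<bullet> \<omega> = f \<bullet> m"
    proof (rule epiD[OF me(2)])
      have "(l k' \<bullet> \<omega>) \<bullet> e = l k' \<bullet> (\<omega> \<bullet> e)" by simp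
      also have "\<dots> = l k' \<bullet> (x k k' \<bullet> \<psi>)" by (simp only: \<omega>(4))
      also have "\<dots> = l k \<bullet> \<psi>" by (rule Comp_eq_CompI[OF L(12)]) simp_all
      also have "\<dots> = f \<bullet> \<phi>" by (rule l\<psi>)
      also have "\<dots> = (f \<bullet> m) \<bullet> e" unfolding me(3)[symmetric] by simp
      finally show "(l k' \<bullet> \<omega>) \<bullet> e = (f \<bullet> m) \<bullet> e" .
    qed simp_all
    then have mS: "m \<in> S" unfolding S_def
      by (intro CollectI conjI bexI[of _ k'] exI[of _ \<omega>]) (use me in simp_all)
    \<comment> \<open>The image \<open>m\<close> contains both \<open>b\<close> and
      \<open>g\<close>; maximality of \<open>b\<close> then puts \<open>g\<close> inside
      \<open>b\<close>, against the choice of \<open>h\<close>.\<close>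
    have b_eq: "m \<bullet> (e \<bullet> i1) = b"
      using Comp_eq_CompI[OF me(3), of i1] \<phi>(4) by simp
    have "subobject_le C b m" by (rule subobject_leI[OF b_eq]) simp_all
    then have mb: "subobject_le C m b" by (rule max[OF mS])
    have "m \<bullet> (e \<bullet> j1) = g"
      using Comp_eq_CompI[OF me(3), of j1] \<phi>(5) by simp
    then have "subobject_le C g m" by (rule subobject_leI) simp_all
    then have "subobject_le C g b" by (rule subobject_le_trans[OF _ mb]) (use b' in simp_all)
    then have "null (coker b \<bullet> g)" by (subst (asm) mono_le_iff[OF b'(1)]) (use g b' in auto)
    then show False using h(4) unfolding g_def using h b' pq by simp
  qed
  then obtain b'' where b'': "b'' \<in> Arr C" "Dom C b'' = Cod C b" "Cod C b'' = Dom C b"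
    "b \<bullet> b'' = Ident C (Cod C b)" by (rule mono_epi_iso[OF b'(1)])
  have "l j \<bullet> (\<beta> \<bullet> b'') = f \<bullet> (b \<bullet> b'')"
    by (rule Comp_eq_Comp[OF \<beta>(4)]) (use L j \<beta> b'' b' f in auto)
  also have "\<dots> = f" unfolding b''(4) using b' f by simp
  finally show thesis using that[of j "\<beta> \<bullet> b''"] j \<beta> b'' b' by simp
qed

text \<open>Surjectivity is the lifting just proved. For injectivity, two arrows that agree in
  \<open>L\<close> are moved to a common stage; their difference vanishes in \<open>L\<close>, hence
  at a later stage.\<close>

lemma noetherian_finitely_presented:
  assumes gen: "generating_set U C \<G>" "\<And>G. G \<in> \<G> \<Longrightarrow> noetherian C G"
    and A: "noetherian C A"
  shows "finitely_presented U C A"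
  unfolding finitely_presented_def
proof (intro conjI allI impI ballI)
  show "A \<in> Obj C" using A by (simp add: noetherian_def)
  fix I :: "'u set" and leq X x L l
  assume "small U I \<and> is_directed_colimit C I leq X x L l"
  then have small: "small U I" and lim: "is_directed_colimit C I leq X x L l" by auto
  note L = colimitD[OF lim]
  note dir = directed_onD[OF L(1)]
  show "\<exists>i\<in>I. \<exists>g\<in>Hom C A (X i). l i \<bullet> g = f" if f: "f \<in> Hom C A L" for f
  proof -
    have f': "f \<in> Arr C" "Cod C f = L" "noetherian C (Dom C f)" "Dom C f = A"
      using f A by (auto simp: in_Hom)
    obtain i g where g: "i \<in> I" "g \<in> Arr C" "Dom C g = Dom C f" "Cod C g = X i" "l i \<bullet> g = f"
      by (rule noetherian_lifts[OF gen small lim f'(1-3)])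
    then have "g \<in> Hom C A (X i)" using f'(4) by (simp add: in_Hom)
    then show ?thesis using g(1,5) by blast
  qed
  fix i j g h assume ij: "i \<in> I" "j \<in> I" and g: "g \<in> Hom C A (X i)" and h: "h \<in> Hom C A (X j)"
    and eq: "l i \<bullet> g = l j \<bullet> h"
  have gh: "g \<in> Arr C" "Dom C g = A" "Cod C g = X i" "h \<in> Arr C" "Dom C h = A" "Cod C h = X j"
    using g h by (auto simp: in_Hom)
  obtain k where k: "k \<in> I" "leq i k" "leq j k" using dir(4)[OF ij] by blast
  note [simp] = ij k gh L(5-7,9-11)
  let ?d = "diff (x i k \<bullet> g) (x j k \<bullet> h)"
  have d: "?d \<in> Arr C" "Dom C ?d = A" "Cod C ?d = X k" by (simp_all add: Arr_diff)
  have "null (l k \<bullet> ?d)"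
  proof (subst null_Comp_diff_iff)
    have "l k \<bullet> (x i k \<bullet> g) = l i \<bullet> g" by (rule Comp_eq_CompI[OF L(12)]) simp_all
    moreover have "l k \<bullet> (x j k \<bullet> h) = l j \<bullet> h" by (rule Comp_eq_CompI[OF L(12)]) simp_all
    ultimately show "l k \<bullet> (x i k \<bullet> g) = l k \<bullet> (x j k \<bullet> h)" using eq by simp
  qed simp_all
  then obtain k' where k': "k' \<in> I" "leq k k'" "null (x k k' \<bullet> ?d)"
    by (rule noetherian_killed_in_colimit[OF small lim k(1), rotated 3]) (use d A in auto)
  note [simp] = k'(1,2)
  have le: "leq i k'" "leq j k'" using dir(3)[of i k k'] dir(3)[of j k k'] by simp_all
  have "x k k' \<bullet> (x i k \<bullet> g) = x k k' \<bullet> (x j k \<bullet> h)"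
    using k'(3) by (subst (asm) null_Comp_diff_iff) simp_all
  moreover have "x k k' \<bullet> (x i k \<bullet> g) = x i k' \<bullet> g" by (rule Comp_eq_CompI[OF L(8)]) simp_all
  moreover have "x k k' \<bullet> (x j k \<bullet> h) = x j k' \<bullet> h" by (rule Comp_eq_CompI[OF L(8)]) simp_all
  ultimately have "x i k' \<bullet> g = x j k' \<bullet> h" by simp
  then show "\<exists>k\<in>I. leq i k \<and> leq j k \<and> x i k \<bullet> g = x j k \<bullet> h"
    using le k' by blast
qed

end

section \<open>Indecomposable injective objects are uniform\<close>

text \<open>The universe axioms speak of subsets of \<open>U\<close>, so \<open>X\<close> is first
  moved into \<open>U\<close> along an injection.\<close>

lemma small_Pow:
  assumes "universe U" "small U X"
  shows "small U (Pow X)"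
proof -
  obtain f where f: "inj_on f X" "f ` X \<subseteq> U"
    using assms(2) unfolding small_def lesspoll_def lepoll_def by blast
  have "small U (f ` X)" by (rule small_lepoll[OF assms(2) image_lepoll])
  then have "small U (Pow (f ` X))" using assms(1) f(2) unfolding universe_def by blast
  moreover have "Pow X \<lesssim> Pow (f ` X)"
    unfolding lepoll_def by (rule exI[of _ "image f"]) (use inj_on_image_Pow[OF f(1)] in auto)
  ultimately show ?thesis by (rule small_lepoll)
qed

section \<open>Coproducts and trivially intersecting subobjects\<close>

context category
begin

lemma coproductD:
  assumes "is_coproduct C I X S s"
  shows "S \<in> Obj C" "i \<in> I \<Longrightarrow> s i \<in> Arr C" "i \<in> I \<Longrightarrow> Dom C (s i) = X i"
    "i \<in> I \<Longrightarrow> Cod C (s i) = S"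
    "\<lbrakk>T \<in> Obj C; \<And>i. i \<in> I \<Longrightarrow> t i \<in> Arr C \<and> Dom C (t i) = X i \<and> Cod C (t i) = T\<rbrakk> \<Longrightarrow>
      \<exists>h. h \<in> Arr C \<and> Dom C h = S \<and> Cod C h = T \<and> (\<forall>i\<in>I. h \<bullet> s i = t i)"
    "\<lbrakk>h \<in> Arr C; h' \<in> Arr C; Dom C h = S; Dom C h' = S; Cod C h = Cod C h';
      \<And>i. i \<in> I \<Longrightarrow> h \<bullet> s i = h' \<bullet> s i\<rbrakk> \<Longrightarrow> h = h'"
proof -
  have s: "\<forall>i\<in>I. s i \<in> Hom C (X i) S" and "S \<in> Obj C" and
    ex: "\<And>T t. \<lbrakk>T \<in> Obj C; \<forall>i\<in>I. t i \<in> Hom C (X i) T\<rbrakk> \<Longrightarrow>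
        (\<exists>!h. h \<in> Hom C S T \<and> (\<forall>i\<in>I. h \<bullet> s i = t i))"
    using assms unfolding is_coproduct_def by blast+
  then show "S \<in> Obj C" "i \<in> I \<Longrightarrow> s i \<in> Arr C" "i \<in> I \<Longrightarrow> Dom C (s i) = X i"
    "i \<in> I \<Longrightarrow> Cod C (s i) = S" by (auto simp: in_Hom)
  show "\<lbrakk>T \<in> Obj C; \<And>i. i \<in> I \<Longrightarrow> t i \<in> Arr C \<and> Dom C (t i) = X i \<and> Cod C (t i) = T\<rbrakk> \<Longrightarrow>
      \<exists>h. h \<in> Arr C \<and> Dom C h = S \<and> Cod C h = T \<and> (\<forall>i\<in>I. h \<bullet> s i = t i)"
    using ex[of T t] unfolding in_Hom by blast
  assume h: "h \<in> Arr C" "h' \<in> Arr C" "Dom C h = S" "Dom C h' = S" "Cod C h = Cod C h'"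
      "\<And>i. i \<in> I \<Longrightarrow> h \<bullet> s i = h' \<bullet> s i"
  have "\<forall>i\<in>I. h' \<bullet> s i \<in> Hom C (X i) (Cod C h')" using h s by (simp add: in_Hom)
  from ex[OF _ this] h show "h = h'" by (metis (no_types, lifting) Cod_in_Obj in_Hom)
qed

end

context preadditive_category
begin

text \<open>Trivial intersection, tested on commuting squares instead of on a chosen
  pullback.\<close>

definition meet_zero :: "'m \<Rightarrow> 'm \<Rightarrow> bool" where
  "meet_zero l k \<longleftrightarrow> (\<forall>x y. x \<in> Arr C \<and> y \<in> Arr C \<and> Cod C x = Dom C l \<and> Cod C y = Dom C k \<and>
     Dom C x = Dom C y \<and> l \<bullet> x = k \<bullet> y \<longrightarrow> null (l \<bullet> x))"

lemma meet_zeroD: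
  "\<lbrakk>meet_zero l k; l \<bullet> x = k \<bullet> y; x \<in> Arr C; y \<in> Arr C; Cod C x = Dom C l; Cod C y = Dom C k;
    Dom C x = Dom C y\<rbrakk> \<Longrightarrow> null (l \<bullet> x)"
  unfolding meet_zero_def by blast

lemma meet_zero_commute: "meet_zero l k \<longleftrightarrow> meet_zero k l"
  unfolding meet_zero_def by metis

lemma meet_zero_le:
  assumes "meet_zero l k" "subobject_le C k' k" "l \<in> Arr C" "k \<in> Arr C" "k' \<in> Arr C"
  shows "meet_zero l k'"
  unfolding meet_zero_def
proof (intro allI impI, elim conjE)
  fix x y assume x: "x \<in> Arr C" "y \<in> Arr C" "Cod C x = Dom C l" "Cod C y = Dom C k'" "Dom C x = Dom C y"
    "l \<bullet> x = k' \<bullet> y"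
  obtain z where z: "z \<in> Arr C" "Dom C z = Dom C k'" "Cod C z = Dom C k" "k \<bullet> z = k'"
    using assms(2) by (rule subobject_leE)
  show "null (l \<bullet> x)"
  proof (rule meet_zeroD[OF assms(1)])
    have "k \<bullet> (z \<bullet> y) = k' \<bullet> y" by (rule Comp_eq_CompI[OF z(4)]) (use assms z x in auto)
    then show "l \<bullet> x = k \<bullet> (z \<bullet> y)" using x by simp
  qed (use assms z x in auto)
qed

lemma le_null:
  assumes "subobject_le C x m" "null m" "m \<in> Arr C"
  shows "null x"
proof -
  obtain y where "y \<in> Arr C" "Dom C y = Dom C x" "Cod C y = Dom C m" "m \<bullet> y = x"
    using assms(1) by (rule subobject_leE)
  then show ?thesis using null_Comp_right[OF assms(2), of y] assms(3) by simp
qed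

end

context grothendieck_category
begin

text \<open>
  A subobject of \<open>E\<close> is encoded by the set \<open>H l\<close> of maps \<open>G \<rightarrow> E\<close> factoring through it, which makes chains of
  subobjects small. That disjointness from \<open>k\<close> passes to the sum of a chain is tested on noetherian generators.
\<close>

lemma maximal_complement:
  assumes gen: "generating_set U C \<G>" "\<And>G. G \<in> \<G> \<Longrightarrow> noetherian C G"
    and l0: "is_mono C l0" "Cod C l0 = E" and k: "is_mono C k" "Cod C k = E" and "meet_zero l0 k"
  obtains l where "is_mono C l" "Cod C l = E" "subobject_le C l0 l" "meet_zero l k"
    "\<And>l'. \<lbrakk>is_mono C l'; Cod C l' = E; subobject_le C l l'; meet_zero l' k\<rbrakk> \<Longrightarrow> subobject_le C l' l"
proof -
  obtain G where G: "generating_set U C {G}" using generator by blast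
  then have GO: "G \<in> Obj C" by (simp add: generating_set_def)
  have E: "E \<in> Obj C" using l0 by auto
  define H where "H l = {h. h \<in> Hom C G E \<and> subobject_le C h l}" for l
  have H_le: "H l \<subseteq> H l' \<longleftrightarrow> subobject_le C l l'"
    if l: "is_mono C l" "Cod C l = E" and l': "is_mono C l'" "Cod C l' = E" for l l'
  proof
    assume "subobject_le C l l'"
    then show "H l \<subseteq> H l'" unfolding H_def using subobject_le_trans l l' by auto
  next
    assume *: "H l \<subseteq> H l'"
    show "subobject_le C l l'"
    proof (rule ccontr)
      assume "\<not> subobject_le C l l'"
      \<comment> \<open>An arrow \<open>h\<close> from the generator \<open>G\<close> detects this,
        and then \<open>l \<bullet> h\<close> belongs to \<open>H l\<close> but not to
        \<open>H l'\<close>.\<close>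
      then have "\<not> null (coker l' \<bullet> l)" using mono_le_iff[OF l'(1)] l l' by simp
      then obtain h where h: "Dom C h \<in> {G}" "h \<in> Arr C" "Cod C h = Dom C (coker l' \<bullet> l)"
        "\<not> null ((coker l' \<bullet> l) \<bullet> h)"
        by (rule generating_set_detects[OF G, rotated]) (use l l' in auto)
      have lh: "l \<bullet> h \<in> Arr C" "Dom C (l \<bullet> h) = G" "Cod C (l \<bullet> h) = E" using h l l' by auto
      have "subobject_le C (l \<bullet> h) l" by (rule subobject_leI[OF refl]) (use h l l' in auto)
      then have "l \<bullet> h \<in> H l'" using * lh unfolding H_def in_Hom by blast
      then have "null (coker l' \<bullet> (l \<bullet> h))"
        using mono_le_iff[OF l'(1) lh(1)] lh l' unfolding H_def by simp
      then show False using h l l' by simp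
    qed
  qed
  define F where "F = {l. is_mono C l \<and> Cod C l = E \<and> subobject_le C l0 l \<and> meet_zero l k}"
  have l0F: "l0 \<in> F" using l0 assms(7) subobject_le_refl by (simp add: F_def)
  \<comment> \<open>Zorn is applied to the sets \<open>H l\<close>: their inclusion is a partial
    order, while \<open>subobject_le\<close> is only a preorder on arrows.\<close>
  have "\<exists>M\<in>H ` F. \<forall>X\<in>H ` F. M \<subseteq> X \<longrightarrow> X = M"
  proof (rule subset_Zorn)
    fix \<C> assume "subset.chain (H ` F) \<C>"
    then have sub: "\<C> \<subseteq> H ` F" and chain: "\<And>A B. \<lbrakk>A \<in> \<C>; B \<in> \<C>\<rbrakk> \<Longrightarrow> A \<subseteq> B \<or> B \<subseteq> A"
      unfolding subset.chain_def by blast+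
    show "\<exists>M\<in>H ` F. \<forall>X\<in>\<C>. X \<subseteq> M"
    proof (cases "\<C> = {}")
      case True then show ?thesis using l0F by blast
    next
      case False
      have "\<C> \<subseteq> Pow (Hom C G E)" using sub by (auto simp: H_def)
      then have small\<C>: "small U \<C>"
        using small_Pow[OF universe locally_small[OF GO E]] small_subset by blast
      \<comment> \<open>The coproduct axiom and the union lemma take index sets of type
        \<open>'u set\<close>, so the chain is relabelled by elements of \<open>U\<close>.\<close>
      then obtain \<iota> where \<iota>: "inj_on \<iota> \<C>" "\<iota> ` \<C> \<subseteq> U"
        unfolding small_def lesspoll_def lepoll_def by blast
      define I where "I = \<iota> ` \<C>"
      have small: "small U I" unfolding I_def by (rule small_lepoll[OF small\<C> image_lepoll])
      have "\<exists>l. l \<in> F \<and> H l = inv_into \<C> \<iota> i" if "i \<in> I" for i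
        using inv_into_into[of i \<iota> \<C>] that sub unfolding I_def by blast
      then obtain a where a: "\<And>i. i \<in> I \<Longrightarrow> a i \<in> F" "\<And>i. i \<in> I \<Longrightarrow> H (a i) = inv_into \<C> \<iota> i"
        by metis
      have aI: "H (a i) \<in> \<C>" if "i \<in> I" for i
        using a(2)[OF that] inv_into_into[of i \<iota> \<C>] that unfolding I_def by simp
      have a': "is_mono C (a i)" "Cod C (a i) = E" "subobject_le C l0 (a i)" "meet_zero (a i) k" "a i \<in> Arr C"
        if "i \<in> I" for i using a(1)[OF that] by (auto simp: F_def)
      define leq where "leq i j \<longleftrightarrow> H (a i) \<subseteq> H (a j)" for i j
      have dir: "directed_on I leq"
        unfolding directed_on_def
      proof (intro conjI ballI)
        show "I \<noteq> {}" using False by (simp add: I_def)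
        fix i j assume "i \<in> I" "j \<in> I"
        then show "\<exists>k\<in>I. leq i k \<and> leq j k"
          using chain[OF aI aI, of i j] unfolding leq_def by blast
      qed (auto simp: leq_def)
      \<comment> \<open>The sum of the chain is realized as the image \<open>m\<close> of the arrow
        from the coproduct of its members to \<open>E\<close>.\<close>
      obtain S s where "is_coproduct C I (\<lambda>i. Dom C (a i)) S s"
        using coproducts[OF small, of "\<lambda>i. Dom C (a i)"] a' by auto
      note S = coproductD[OF this]
      have "\<exists>u. u \<in> Arr C \<and> Dom C u = S \<and> Cod C u = E \<and> (\<forall>i\<in>I. u \<bullet> s i = a i)"
        by (rule S(5)[OF E]) (use a' in auto)
      then obtain u where u: "u \<in> Arr C" "Dom C u = S" "Cod C u = E" "\<And>i. i \<in> I \<Longrightarrow> u \<bullet> s i = a i"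
        by blast
      obtain m e where me: "is_mono C m" "is_epi C e" "m \<bullet> e = u" "Dom C m = Cod C e"
        "Cod C m = E" "Dom C e = S"
        by (rule image_factorization[of u]) (use u in auto)
      have me': "m \<in> Arr C" "e \<in> Arr C" using me by auto
      have mes: "m \<bullet> (e \<bullet> s i) = a i" if i: "i \<in> I" for i
        using Comp_eq_CompI[OF me(3), of "s i"] u(4)[OF i] me me' S i by simp
      have a_le_m: "subobject_le C (a i) m" if i: "i \<in> I" for i
        by (rule subobject_leI[OF mes[OF i]]) (use me me' S i in auto)
      have es_mono: "is_mono C (e \<bullet> s i)" if i: "i \<in> I" for i
      proof (rule monoI)
        fix x assume x: "x \<in> Arr C" "Cod C x = Dom C (e \<bullet> s i)" "null (e \<bullet> s i \<bullet> x)"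
        have "null (m \<bullet> (e \<bullet> s i \<bullet> x))" by (rule null_Comp_left[OF x(3)]) (use x me me' S i in auto)
        also have "m \<bullet> (e \<bullet> s i \<bullet> x) = a i \<bullet> x"
          by (rule Comp_eq_CompI[OF mes[OF i]]) (use x me me' S i in auto)
        finally show "null x" by (subst (asm) mono_null_iff[OF a'(1)[OF i]]) (use x me me' S i in auto)
      qed (use me me' S i in auto)
      have "meet_zero m k"
        unfolding meet_zero_def
      proof (intro allI impI, elim conjE, rule ccontr)
        fix x y assume x: "x \<in> Arr C" "y \<in> Arr C" "Cod C x = Dom C m" "Cod C y = Dom C k" "Dom C x = Dom C y"
          and eq: "m \<bullet> x = k \<bullet> y" and nn: "\<not> null (m \<bullet> x)"
        obtain n where n: "Dom C n \<in> \<G>" "n \<in> Arr C" "Cod C n = Dom C (m \<bullet> x)" "\<not> null (m \<bullet> x \<bullet> n)"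
          by (rule generating_set_detects[OF gen(1) _ nn]) (use x me' in auto)
        have nx: "Cod C n = Dom C x" using n x me me' by simp
        \<comment> \<open>The members of the chain cover \<open>Cod C e\<close>, so
          \<open>x \<bullet> n\<close>, having a noetherian domain, already factors through one of
          them. Disjointness of that member from \<open>k\<close> contradicts the choice of
          \<open>n\<close>.\<close>
        obtain i where i: "i \<in> I" "null (coker (e \<bullet> s i) \<bullet> (x \<bullet> n))"
        proof (rule noetherian_into_directed_union[OF small dir, of "\<lambda>i. e \<bullet> s i" "Cod C e" "x \<bullet> n"])
          fix i j assume ij: "i \<in> I" "j \<in> I" "leq i j"
          then have "subobject_le C (a i) (a j)" using H_le[of "a i" "a j"] a' by (simp add: leq_def)
          then obtain t where t: "t \<in> Arr C" "Dom C t = Dom C (a i)" "Cod C t = Dom C (a j)" "a j \<bullet> t = a i"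
            by (rule subobject_leE)
          have "(e \<bullet> s j) \<bullet> t = e \<bullet> s i"
          proof (rule monoD[OF me(1)])
            have "m \<bullet> (e \<bullet> s j \<bullet> t) = a j \<bullet> t"
              by (rule Comp_eq_CompI[OF mes[OF ij(2)]]) (use ij t(1-3) me me' S in auto)
            also have "\<dots> = m \<bullet> (e \<bullet> s i)" unfolding t(4) mes[OF ij(1)] ..
            finally show "m \<bullet> (e \<bullet> s j \<bullet> t) = m \<bullet> (e \<bullet> s i)" .
          qed (use ij t(1-3) me me' S in auto)
          then have "subobject_le C (e \<bullet> s i) (e \<bullet> s j)"
            by (rule subobject_leI) (use ij t(1-3) me me' S in auto)
          then show "null (coker (e \<bullet> s j) \<bullet> (e \<bullet> s i))"
            by (subst (asm) mono_le_iff[OF es_mono[OF ij(2)]]) (use ij me me' S in auto)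
        next
          fix h assume h: "h \<in> Arr C" "Dom C h = Cod C e" "\<And>i. i \<in> I \<Longrightarrow> null (h \<bullet> (e \<bullet> s i))"
          have "h \<bullet> e = Zero C S (Cod C h)"
          proof (rule S(6))
            fix i assume i: "i \<in> I"
            show "h \<bullet> e \<bullet> s i = Zero C S (Cod C h) \<bullet> s i"
              by (rule null_unique) (use h(3)[OF i] i a'(5)[OF i] h(1,2) me'(2) me(6) S(1-4) Dom_in_Obj[OF a'(5)[OF i]] in simp_all)
          qed (use h me' me S in auto)
          then have "null (h \<bullet> e)" using h S by simp
          then show "null h" by (subst (asm) epi_null_iff[OF me(2)]) (use h in auto)
        qed (use me me' S x n nx gen(2) in auto)
        have "subobject_le C (x \<bullet> n) (e \<bullet> s i)"
          by (subst mono_le_iff[OF es_mono[OF i(1)]]) (use i me me' S x n nx in auto)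
        then obtain w where w: "w \<in> Arr C" "Dom C w = Dom C (x \<bullet> n)" "Cod C w = Dom C (e \<bullet> s i)"
          "(e \<bullet> s i) \<bullet> w = x \<bullet> n" by (rule subobject_leE)
        have w': "Dom C w = Dom C n" "Cod C w = Dom C (a i)" using w(2,3) i me me' S x n nx by simp_all
        have "a i \<bullet> w = m \<bullet> (e \<bullet> s i \<bullet> w)"
          by (rule Comp_eq_CompI[OF mes[OF i(1)], symmetric]) (use i me me' S w(1,3) in auto)
        also have "\<dots> = m \<bullet> (x \<bullet> n)" unfolding w(4) ..
        finally have aw: "a i \<bullet> w = m \<bullet> (x \<bullet> n)" .
        also have "\<dots> = k \<bullet> (y \<bullet> n)" by (rule Comp_eq_Comp[OF eq]) (use k x n nx me' in auto)
        finally have "null (a i \<bullet> w)"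
          by (rule meet_zeroD[OF a'(4)[OF i(1)]]) (use w(1) w' x n nx in auto)
        then show False unfolding aw using n(4) x nx n(2) me' by simp
      qed
      moreover have "subobject_le C l0 m"
      proof -
        obtain i where i: "i \<in> I" using directed_onD(1)[OF dir] by blast
        show ?thesis by (rule subobject_le_trans[OF a'(3)[OF i] a_le_m[OF i] a'(5)[OF i] me'(1)])
      qed
      ultimately have "m \<in> F" using me by (simp add: F_def)
      moreover have "X \<subseteq> H m" if "X \<in> \<C>" for X
      proof -
        have i: "\<iota> X \<in> I" using that by (simp add: I_def)
        have "H (a (\<iota> X)) = X" using a(2)[OF i] \<iota>(1) that by simp
        then show ?thesis using H_le[of "a (\<iota> X)" m] a'[OF i] a_le_m[OF i] me by simp
      qed
      ultimately show ?thesis by blast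
    qed
  qed
  then obtain M where M: "M \<in> H ` F" "\<forall>X\<in>H ` F. M \<subseteq> X \<longrightarrow> X = M" by (rule bexE)
  then obtain l where l: "l \<in> F" "M = H l" by (auto elim: imageE)
  have max: "H l' = H l" if "l' \<in> F" "H l \<subseteq> H l'" for l'
    using M(2) that l(2) by simp
  have l': "is_mono C l" "Cod C l = E" "subobject_le C l0 l" "meet_zero l k"
    using l(1) by (auto simp: F_def)
  show thesis
  proof (rule that[OF l'])
    fix l' assume a: "is_mono C l'" "Cod C l' = E" "subobject_le C l l'" "meet_zero l' k"
    have "subobject_le C l0 l'"
      by (rule subobject_le_trans[OF l'(3) a(3)]) (use l' a in auto)
    then have "l' \<in> F" using a by (simp add: F_def)
    moreover have "H l \<subseteq> H l'" using H_le l' a by blast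
    ultimately have "H l' \<subseteq> H l" using max by blast
    then show "subobject_le C l' l" using H_le l' a by blast
  qed
qed

text \<open>
  Enlarge \<open>l\<close> to \<open>l'\<close> maximal disjoint from \<open>k\<close>, then \<open>k\<close> to \<open>k'\<close> maximal disjoint from \<open>l'\<close>. As \<open>k'\<close> is essential in
  \<open>E / l'\<close>, the extension of \<open>k'\<close> to \<open>\<phi> : E / l' \<rightarrow> E\<close> is monic with image disjoint from \<open>l'\<close>, so this image is
  \<open>k'\<close> and \<open>E\<close> is the direct sum of \<open>k'\<close> and \<open>l'\<close>.
\<close>

lemma indecomposable_injective_uniform:
  assumes gen: "generating_set U C \<G>" "\<And>G. G \<in> \<G> \<Longrightarrow> noetherian C G"
    and E: "injective_object C E" "indecomposable C E"
    and l: "is_mono C l" "Cod C l = E" and k: "is_mono C k" "Cod C k = E" and "meet_zero l k"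
  shows "null l \<or> null k"
proof -
  obtain l' where l': "is_mono C l'" "Cod C l' = E" "subobject_le C l l'" "meet_zero l' k" and
    l_max: "\<And>m. \<lbrakk>is_mono C m; Cod C m = E; subobject_le C l' m; meet_zero m k\<rbrakk> \<Longrightarrow> subobject_le C m l'"
    by (rule maximal_complement[OF gen l k assms(9)]) blast+
  obtain k' where k': "is_mono C k'" "Cod C k' = E" "subobject_le C k k'" "meet_zero k' l'" and
    k_max: "\<And>m. \<lbrakk>is_mono C m; Cod C m = E; subobject_le C k' m; meet_zero m l'\<rbrakk> \<Longrightarrow> subobject_le C m k'"
    by (rule maximal_complement[OF gen k l'(1,2) l'(4)[unfolded meet_zero_commute[of l']]]) blast+
  have [simp]: "l' \<in> Arr C" "k' \<in> Arr C" "Cod C l' = E" "Cod C k' = E" using l' k' by auto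
  have EO: "E \<in> Obj C" using Cod_in_Obj[OF \<open>l' \<in> Arr C\<close>] by simp
  define \<pi> where "\<pi> = coker l'"
  have \<pi> [simp]: "\<pi> \<in> Arr C" "Dom C \<pi> = E" and \<pi>l: "null (\<pi> \<bullet> l')" "is_epi C \<pi>"
    by (simp_all add: \<pi>_def)
  \<comment> \<open>The preimage \<open>z'\<close> of \<open>z\<close> in \<open>E\<close> contains
    \<open>l'\<close>. Were it disjoint from \<open>k'\<close>, and so from the smaller
    \<open>k\<close>, maximality of \<open>l'\<close> would give \<open>z' \<le> l'\<close>. Then
    \<open>\<pi>\<close> kills \<open>z'\<close> and factors through
    \<open>coker z \<bullet> \<pi>\<close>, which gives \<open>coker z\<close> a left inverse and
    makes \<open>z\<close> zero.\<close>
  have essential: "\<exists>y w. y \<in> Arr C \<and> w \<in> Arr C \<and> Cod C y = Dom C k' \<and> Cod C w = Dom C z \<and>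
      Dom C y = Dom C w \<and> \<pi> \<bullet> (k' \<bullet> y) = z \<bullet> w \<and> \<not> null (k' \<bullet> y)"
    if z: "is_mono C z" "Cod C z = Cod C \<pi>" "\<not> null z" for z
  proof -
    have [simp]: "z \<in> Arr C" "Cod C z = Cod C \<pi>" using z by auto
    define z' where "z' = ker (coker z \<bullet> \<pi>)"
    have [simp]: "z' \<in> Arr C" "Cod C z' = E" and z'_mono: "is_mono C z'"
      by (simp_all add: z'_def)
    have z'_null: "null (coker z \<bullet> \<pi> \<bullet> z')"
      unfolding z'_def by (rule ker(3)) simp
    have epi: "is_epi C (coker z \<bullet> \<pi>)" by (rule epi_Comp) (use \<pi>l in auto)
    have "null (coker z \<bullet> (\<pi> \<bullet> l'))" by (rule null_Comp_left[OF \<pi>l(1)]) auto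
    then have lz: "subobject_le C l' z'" unfolding z'_def by (subst le_ker_iff) auto
    have "\<not> meet_zero z' k'"
    proof
      assume "meet_zero z' k'"
      then have "meet_zero z' k" by (rule meet_zero_le[OF _ k'(3)]) (use k in auto)
      then have "subobject_le C z' l'" using l_max[OF z'_mono _ lz] by simp
      then have "null (\<pi> \<bullet> z')" unfolding \<pi>_def by (subst (asm) mono_le_iff[OF l'(1)]) auto
      then obtain t where t: "t \<in> Arr C" "Dom C t = Cod C (coker z \<bullet> \<pi>)" "Cod C t = Cod C \<pi>"
        "t \<bullet> (coker z \<bullet> \<pi>) = \<pi>"
        unfolding z'_def by (rule epi_factor[OF epi]) auto
      have "t \<bullet> coker z = Ident C (Cod C \<pi>)"
        by (rule epiD[OF \<pi>l(2)]) (use t in auto)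
      then have "t \<bullet> (coker z \<bullet> z) = Ident C (Cod C \<pi>) \<bullet> z"
        by (rule Comp_eq_CompI) (use t(1-3) in auto)
      also have "\<dots> = z" by simp
      finally have "z = t \<bullet> (coker z \<bullet> z)" ..
      moreover have "null (t \<bullet> (coker z \<bullet> z))" by (rule null_Comp_left) (use t(1-3) in auto)
      ultimately show False using z(3) by simp
    qed
    then obtain x y where xy: "x \<in> Arr C" "y \<in> Arr C" "Cod C x = Dom C z'" "Cod C y = Dom C k'"
      "Dom C x = Dom C y" "z' \<bullet> x = k' \<bullet> y" "\<not> null (z' \<bullet> x)"
      unfolding meet_zero_def by blast
    have "null (coker z \<bullet> \<pi> \<bullet> z' \<bullet> x)" by (rule null_Comp_right[OF z'_null]) (use xy(1-5) in auto)
    also have "coker z \<bullet> \<pi> \<bullet> z' \<bullet> x = coker z \<bullet> (\<pi> \<bullet> (z' \<bullet> x))" using xy(1-5) by simp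
    finally have "null (coker z \<bullet> (\<pi> \<bullet> (k' \<bullet> y)))" unfolding xy(6) .
    then have "subobject_le C (\<pi> \<bullet> (k' \<bullet> y)) z"
      by (subst mono_le_iff[OF z(1)]) (use xy(1-5) in auto)
    then obtain w where w: "w \<in> Arr C" "Dom C w = Dom C (\<pi> \<bullet> (k' \<bullet> y))" "Cod C w = Dom C z"
      "z \<bullet> w = \<pi> \<bullet> (k' \<bullet> y)" by (rule subobject_leE)
    show ?thesis
      by (rule exI[of _ y], rule exI[of _ w]) (use w xy in simp)
  qed
  have "is_mono C (\<pi> \<bullet> k')"
  proof (rule monoI)
    fix y assume y: "y \<in> Arr C" "Cod C y = Dom C (\<pi> \<bullet> k')" "null (\<pi> \<bullet> k' \<bullet> y)"
    have [simp]: "y \<in> Arr C" "Cod C y = Dom C k'" using y by auto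
    have "subobject_le C (k' \<bullet> y) l'"
      by (subst mono_le_iff[OF l'(1)]) (use y(3) in \<open>simp_all add: \<pi>_def\<close>)
    then obtain x where x: "x \<in> Arr C" "Dom C x = Dom C (k' \<bullet> y)" "Cod C x = Dom C l'" "l' \<bullet> x = k' \<bullet> y"
      by (rule subobject_leE)
    have "null (k' \<bullet> y)"
      by (rule meet_zeroD[OF k'(4) x(4)[symmetric]]) (use x(1-3) in auto)
    then show "null y" by (subst (asm) mono_null_iff[OF k'(1)]) auto
  qed auto
  moreover have "k' \<in> Hom C (Dom C (\<pi> \<bullet> k')) E" by (simp add: in_Hom)
  ultimately obtain \<phi> where "\<phi> \<in> Hom C (Cod C (\<pi> \<bullet> k')) E" and \<phi>k: "\<phi> \<bullet> (\<pi> \<bullet> k') = k'"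
    using E(1) unfolding injective_object_def by blast
  then have \<phi> [simp]: "\<phi> \<in> Arr C" "Dom C \<phi> = Cod C \<pi>" "Cod C \<phi> = E" by (auto simp: in_Hom)
  have \<phi>ky: "\<phi> \<bullet> (\<pi> \<bullet> (k' \<bullet> y)) = k' \<bullet> y" if "y \<in> Arr C" "Cod C y = Dom C k'" for y
    using Comp_eq_CompI[OF \<phi>k, of y] that by simp
  have \<phi>_mono: "is_mono C \<phi>"
  proof (rule ccontr)
    assume "\<not> is_mono C \<phi>"
    then have "\<not> null (ker \<phi>)" using mono_iff_ker by simp
    then obtain y w where yw: "y \<in> Arr C" "w \<in> Arr C" "Cod C y = Dom C k'" "Cod C w = Dom C (ker \<phi>)"
      "Dom C y = Dom C w" "\<pi> \<bullet> (k' \<bullet> y) = ker \<phi> \<bullet> w" "\<not> null (k' \<bullet> y)"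
      using essential[of "ker \<phi>"] by auto
    have "null (\<phi> \<bullet> ker \<phi> \<bullet> w)" by (rule null_Comp_right[OF ker(3)]) (use yw(1-5) in auto)
    also have "\<phi> \<bullet> ker \<phi> \<bullet> w = \<phi> \<bullet> (ker \<phi> \<bullet> w)" using yw(1-5) by simp
    also have "\<dots> = k' \<bullet> y" unfolding yw(6)[symmetric] by (rule \<phi>ky[OF yw(1,3)])
    finally show False using yw(7) by simp
  qed
  \<comment> \<open>A non-zero common part of \<open>\<phi>\<close> and \<open>l'\<close> has the
    form \<open>\<phi> \<bullet> z\<close> with \<open>z\<close> a non-zero subobject of
    \<open>Cod C \<pi>\<close>. By essentiality \<open>z\<close> meets \<open>k'\<close> there, and
    since \<open>\<phi>\<close> returns this meet to \<open>k'\<close> itself, \<open>k'\<close>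
    would meet \<open>l'\<close>.\<close>
  have "meet_zero \<phi> l'"
    unfolding meet_zero_def
  proof (intro allI impI, elim conjE, rule ccontr)
    fix x y assume [simp]: "x \<in> Arr C" "y \<in> Arr C" "Cod C x = Dom C \<phi>" "Cod C y = Dom C l'" "Dom C x = Dom C y"
      and eq: "\<phi> \<bullet> x = l' \<bullet> y" and nn: "\<not> null (\<phi> \<bullet> x)"
    obtain z e where ze: "is_mono C z" "is_epi C e" "z \<bullet> e = x" "Dom C z = Cod C e"
      "Cod C z = Cod C x" "Dom C e = Dom C x"
      by (rule image_factorization[of x]) auto
    have [simp]: "z \<in> Arr C" "e \<in> Arr C" "Dom C z = Cod C e" "Cod C z = Cod C \<pi>" "Dom C e = Dom C y" using ze by auto
    have "\<not> null z"
    proof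
      assume "null z"
      then have "null (z \<bullet> e)" by (rule null_Comp_right) auto
      then have "null (\<phi> \<bullet> x)" unfolding ze(3) by (rule null_Comp_left) auto
      then show False using nn by simp
    qed
    then obtain y' w where yw: "y' \<in> Arr C" "w \<in> Arr C" "Cod C y' = Dom C k'" "Cod C w = Dom C z"
      "Dom C y' = Dom C w" "\<pi> \<bullet> (k' \<bullet> y') = z \<bullet> w" "\<not> null (k' \<bullet> y')"
      using essential[OF ze(1)] by auto
    have "null (\<pi> \<bullet> l' \<bullet> y)" by (rule null_Comp_right[OF \<pi>l(1)]) auto
    also have "\<pi> \<bullet> l' \<bullet> y = \<pi> \<bullet> (l' \<bullet> y)" by simp
    also have "\<dots> = \<pi> \<bullet> \<phi> \<bullet> z \<bullet> e" unfolding eq[symmetric] ze(3)[symmetric] by simp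
    finally have "null (\<pi> \<bullet> \<phi> \<bullet> z)" by (subst (asm) epi_null_iff[OF ze(2)]) auto
    then have "subobject_le C (\<phi> \<bullet> z) l'"
      by (subst mono_le_iff[OF l'(1)]) (simp_all add: \<pi>_def)
    then obtain v where v: "v \<in> Arr C" "Dom C v = Dom C (\<phi> \<bullet> z)" "Cod C v = Dom C l'" "l' \<bullet> v = \<phi> \<bullet> z"
      by (rule subobject_leE)
    have "k' \<bullet> y' = \<phi> \<bullet> (z \<bullet> w)" unfolding yw(6)[symmetric] by (rule \<phi>ky[OF yw(1,3), symmetric])
    also have "\<dots> = l' \<bullet> (v \<bullet> w)"
      by (rule Comp_eq_Comp[OF v(4)[symmetric]]) (use v(1-3) yw(1-5) in auto)
    finally have "null (k' \<bullet> y')"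
      by (rule meet_zeroD[OF k'(4)]) (use v(1-3) yw(1-5) in auto)
    then show False using yw(7) by simp
  qed
  moreover have "subobject_le C k' \<phi>" by (rule subobject_leI[OF \<phi>k]) auto
  ultimately have "subobject_le C \<phi> k'" using k_max[OF \<phi>_mono] by simp
  then obtain r where r: "r \<in> Arr C" "Dom C r = Dom C \<phi>" "Cod C r = Dom C k'" "k' \<bullet> r = \<phi>"
    by (rule subobject_leE)
  have [simp]: "Dom C r = Cod C \<pi>" using r by simp
  have rk: "r \<bullet> \<pi> \<bullet> k' = Ident C (Dom C k')"
  proof (rule monoD[OF k'(1)])
    have "k' \<bullet> (r \<bullet> \<pi> \<bullet> k') = k' \<bullet> (r \<bullet> (\<pi> \<bullet> k'))" using r(1,3) by simp
    also have "\<dots> = \<phi> \<bullet> (\<pi> \<bullet> k')" by (rule Comp_eq_CompI[OF r(4)]) (use r(1,3) in auto)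
    finally show "k' \<bullet> (r \<bullet> \<pi> \<bullet> k') = k' \<bullet> Ident C (Dom C k')" unfolding \<phi>k by simp
  qed (use r(1,3) in auto)
  \<comment> \<open>Now \<open>r \<bullet> \<pi>\<close> retracts \<open>E\<close> onto
    \<open>k'\<close>. The complementary summand is its kernel, which contains \<open>l'\<close> and
    therefore \<open>l\<close>.\<close>
  let ?s = "ker (r \<bullet> \<pi>)"
  have s: "?s \<in> Arr C" "Cod C ?s = E" using r(1,3) by simp_all
  have "is_biproduct C E (Dom C k') (Dom C ?s)"
    by (rule split_mono_biproduct[OF _ _ rk]) (use r(1,3) in \<open>simp_all add: in_Hom\<close>)
  then have "is_zero_object C (Dom C k') \<or> is_zero_object C (Dom C ?s)"
    using E(2) s unfolding indecomposable_def by auto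
  then show ?thesis
  proof
    assume "is_zero_object C (Dom C k')"
    then have "null k'" by (rule zero_object_null) auto
    then have "null k" by (rule le_null[OF k'(3)]) auto
    then show ?thesis ..
  next
    assume "is_zero_object C (Dom C ?s)"
    then have sn: "null ?s" by (rule zero_object_null) (use s in auto)
    have "null (r \<bullet> (\<pi> \<bullet> l'))" by (rule null_Comp_left[OF \<pi>l(1)]) (use r(1,3) in auto)
    then have "subobject_le C l' ?s" by (subst le_ker_iff) (use r(1,3) in auto)
    then have "null l'" by (rule le_null[OF _ sn s(1)])
    then have "null l" by (rule le_null[OF l'(3)]) auto
    then show ?thesis ..
  qed
qed

end

section \<open>The Ziegler topology\<close>

context category
begin

lemma isomorphic_refl: "A \<in> Obj C \<Longrightarrow> isomorphic C A A"
  unfolding isomorphic_def using Ident_in_Hom[of A] Comp_Ident[OF Ident_in_Hom[of A]] by blast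

lemma isomorphic_sym: "isomorphic C A B \<Longrightarrow> isomorphic C B A"
  unfolding isomorphic_def by blast

lemma isomorphic_trans:
  assumes "isomorphic C A B" "isomorphic C B D"
  shows "isomorphic C A D"
proof -
  obtain f g where f: "f \<in> Hom C A B" "g \<in> Hom C B A" "g \<bullet> f = Ident C A" "f \<bullet> g = Ident C B"
    using assms(1) unfolding isomorphic_def by blast
  obtain f' g' where f': "f' \<in> Hom C B D" "g' \<in> Hom C D B" "g' \<bullet> f' = Ident C B" "f' \<bullet> g' = Ident C D"
    using assms(2) unfolding isomorphic_def by blast
  note H = f(1,2)[unfolded in_Hom] f'(1,2)[unfolded in_Hom]
  have "(g \<bullet> g') \<bullet> (f' \<bullet> f) = g \<bullet> (g' \<bullet> (f' \<bullet> f))" using H by simp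
  also have "g' \<bullet> (f' \<bullet> f) = Ident C B \<bullet> f" by (rule Comp_eq_CompI[OF f'(3)]) (use H in auto)
  also have "\<dots> = f" using H by simp
  finally have 1: "(g \<bullet> g') \<bullet> (f' \<bullet> f) = Ident C A" using f(3) by simp
  have "(f' \<bullet> f) \<bullet> (g \<bullet> g') = f' \<bullet> (f \<bullet> (g \<bullet> g'))" using H by simp
  also have "f \<bullet> (g \<bullet> g') = Ident C B \<bullet> g'" by (rule Comp_eq_CompI[OF f(4)]) (use H in auto)
  also have "\<dots> = g'" using H by simp
  finally have 2: "(f' \<bullet> f) \<bullet> (g \<bullet> g') = Ident C D" using f'(4) by simp
  have "f' \<bullet> f \<in> Hom C A D" "g \<bullet> g' \<in> Hom C D A" using H by (simp_all add: in_Hom)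
  moreover have "A \<in> Obj C" "D \<in> Obj C" using assms by (auto simp: isomorphic_def)
  ultimately show ?thesis unfolding isomorphic_def using 1 2 by blast
qed

definition iso_class :: "'o \<Rightarrow> 'o set" where
  "iso_class E = {F. isomorphic C E F}"

text \<open>The relation in \<open>InjSpec\<close> is isomorphism on all objects, so a point is the
  full isomorphism class of any of its representatives.\<close>

lemma InjSpec_eq: "InjSpec C = iso_class ` {E. injective_object C E \<and> indecomposable C E}"
  unfolding InjSpec_def quotient_def iso_class_def Image_singleton by auto

lemma InjSpecE:
  assumes "e \<in> InjSpec C"
  obtains E where "injective_object C E" "indecomposable C E" "e = iso_class E"
  using assms unfolding InjSpec_eq by blast

lemma iso_class_eqI:
  assumes "isomorphic C A B"
  shows "iso_class A = iso_class B"
  unfolding iso_class_def using assms isomorphic_trans isomorphic_sym by blast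

end

context preadditive_category
begin

text \<open>A non-zero arrow to any member of the class stays non-zero when followed by an
  isomorphism to \<open>E\<close>, so a fixed representative decides membership.\<close>

lemma iso_class_in_ziegler_basic:
  assumes "injective_object C E" "indecomposable C E"
  shows "iso_class E \<in> ziegler_basic C A \<longleftrightarrow> (\<exists>f. f \<in> Arr C \<and> Dom C f = A \<and> Cod C f = E \<and> \<not> null f)"
proof
  assume "iso_class E \<in> ziegler_basic C A"
  then obtain F f where F: "isomorphic C E F" "f \<in> Hom C A F" "f \<noteq> Zero C A F"
    unfolding ziegler_basic_def iso_class_def by blast
  obtain u v where uv: "u \<in> Hom C E F" "v \<in> Hom C F E" "u \<bullet> v = Ident C F"
    using F(1) unfolding isomorphic_def by blast
  note H = F(2)[unfolded in_Hom] uv(1,2)[unfolded in_Hom]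
  have "\<not> null (v \<bullet> f)"
  proof
    assume "null (v \<bullet> f)"
    then have "null (u \<bullet> (v \<bullet> f))" by (rule null_Comp_left) (use H in auto)
    also have "u \<bullet> (v \<bullet> f) = Ident C F \<bullet> f" by (rule Comp_eq_CompI[OF uv(3)]) (use H in auto)
    also have "\<dots> = f" using H by simp
    finally show False using F(3) H by (simp add: null_def)
  qed
  then show "\<exists>f. f \<in> Arr C \<and> Dom C f = A \<and> Cod C f = E \<and> \<not> null f"
    by (intro exI[of _ "v \<bullet> f"]) (use H in auto)
next
  assume "\<exists>f. f \<in> Arr C \<and> Dom C f = A \<and> Cod C f = E \<and> \<not> null f"
  then obtain f where f: "f \<in> Hom C A E" "f \<noteq> Zero C A E" by (auto simp: in_Hom null_def)
  have "E \<in> iso_class E" unfolding iso_class_def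
    using isomorphic_refl assms(1) by (simp add: injective_object_def)
  then show "iso_class E \<in> ziegler_basic C A"
    unfolding ziegler_basic_def InjSpec_eq using assms f by blast
qed

lemma ziegler_basic_subset: "ziegler_basic C A \<subseteq> InjSpec C"
  unfolding ziegler_basic_def by blast

lemma injective_extend:
  assumes "injective_object C E" "is_mono C m" "f \<in> Arr C" "Dom C f = Dom C m" "Cod C f = E"
  obtains g where "g \<in> Arr C" "Dom C g = Cod C m" "Cod C g = E" "g \<bullet> m = f"
proof -
  have "f \<in> Hom C (Dom C m) E" using assms by (simp add: in_Hom)
  then obtain g where "g \<in> Hom C (Cod C m) E" "g \<bullet> m = f"
    using assms(1,2) unfolding injective_object_def by blast
  then show thesis using that by (auto simp: in_Hom)
qed

text \<open>A non-zero arrow on the subobject extends to \<open>B\<close> because its target is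
  injective.\<close>

lemma ziegler_basic_mono:
  assumes "is_mono C t" "Cod C t = B"
  shows "ziegler_basic C (Dom C t) \<subseteq> ziegler_basic C B"
proof
  fix e assume e: "e \<in> ziegler_basic C (Dom C t)"
  then obtain F where F: "injective_object C F" "indecomposable C F" "e = iso_class F"
    using ziegler_basic_subset by (blast elim: InjSpecE)
  note iff = iso_class_in_ziegler_basic[OF F(1,2), folded F(3)]
  obtain u where u: "u \<in> Arr C" "Dom C u = Dom C t" "Cod C u = F" "\<not> null u"
    using e unfolding iff by blast
  obtain g where g: "g \<in> Arr C" "Dom C g = Cod C t" "Cod C g = F" "g \<bullet> t = u"
    by (rule injective_extend[OF F(1) assms(1) u(1-3)])
  have "\<not> null g"
    using null_Comp_right[of g t] g u(4) assms by auto
  then show "e \<in> ziegler_basic C B" unfolding iff using g assms by blast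
qed

text \<open>Precomposition with an epi keeps arrows non-zero.\<close>

lemma ziegler_basic_epi:
  assumes "is_epi C p" "Dom C p = A"
  shows "ziegler_basic C (Cod C p) \<subseteq> ziegler_basic C A"
proof
  fix e assume e: "e \<in> ziegler_basic C (Cod C p)"
  then obtain F where F: "injective_object C F" "indecomposable C F" "e = iso_class F"
    using ziegler_basic_subset by (blast elim: InjSpecE)
  note iff = iso_class_in_ziegler_basic[OF F(1,2), folded F(3)]
  obtain u where u: "u \<in> Arr C" "Dom C u = Cod C p" "Cod C u = F" "\<not> null u"
    using e unfolding iff by blast
  have "\<not> null (u \<bullet> p)" using epi_null_iff[OF assms(1) u(1,2)] u(4) by simp
  then show "e \<in> ziegler_basic C A" unfolding iff
    by (intro exI[of _ "u \<bullet> p"]) (use u assms in auto)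
qed

end

section \<open>The topology of a locally noetherian category and its generic points\<close>

locale locally_noetherian_category = grothendieck_category U C
  for U :: "'u set" and C :: "('o, 'm) cat" (structure) +
  assumes locally_noetherian: "locally_noetherian U C"
begin

definition gens :: "'o set" where
  "gens = (SOME \<G>. generating_set U C \<G> \<and> (\<forall>G\<in>\<G>. noetherian C G))"

lemma gens: "generating_set U C gens" "G \<in> gens \<Longrightarrow> noetherian C G"
proof -
  have "\<exists>\<G>. generating_set U C \<G> \<and> (\<forall>G\<in>\<G>. noetherian C G)"
    using locally_noetherian unfolding locally_noetherian_def .
  from someI_ex[OF this]
  show "generating_set U C gens" "G \<in> gens \<Longrightarrow> noetherian C G"
    unfolding gens_def by blast+
qed

lemmas noetherian_fp = noetherian_finitely_presented[OF gens]
  and detect = generating_set_detects[OF gens(1)]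
  and uniform = indecomposable_injective_uniform[OF gens]

text \<open>Non-zero arrows from \<open>A\<close> and \<open>B\<close> to \<open>E\<close> need not
  be monic, so both objects are replaced by their images. These meet by uniformity, and a generator
  that maps non-trivially into the meet has as its image in \<open>E\<close> a noetherian subobject,
  which embeds in both.\<close>

lemma ziegler_basic_Int:
  assumes "e \<in> ziegler_basic C A" "e \<in> ziegler_basic C B"
  obtains D where "noetherian C D" "e \<in> ziegler_basic C D"
    "ziegler_basic C D \<subseteq> ziegler_basic C A \<inter> ziegler_basic C B"
proof -
  obtain E where E: "injective_object C E" "indecomposable C E" "e = iso_class E"
    using assms(1) ziegler_basic_subset by (blast elim: InjSpecE)
  note iff = iso_class_in_ziegler_basic[OF E(1,2), folded E(3)]
  have img: "\<exists>m. is_mono C m \<and> Cod C m = E \<and> \<not> null m \<and> ziegler_basic C (Dom C m) \<subseteq> ziegler_basic C A"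
    if in_basic: "e \<in> ziegler_basic C A" for A
  proof -
    obtain f where f: "f \<in> Arr C" "Dom C f = A" "Cod C f = E" "\<not> null f"
      using in_basic iff by blast
    obtain m p where mp: "is_mono C m" "is_epi C p" "m \<bullet> p = f" "Dom C m = Cod C p"
      "Cod C m = Cod C f" "Dom C p = Dom C f" by (rule image_factorization[OF f(1)])
    have "\<not> null m" using null_Comp_right[of m p] mp f(4) by auto
    moreover have "ziegler_basic C (Dom C m) \<subseteq> ziegler_basic C A"
      using ziegler_basic_epi[OF mp(2), of A] mp f by simp
    ultimately show ?thesis using mp(1) mp(5)[unfolded f(3)] by blast
  qed
  obtain m where m: "is_mono C m" "Cod C m = E" "\<not> null m" "ziegler_basic C (Dom C m) \<subseteq> ziegler_basic C A"
    using img[OF assms(1)] by blast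
  obtain n where n: "is_mono C n" "Cod C n = E" "\<not> null n" "ziegler_basic C (Dom C n) \<subseteq> ziegler_basic C B"
    using img[OF assms(2)] by blast
  have mn: "m \<in> Arr C" "n \<in> Arr C" using m n by auto
  have "\<not> meet_zero m n" using uniform[OF _ E(1,2) m(1,2) n(1,2)] m(3) n(3) by blast
  then obtain x y where xy: "x \<in> Arr C" "y \<in> Arr C" "Cod C x = Dom C m" "Cod C y = Dom C n"
    "Dom C x = Dom C y" "m \<bullet> x = n \<bullet> y" "\<not> null (m \<bullet> x)"
    unfolding meet_zero_def by blast
  obtain h where h: "Dom C h \<in> gens" "h \<in> Arr C" "Cod C h = Dom C (m \<bullet> x)" "\<not> null (m \<bullet> x \<bullet> h)"
    by (rule detect[of "m \<bullet> x"]) (use xy mn in auto)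
  have hx: "Cod C h = Dom C x" using h xy mn by simp
  define v where "v = m \<bullet> (x \<bullet> h)"
  have v: "v \<in> Arr C" "Dom C v = Dom C h" "Cod C v = E" "\<not> null v"
    using h(2,4) hx xy(1,3) mn m(2) by (simp_all add: v_def)
  have v_n: "v = n \<bullet> (y \<bullet> h)"
    unfolding v_def by (rule Comp_eq_Comp[OF xy(6)]) (use h(2) hx xy mn in auto)
  obtain w p where wp: "is_mono C w" "is_epi C p" "w \<bullet> p = v" "Dom C w = Cod C p"
      "Cod C w = Cod C v" "Dom C p = Dom C v" by (rule image_factorization[OF v(1)])
  have wp': "w \<in> Arr C" "p \<in> Arr C" using wp by auto
  \<comment> \<open>The image \<open>w\<close> of \<open>v\<close> is the least subobject through
    which \<open>v\<close> factors: \<open>coker k\<close> kills \<open>v = w \<bullet> p\<close>,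
    and \<open>p\<close> is epi.\<close>
  have through: "\<exists>t. is_mono C t \<and> Dom C t = Dom C w \<and> Cod C t = Dom C k"
    if k: "is_mono C k" "Cod C k = E" and z: "v = k \<bullet> z" "z \<in> Arr C" "Cod C z = Dom C k" for k z
  proof -
    have k': "k \<in> Arr C" using k by simp
    have "subobject_le C v k" by (rule subobject_leI[OF z(1)[symmetric]]) (use k' z in auto)
    then have "null (coker k \<bullet> v)" by (subst (asm) mono_le_iff[OF k(1)]) (use k v in auto)
    moreover have "coker k \<bullet> v = (coker k \<bullet> w) \<bullet> p"
      unfolding wp(3)[symmetric] using wp wp' v k' k by simp
    ultimately have "null ((coker k \<bullet> w) \<bullet> p)" by simp
    then have "null (coker k \<bullet> w)"
      by (subst (asm) epi_null_iff[OF wp(2)]) (use wp wp' v k' k in auto)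
    then have "subobject_le C w k" by (subst mono_le_iff[OF k(1)]) (use wp wp' v k in auto)
    then obtain t where t: "t \<in> Arr C" "Dom C t = Dom C w" "Cod C t = Dom C k" "k \<bullet> t = w"
      by (rule subobject_leE)
    have "is_mono C t"
    proof (rule monoI[OF t(1)])
      fix x assume x: "x \<in> Arr C" "Cod C x = Dom C t" "null (t \<bullet> x)"
      have "null (k \<bullet> (t \<bullet> x))" by (rule null_Comp_left[OF x(3)]) (use x t k' in auto)
      also have "k \<bullet> (t \<bullet> x) = w \<bullet> x" by (rule Comp_eq_CompI[OF t(4)]) (use x t k' in auto)
      finally show "null x" by (subst (asm) mono_null_iff[OF wp(1)]) (use x t in auto)
    qed
    then show ?thesis using t by blast
  qed
  show thesis
  proof (rule that)
    have "noetherian C (Cod C p)" by (rule noetherian_Cod_epi[OF wp(2)]) (use wp v h gens(2) in auto)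
    then show "noetherian C (Dom C w)" using wp by simp
    have "\<not> null w" using null_Comp_right[of w p] wp wp' v(4) by auto
    then show "e \<in> ziegler_basic C (Dom C w)"
      unfolding iff by (intro exI[of _ w]) (use wp(5) wp' v(3) in simp)
    obtain t where "is_mono C t" "Dom C t = Dom C w" "Cod C t = Dom C m"
      using through[OF m(1,2) v_def] xy h hx by auto
    then have "ziegler_basic C (Dom C w) \<subseteq> ziegler_basic C (Dom C m)"
      using ziegler_basic_mono by metis
    moreover obtain t where "is_mono C t" "Dom C t = Dom C w" "Cod C t = Dom C n"
      using through[OF n(1,2) v_n] xy h hx by auto
    then have "ziegler_basic C (Dom C w) \<subseteq> ziegler_basic C (Dom C n)"
      using ziegler_basic_mono by metis
    ultimately show "ziegler_basic C (Dom C w) \<subseteq> ziegler_basic C A \<inter> ziegler_basic C B"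
      using m(4) n(4) by blast
  qed
qed

text \<open>The constructor \<open>topology\<close> returns the given family only if that family
  satisfies the axioms of a topology. For unions of basic sets these reduce to finding a basic
  neighbourhood of each point inside the intersection of two basic sets.\<close>

lemma openin_ziegler: "openin (ziegler_topology U C) =
    arbitrary union_of (\<lambda>V. \<exists>A. finitely_presented U C A \<and> V = ziegler_basic C A)"
  unfolding ziegler_topology_def
proof (rule topology_inverse', unfold istopology_base_eq, intro allI impI, elim conjE exE)
  fix S T A B assume "S = ziegler_basic C A" "T = ziegler_basic C B"
  then have "\<exists>D. finitely_presented U C D \<and> e \<in> ziegler_basic C D \<and> ziegler_basic C D \<subseteq> S \<inter> T"
    if "e \<in> S \<inter> T" for e
    using ziegler_basic_Int[of e A B] noetherian_fp that by (metis IntE)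
  then show "(arbitrary union_of (\<lambda>V. \<exists>A. finitely_presented U C A \<and> V = ziegler_basic C A)) (S \<inter> T)"
    unfolding arbitrary_union_of_alt by blast
qed

lemma openin_ziegler_basic: "noetherian C A \<Longrightarrow> openin (ziegler_topology U C) (ziegler_basic C A)"
  unfolding openin_ziegler by (rule union_of_inc) (use noetherian_fp in \<open>auto simp: arbitrary_def\<close>)

lemma topspace_ziegler_subset: "topspace (ziegler_topology U C) \<subseteq> InjSpec C"
proof -
  have "openin (ziegler_topology U C) (topspace (ziegler_topology U C))" by simp
  then show ?thesis
    unfolding openin_ziegler arbitrary_union_of_alt using ziegler_basic_subset by blast
qed

text \<open>Extend \<open>g\<close> along \<open>f\<close> to \<open>h\<close> from \<open>E\<close>
  to \<open>F\<close>. As \<open>h \<bullet> f = g\<close> is monic, \<open>ker h\<close> is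
  disjoint from \<open>f\<close>, hence zero by uniformity. The mono \<open>h\<close> splits because
  \<open>E\<close> is injective, and indecomposability of \<open>F\<close> makes the complement
  zero.\<close>

lemma injective_over_common_subobject:
  assumes E: "injective_object C E" "indecomposable C E" and F: "injective_object C F" "indecomposable C F"
    and f: "is_mono C f" "Cod C f = E" and g: "is_mono C g" "Cod C g = F" and "Dom C f = Dom C g" "\<not> null f"
  shows "isomorphic C E F"
proof -
  have [simp]: "f \<in> Arr C" "g \<in> Arr C" "Cod C f = E" "Cod C g = F" "Dom C g = Dom C f"
    using f g assms(9) by auto
  have EF [simp]: "E \<in> Obj C" "F \<in> Obj C" using E(1) F(1) by (auto simp: injective_object_def)
  obtain h where h [simp]: "h \<in> Arr C" "Dom C h = Cod C f" "Cod C h = F" and hf: "h \<bullet> f = g"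
    by (rule injective_extend[OF F(1) f(1), of g]) auto
  have "meet_zero f (ker h)"
    unfolding meet_zero_def
  proof (intro allI impI, elim conjE)
    fix x y assume [simp]: "x \<in> Arr C" "y \<in> Arr C" "Cod C x = Dom C f" "Cod C y = Dom C (ker h)" "Dom C x = Dom C y"
      and eq: "f \<bullet> x = ker h \<bullet> y"
    have "null (h \<bullet> ker h \<bullet> y)" by (rule null_Comp_right[OF ker(3)]) auto
    also have "h \<bullet> ker h \<bullet> y = h \<bullet> (f \<bullet> x)" unfolding eq by simp
    also have "\<dots> = g \<bullet> x" by (rule Comp_eq_CompI[OF hf]) auto
    finally have "null x" by (subst (asm) mono_null_iff[OF g(1)]) auto
    then show "null (f \<bullet> x)" by (rule null_Comp_left) auto
  qed
  then have "null (ker h)" using uniform[OF _ E f(1,2), of "ker h"] assms(10) by simp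
  then have h_mono: "is_mono C h" by (simp add: mono_iff_ker)
  obtain r where r [simp]: "r \<in> Arr C" "Dom C r = F" "Cod C r = E" and rh: "r \<bullet> h = Ident C E"
    by (rule injective_extend[OF E(1) h_mono, of "Ident C E"]) auto
  have "is_biproduct C F E (Dom C (ker r))"
    by (rule split_mono_biproduct[OF _ _ rh]) (simp_all add: in_Hom)
  then have "is_zero_object C E \<or> is_zero_object C (Dom C (ker r))"
    using F(2) unfolding indecomposable_def by auto
  then have "null (ker r)"
    using E(2) zero_object_null[of "Dom C (ker r)" "ker r"] unfolding indecomposable_def by auto
  then have r_mono: "is_mono C r" by (simp add: mono_iff_ker)
  have "h \<bullet> r = Ident C F"
  proof (rule monoD[OF r_mono])
    have "r \<bullet> (h \<bullet> r) = Ident C E \<bullet> r" by (rule Comp_eq_CompI[OF rh]) auto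
    then show "r \<bullet> (h \<bullet> r) = r \<bullet> Ident C F" by simp
  qed auto
  moreover have "h \<in> Hom C E F" "r \<in> Hom C F E" by (simp_all add: in_Hom)
  ultimately show ?thesis unfolding isomorphic_def using rh EF by blast
qed

text \<open>
  Modulo the torsion class of all objects \<open>N\<close> with \<open>Hom(N, E) = 0\<close> for every \<open>E\<close> in \<open>S\<close>, the object
  \<open>A\<close> found here is simple.
\<close>

lemma isolated_point:
  assumes "S \<subseteq> InjSpec C" "S \<noteq> {}"
  obtains A p where "noetherian C A" "ziegler_basic C A \<inter> S = {p}"
proof -
  have arrow_to: "\<exists>E. injective_object C E \<and> indecomposable C E \<and> iso_class E \<in> S" using assms
    by (metis InjSpecE ex_in_conv subsetD)
  then obtain E where E: "injective_object C E" "indecomposable C E" "iso_class E \<in> S" by blast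
  have EO: "E \<in> Obj C" using E(1) by (simp add: injective_object_def)
  have "\<not> null (Ident C E)" using E(2) EO zero_object_iff by (simp add: indecomposable_def)
  then obtain h where h: "Dom C h \<in> gens" "h \<in> Arr C" "Cod C h = Dom C (Ident C E)" "\<not> null (Ident C E \<bullet> h)"
    by (rule detect[rotated]) (use EO in auto)
  define G where "G = Dom C h"
  have h': "Cod C h = E" "\<not> null h" using h EO by auto
  have G: "noetherian C G" using gens(2) h by (simp add: G_def)
  have GO: "G \<in> Obj C" using h by (simp add: G_def)
  define hits where "hits M \<longleftrightarrow> (\<exists>F f. injective_object C F \<and> indecomposable C F \<and> iso_class F \<in> S \<and>
    f \<in> Arr C \<and> Dom C f = M \<and> Cod C f = F \<and> \<not> null f)" for M
  define \<S> where "\<S> = {k. is_mono C k \<and> Cod C k = G \<and> hits (Cod C (coker k))}"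
  have hits_coker: "hits (Cod C (coker k))"
    if hyps: "injective_object C F" "indecomposable C F" "iso_class F \<in> S" "k \<in> Arr C" "u \<in> Arr C"
      "Dom C u = Cod C k" "Cod C u = F" "null (u \<bullet> k)" "\<not> null u" for F u k
  proof -
    obtain y where y: "y \<in> Arr C" "Dom C y = Cod C (coker k)" "Cod C y = Cod C u" "y \<bullet> coker k = u"
      by (rule coker_factor[of u k]) (use hyps in auto)
    have "\<not> null y" using null_Comp_right[of y "coker k"] y hyps(4,9) by auto
    then show ?thesis unfolding hits_def using hyps(1-3,7) y by metis
  qed
  \<comment> \<open>The zero subobject starts the search: the arrow \<open>h\<close> shows that its
    quotient still maps non-trivially to \<open>E\<close>.\<close>
  have k0: "ker (Ident C G) \<in> \<S>"
  proof -
    have kG: "ker (Ident C G) \<in> Arr C" "Cod C (ker (Ident C G)) = G" using GO by simp_all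
    have "null (h \<bullet> ker (Ident C G))"
      by (rule null_Comp_left[OF null_ker_Ident[OF GO]]) (use kG h(2) in \<open>simp_all add: G_def\<close>)
    then have "hits (Cod C (coker (ker (Ident C G))))"
      by (intro hits_coker[OF E kG(1) h(2) _ h'(1)]) (use kG h' in \<open>simp_all add: G_def\<close>)
    then show ?thesis using GO by (simp add: \<S>_def)
  qed
  obtain k where "k \<in> \<S>" and max: "\<And>k'. \<lbrakk>k' \<in> \<S>; subobject_le C k k'\<rbrakk> \<Longrightarrow> subobject_le C k' k"
    by (rule noetherian_maximal[OF G k0]) (auto simp: \<S>_def)
  then have k: "is_mono C k" "Cod C k = G" "hits (Cod C (coker k))" "k \<in> Arr C" by (auto simp: \<S>_def)
  define c where "c = coker k"
  have c: "c \<in> Arr C" "Dom C c = G" "is_epi C c" "null (c \<bullet> k)" using k by (auto simp: c_def)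
  define M where "M = Cod C c"
  have M: "noetherian C M" unfolding M_def by (rule noetherian_Cod_epi[OF c(3)]) (use c G in auto)
  \<comment> \<open>The kernel of \<open>f \<bullet> c\<close> contains \<open>k\<close>, and its
    quotient still maps non-trivially to \<open>F\<close> by the arrow that
    \<open>f \<bullet> c\<close> induces. Maximality makes it equal to \<open>k\<close> as a
    subobject, so \<open>f\<close> has zero kernel on \<open>M\<close>.\<close>
  have f_mono: "is_mono C f"
    if F: "injective_object C F" "indecomposable C F" "iso_class F \<in> S"
      and f: "f \<in> Arr C" "Dom C f = M" "Cod C f = F" "\<not> null f" for F f
  proof (rule mono_of_same_kernel[OF c(3) f(1)])
    show "Dom C f = Cod C c" using f by (simp add: M_def)
    define k' where "k' = ker (f \<bullet> c)"
    have fc: "f \<bullet> c \<in> Arr C" "Dom C (f \<bullet> c) = G" "Cod C (f \<bullet> c) = F" using f c by (auto simp: M_def)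
    have k': "is_mono C k'" "Cod C k' = G" "k' \<in> Arr C" "null (f \<bullet> c \<bullet> k')" using fc by (auto simp: k'_def)
    have "\<not> null (f \<bullet> c)" by (subst epi_null_iff[OF c(3)]) (use f in \<open>auto simp: M_def\<close>)
    then have "hits (Cod C (coker k'))"
      by (intro hits_coker[OF F, of _ "f \<bullet> c"]) (use fc k' in auto)
    then have k'S: "k' \<in> \<S>" using k' by (simp add: \<S>_def)
    have "null (f \<bullet> (c \<bullet> k))" by (rule null_Comp_left[OF c(4)]) (use f c k in \<open>auto simp: M_def\<close>)
    then have "null (f \<bullet> c \<bullet> k)" using f c k by (simp add: M_def)
    then have "subobject_le C k k'" unfolding k'_def by (subst le_ker_iff) (use fc k in auto)
    then have kk: "subobject_le C k' k" by (rule max[OF k'S])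
    fix x assume x: "x \<in> Arr C" "Cod C x = Dom C c" "null (f \<bullet> (c \<bullet> x))"
    have "null (f \<bullet> c \<bullet> x)" using x f c by (simp add: M_def)
    then have "subobject_le C x k'" unfolding k'_def by (subst le_ker_iff) (use fc x c in auto)
    then have "subobject_le C x k" by (rule subobject_le_trans[OF _ kk k'(3) k(4)])
    then show "null (c \<bullet> x)" unfolding c_def
      by (subst (asm) mono_le_iff[OF k(1)]) (use x c k in \<open>auto simp: c_def[symmetric]\<close>)
  qed
  obtain F f where F: "injective_object C F" "indecomposable C F" "iso_class F \<in> S"
    and f: "f \<in> Arr C" "Dom C f = M" "Cod C f = F" "\<not> null f"
    using k(3) unfolding hits_def M_def c_def by blast
  have "ziegler_basic C M \<inter> S = {iso_class F}"
  proof
    have "iso_class F \<in> ziegler_basic C M"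
      unfolding iso_class_in_ziegler_basic[OF F(1,2)] using f by blast
    then show "{iso_class F} \<subseteq> ziegler_basic C M \<inter> S" using F(3) by simp
    show "ziegler_basic C M \<inter> S \<subseteq> {iso_class F}"
    proof
      fix e assume e: "e \<in> ziegler_basic C M \<inter> S"
      then obtain F' where F': "injective_object C F'" "indecomposable C F'" "e = iso_class F'"
        using assms(1) by (blast elim: InjSpecE)
      then obtain f' where f': "f' \<in> Arr C" "Dom C f' = M" "Cod C f' = F'" "\<not> null f'"
        using e iso_class_in_ziegler_basic[OF F'(1,2), of M] by auto
      have "is_mono C f'" by (rule f_mono[OF F'(1,2) _ f']) (use e F'(3) in simp)
      then have "isomorphic C F F'"
        by (intro injective_over_common_subobject[OF F(1,2) F'(1,2), of f f'])
           (use f_mono[OF F f] f f' in auto)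
      then show "e \<in> {iso_class F}" using iso_class_eqI F'(3) by simp
    qed
  qed
  then show thesis by (rule that[OF M])
qed

lemma sober: "sober_space (ziegler_topology U C)"
  unfolding sober_space_def
proof (intro allI impI)
  let ?T = "ziegler_topology U C"
  fix S assume S: "irreducible_closed_in ?T S"
  then have closed: "closedin ?T S" and "S \<noteq> {}" and
    irr: "\<And>F G. \<lbrakk>closedin ?T F; closedin ?T G; S = F \<union> G\<rbrakk> \<Longrightarrow> S = F \<or> S = G"
    unfolding irreducible_closed_in_def by blast+
  have S_top: "S \<subseteq> topspace ?T" using closed by (rule closedin_subset)
  obtain A p where A: "noetherian C A" and p: "ziegler_basic C A \<inter> S = {p}"
    by (rule isolated_point[of S]) (use S_top topspace_ziegler_subset \<open>S \<noteq> {}\<close> in auto)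
  note op = openin_ziegler_basic[OF A]
  have pT: "p \<in> topspace ?T" using p S_top by blast
  have 1: "?T closure_of {p} \<subseteq> S" by (rule closure_of_minimal[OF _ closed]) (use p in blast)
  have 2: "p \<in> ?T closure_of {p}" using closure_of_subset[of "{p}" ?T] pT by simp
  \<comment> \<open>Both pieces are closed, the second because \<open>ziegler_basic C A\<close> is
    open. As the second misses \<open>p\<close>, irreducibility selects the closure.\<close>
  have "S = ?T closure_of {p} \<union> (S - ziegler_basic C A)"
  proof
    show "S \<subseteq> ?T closure_of {p} \<union> (S - ziegler_basic C A)"
    proof
      fix x assume x: "x \<in> S"
      show "x \<in> ?T closure_of {p} \<union> (S - ziegler_basic C A)"
      proof (cases "x \<in> ziegler_basic C A")
        case True
        then have "x = p" using p x by blast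
        then show ?thesis using 2 by simp
      qed (use x in simp)
    qed
  qed (use 1 in blast)
  then have "S = ?T closure_of {p} \<or> S = S - ziegler_basic C A"
    by (intro irr) (use closed op in auto)
  then have S_eq: "S = ?T closure_of {p}" using p by blast
  show "\<exists>!p. p \<in> topspace ?T \<and> S = ?T closure_of {p}"
  proof (rule ex1I[of _ p])
    fix q assume q: "q \<in> topspace ?T \<and> S = ?T closure_of {q}"
    then have "q \<in> S" using closure_of_subset[of "{q}" ?T] by simp
    \<comment> \<open>An open set that meets the closure of \<open>q\<close> contains
      \<open>q\<close>; here it meets the closure in \<open>p\<close>.\<close>
    moreover have "q \<in> ziegler_basic C A"
      using openin_Int_closure_of_eq_empty[OF op, of "{q}"] q p by auto
    ultimately show "q = p" using p by blast
  qed (use pT S_eq in blast)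
qed

end

theorem corollary3p11:
  fixes U :: "'u set" and C :: "('o, 'm) cat"
  assumes "grothendieck_category U C"
    and "locally_noetherian U C"
  shows "sober_space (ziegler_topology U C)"
proof -
  interpret locally_noetherian_category U C
    using assms by (simp add: locally_noetherian_category_def locally_noetherian_category_axioms_def)
  show ?thesis by (rule sober)
qed

end
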